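(* Let $(M,\nabla,\langle\cdot,\cdot\rangle)$ be an affine-Riemann manifold. If $\mathrm{tr}_{\langle,\rangle}(\gamma^* )=0$ then, for every vector field $X$ on $M$, $\mathrm{tr}_{\langle,\rangle}(D_X(\gamma^* ))=0$. In particular, if $\mathrm{tr}_{\langle,\rangle}(\gamma^* )=0$ then the Chern Ricci form $\rho^C$ of the canonical Hermitian structure $(TM,J_1,g_1)$ vanishes.
   Context: An affine-Riemann manifold $(M,\nabla,\langle\cdot,\cdot\rangle)$ is a manifold with a flat torsionless connection $\nabla$ and a Riemannian metric. $D$ is the Levi-Civita connection of the metric; the difference tensor is $\gamma_XY=D_XY-\nabla_XY$ and $\gamma^*$ is defined by $\langle\gamma^*_XY,Z\rangle=\langle Y,\gamma_XZ\rangle$; $D_X(\gamma^* )(Y,Z)=D_X(\gamma^*_YZ)-\gamma^*_{D_XY}Z-\gamma^*_YD_XZ$. For a local orthonormal frame $(E_i)$, $\mathrm{tr}_{\langle,\rangle}(\gamma^* )=\sum_i\gamma^*_{E_i}E_i$ and $\mathrm{tr}_{\langle,\rangle}(D_X(\gamma^* ))=\sum_iD_X(\gamma^* )(E_i,E_i)$. Canonical Hermitian structure: $\pi_1:TM\to M$ is the projection; for a vector field $X$ on $M$, $X^h$ is the horizontal lift with respect to $\nabla$ and $X^v$ the vertical lift; $J_1X^h=X^v$, $J_1X^v=-X^h$; $g_1(X^h,Y^h)=g_1(X^v,Y^v)=\langle X,Y\rangle\circ\pi_1$, $g_1(X^h,Y^v)=0$. For a Hermitian manifold $(N,J,g)$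 of real dimension $2n$ with $\omega=g(J\cdot,\cdot)$ and Levi-Civita connection $\nabla^{LC}$, the Chern connection is $g(\nabla^C_XY,Z)=g(\nabla^{LC}_XY,Z)-\frac12d\omega(JX,Y,Z)$ (the unique connection preserving $J$ and $g$ whose torsion has trivial $(1,1)$-component). With $R^C(X,Y)=\nabla^C_{[X,Y]}-\nabla^C_X\nabla^C_Y+\nabla^C_Y\nabla^C_X$, its Ricci form is $\rho^C(X,Y)=\frac12\sum_{i=1}^{2n}g(R^C(X,Y)E_i,JE_i)$ for a local $g$-orthonormal frame. *)

theory Defs
  imports "HOL-Analysis.Analysis" "HOL-Library.Function_Algebras"
begin

section \<open>Smooth manifolds\<close>

text \<open>Both notions are meant for open \<open>S\<close>.\<close>

primrec Ck_on :: "nat \<Rightarrow> 'a::euclidean_space set \<Rightarrow> ('a \<Rightarrow> 'b::real_normed_vector) \<Rightarrow> bool" where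
  "Ck_on 0 S f \<longleftrightarrow> continuous_on S f"
| "Ck_on (Suc k) S f \<longleftrightarrow>
     f differentiable_on S \<and> (\<forall>v. Ck_on k S (\<lambda>x. frechet_derivative f (at x) v))"

definition smooth_on :: "'a::euclidean_space set \<Rightarrow> ('a \<Rightarrow> 'b::real_normed_vector) \<Rightarrow> bool" where
  "smooth_on S f \<longleftrightarrow> (\<forall>k. Ck_on k S f)"

text \<open>An atlas is an indexed family of charts \<open>(cdom i, chart i)\<close>, \<open>i \<in> idx\<close>, modelled on the
  Euclidean space \<open>'e\<close>. The underlying set and its topology are determined by the atlas.\<close>

record ('i, 'm, 'e) atlas =
  idx :: "'i set"
  cdom :: "'i \<Rightarrow> 'm set"
  chart :: "'i \<Rightarrow> 'm \<Rightarrow> 'e"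

definition carrier_of :: "('i, 'm, 'e) atlas \<Rightarrow> 'm set" where
  "carrier_of M = (\<Union>i\<in>idx M. cdom M i)"

definition charts_at :: "('i, 'm, 'e) atlas \<Rightarrow> 'm \<Rightarrow> 'i set" where
  "charts_at M p = {i \<in> idx M. p \<in> cdom M i}"

definition param :: "('i, 'm, 'e) atlas \<Rightarrow> 'i \<Rightarrow> 'e \<Rightarrow> 'm" where
  "param M i = inv_into (cdom M i) (chart M i)"

definition transition :: "('i, 'm, 'e) atlas \<Rightarrow> 'i \<Rightarrow> 'i \<Rightarrow> 'e \<Rightarrow> 'e" where
  "transition M i j = chart M j \<circ> param M i"

definition mopen :: "('i, 'm, 'e::euclidean_space) atlas \<Rightarrow> 'm set \<Rightarrow> bool" where
  "mopen M U \<longleftrightarrow> U \<subseteq> carrier_of M \<and> (\<forall>i\<in>idx M. open (chart M i ` (U \<inter> cdom M i)))"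

definition smooth_manifold :: "('i, 'm, 'e::euclidean_space) atlas \<Rightarrow> bool" where
  "smooth_manifold M \<longleftrightarrow>
     (\<forall>i\<in>idx M. inj_on (chart M i) (cdom M i) \<and> open (chart M i ` cdom M i)) \<and>
     (\<forall>i\<in>idx M. \<forall>j\<in>idx M.
        open (chart M i ` (cdom M i \<inter> cdom M j)) \<and>
        smooth_on (chart M i ` (cdom M i \<inter> cdom M j)) (transition M i j)) \<and>
     Hausdorff_space (topology (mopen M)) \<and> second_countable (topology (mopen M))"

definition smooth_fun :: "('i, 'm, 'e::euclidean_space) atlas \<Rightarrow> 'm set \<Rightarrow> ('m \<Rightarrow> real) \<Rightarrow> bool" where
  "smooth_fun M U f \<longleftrightarrow> (\<forall>i\<in>idx M. smooth_on (chart M i ` (U \<inter> cdom M i)) (f \<circ> param M i))"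

section \<open>Tangent vectors and vector fields\<close>

text \<open>A tangent vector at \<open>p\<close> is the family of its components \<open>v i\<close> in all the charts around \<open>p\<close>,
  related by the derivatives of the transition maps (and \<open>0\<close> at all other indices). Vectors and
  vector fields are added and subtracted pointwise; the component of a vector field \<open>X\<close> at \<open>p\<close> in
  the chart \<open>i\<close> is \<open>X p i\<close>.\<close>

definition dtrans :: "('i, 'm, 'e::euclidean_space) atlas \<Rightarrow> 'i \<Rightarrow> 'i \<Rightarrow> 'm \<Rightarrow> 'e \<Rightarrow> 'e" where
  "dtrans M i j p = frechet_derivative (transition M i j) (at (chart M i p))"

definition tangent_space :: "('i, 'm, 'e::euclidean_space) atlas \<Rightarrow> 'm \<Rightarrow> ('i \<Rightarrow> 'e) set" where
  "tangent_space M p =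
     {v. (\<forall>i\<in>charts_at M p. \<forall>j\<in>charts_at M p. v j = dtrans M i j p (v i)) \<and>
         (\<forall>i. i \<notin> charts_at M p \<longrightarrow> v i = 0)}"

definition vscale :: "real \<Rightarrow> ('i \<Rightarrow> 'e::real_vector) \<Rightarrow> 'i \<Rightarrow> 'e" (infixr "\<cdot>" 75) where
  "a \<cdot> v = (\<lambda>i. a *\<^sub>R v i)"

definition vector_field ::
    "('i, 'm, 'e::euclidean_space) atlas \<Rightarrow> 'm set \<Rightarrow> ('m \<Rightarrow> 'i \<Rightarrow> 'e) \<Rightarrow> bool" where
  "vector_field M U X \<longleftrightarrow>
     (\<forall>p\<in>U. X p \<in> tangent_space M p) \<and>
     (\<forall>i\<in>idx M. smooth_on (chart M i ` (U \<inter> cdom M i)) (\<lambda>x. X (param M i x) i))"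

text \<open>The function \<open>X f\<close>; the chart used is immaterial when \<open>X p\<close> is a tangent vector.\<close>

definition dir_deriv ::
    "('i, 'm, 'e::euclidean_space) atlas \<Rightarrow> ('m \<Rightarrow> 'i \<Rightarrow> 'e) \<Rightarrow> ('m \<Rightarrow> real) \<Rightarrow> 'm \<Rightarrow> real" where
  "dir_deriv M X f p =
     (let i = (SOME i. i \<in> charts_at M p)
      in frechet_derivative (f \<circ> param M i) (at (chart M i p)) (X p i))"

definition lie_bracket ::
    "('i, 'm, 'e::euclidean_space) atlas \<Rightarrow> ('m \<Rightarrow> 'i \<Rightarrow> 'e) \<Rightarrow> ('m \<Rightarrow> 'i \<Rightarrow> 'e) \<Rightarrow> 'm \<Rightarrow> 'i \<Rightarrow> 'e" where
  "lie_bracket M X Y p i =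
     (if i \<in> charts_at M p
      then frechet_derivative (\<lambda>x. Y (param M i x) i) (at (chart M i p)) (X p i)
         - frechet_derivative (\<lambda>x. X (param M i x) i) (at (chart M i p)) (Y p i)
      else 0)"

section \<open>Connections and Riemannian metrics\<close>

text \<open>A connection acts on vector fields defined on arbitrary open sets, compatibly with
  restriction.\<close>

definition connection ::
    "('i, 'm, 'e::euclidean_space) atlas \<Rightarrow>
     (('m \<Rightarrow> 'i \<Rightarrow> 'e) \<Rightarrow> ('m \<Rightarrow> 'i \<Rightarrow> 'e) \<Rightarrow> 'm \<Rightarrow> 'i \<Rightarrow> 'e) \<Rightarrow> bool" where
  "connection M nab \<longleftrightarrow>
     (\<forall>U X X' Y Y' f. mopen M U \<and> vector_field M U X \<and> vector_field M U X' \<and>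
        vector_field M U Y \<and> vector_field M U Y' \<and> smooth_fun M U f \<longrightarrow>
        vector_field M U (nab X Y) \<and>
        ((\<forall>p\<in>U. X p = X' p \<and> Y p = Y' p) \<longrightarrow> (\<forall>p\<in>U. nab X Y p = nab X' Y' p)) \<and>
        (\<forall>p\<in>U.
           nab (X + X') Y p = nab X Y p + nab X' Y p \<and>
           nab (\<lambda>q. f q \<cdot> X q) Y p = f p \<cdot> nab X Y p \<and>
           nab X (Y + Y') p = nab X Y p + nab X Y' p \<and>
           nab X (\<lambda>q. f q \<cdot> Y q) p = dir_deriv M X f p \<cdot> Y p + f p \<cdot> nab X Y p))"

definition torsion_free ::
    "('i, 'm, 'e::euclidean_space) atlas \<Rightarrow>
     (('m \<Rightarrow> 'i \<Rightarrow> 'e) \<Rightarrow> ('m \<Rightarrow> 'i \<Rightarrow> 'e) \<Rightarrow> 'm \<Rightarrow> 'i \<Rightarrow> 'e) \<Rightarrow> bool" where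
  "torsion_free M nab \<longleftrightarrow>
     (\<forall>U X Y. mopen M U \<and> vector_field M U X \<and> vector_field M U Y \<longrightarrow>
        (\<forall>p\<in>U. nab X Y p - nab Y X p = lie_bracket M X Y p))"

definition curvature ::
    "('i, 'm, 'e::euclidean_space) atlas \<Rightarrow>
     (('m \<Rightarrow> 'i \<Rightarrow> 'e) \<Rightarrow> ('m \<Rightarrow> 'i \<Rightarrow> 'e) \<Rightarrow> 'm \<Rightarrow> 'i \<Rightarrow> 'e) \<Rightarrow>
     ('m \<Rightarrow> 'i \<Rightarrow> 'e) \<Rightarrow> ('m \<Rightarrow> 'i \<Rightarrow> 'e) \<Rightarrow> ('m \<Rightarrow> 'i \<Rightarrow> 'e) \<Rightarrow> 'm \<Rightarrow> 'i \<Rightarrow> 'e" where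
  "curvature M nab X Y Z =
     nab (lie_bracket M X Y) Z - nab X (nab Y Z) + nab Y (nab X Z)"

definition flat ::
    "('i, 'm, 'e::euclidean_space) atlas \<Rightarrow>
     (('m \<Rightarrow> 'i \<Rightarrow> 'e) \<Rightarrow> ('m \<Rightarrow> 'i \<Rightarrow> 'e) \<Rightarrow> 'm \<Rightarrow> 'i \<Rightarrow> 'e) \<Rightarrow> bool" where
  "flat M nab \<longleftrightarrow>
     (\<forall>U X Y Z. mopen M U \<and> vector_field M U X \<and> vector_field M U Y \<and> vector_field M U Z \<longrightarrow>
        (\<forall>p\<in>U. curvature M nab X Y Z p = 0))"

definition riemannian_metric ::
    "('i, 'm, 'e::euclidean_space) atlas \<Rightarrow> ('m \<Rightarrow> ('i \<Rightarrow> 'e) \<Rightarrow> ('i \<Rightarrow> 'e) \<Rightarrow> real) \<Rightarrow> bool" where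
  "riemannian_metric M g \<longleftrightarrow>
     (\<forall>p\<in>carrier_of M. \<forall>u\<in>tangent_space M p. \<forall>v\<in>tangent_space M p. \<forall>w\<in>tangent_space M p.
        g p u v = g p v u \<and>
        (\<forall>a b. g p (a \<cdot> u + b \<cdot> v) w = a * g p u w + b * g p v w) \<and>
        (u \<noteq> 0 \<longrightarrow> 0 < g p u u)) \<and>
     (\<forall>U X Y. mopen M U \<and> vector_field M U X \<and> vector_field M U Y \<longrightarrow>
        smooth_fun M U (\<lambda>p. g p (X p) (Y p)))"

definition levi_civita ::
    "('i, 'm, 'e::euclidean_space) atlas \<Rightarrow> ('m \<Rightarrow> ('i \<Rightarrow> 'e) \<Rightarrow> ('i \<Rightarrow> 'e) \<Rightarrow> real) \<Rightarrow>
     (('m \<Rightarrow> 'i \<Rightarrow> 'e) \<Rightarrow> ('m \<Rightarrow> 'i \<Rightarrow> 'e) \<Rightarrow> 'm \<Rightarrow> 'i \<Rightarrow> 'e) \<Rightarrow> bool" where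
  "levi_civita M g D \<longleftrightarrow>
     connection M D \<and> torsion_free M D \<and>
     (\<forall>U X Y Z. mopen M U \<and> vector_field M U X \<and> vector_field M U Y \<and> vector_field M U Z \<longrightarrow>
        (\<forall>p\<in>U. dir_deriv M X (\<lambda>q. g q (Y q) (Z q)) p
               = g p (D X Y p) (Z p) + g p (Y p) (D X Z p)))"

definition orthonormal_frame ::
    "('i, 'm, 'e::euclidean_space) atlas \<Rightarrow> ('m \<Rightarrow> ('i \<Rightarrow> 'e) \<Rightarrow> ('i \<Rightarrow> 'e) \<Rightarrow> real) \<Rightarrow>
     'm set \<Rightarrow> (nat \<Rightarrow> 'm \<Rightarrow> 'i \<Rightarrow> 'e) \<Rightarrow> bool" where
  "orthonormal_frame M g U E \<longleftrightarrow>
     mopen M U \<and> (\<forall>k<DIM('e). vector_field M U (E k)) \<and>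
     (\<forall>p\<in>U. \<forall>k<DIM('e). \<forall>l<DIM('e). g p (E k p) (E l p) = (if k = l then 1 else 0))"

section \<open>Affine-Riemann manifolds\<close>

definition affine_riemann ::
    "('i, 'm, 'e::euclidean_space) atlas \<Rightarrow>
     (('m \<Rightarrow> 'i \<Rightarrow> 'e) \<Rightarrow> ('m \<Rightarrow> 'i \<Rightarrow> 'e) \<Rightarrow> 'm \<Rightarrow> 'i \<Rightarrow> 'e) \<Rightarrow>
     ('m \<Rightarrow> ('i \<Rightarrow> 'e) \<Rightarrow> ('i \<Rightarrow> 'e) \<Rightarrow> real) \<Rightarrow> bool" where
  "affine_riemann M nab g \<longleftrightarrow>
     smooth_manifold M \<and> connection M nab \<and> flat M nab \<and> torsion_free M nab \<and>
     riemannian_metric M g"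

definition difference_tensor ::
    "(('m \<Rightarrow> 'i \<Rightarrow> 'e::euclidean_space) \<Rightarrow> ('m \<Rightarrow> 'i \<Rightarrow> 'e) \<Rightarrow> 'm \<Rightarrow> 'i \<Rightarrow> 'e) \<Rightarrow>
     (('m \<Rightarrow> 'i \<Rightarrow> 'e) \<Rightarrow> ('m \<Rightarrow> 'i \<Rightarrow> 'e) \<Rightarrow> 'm \<Rightarrow> 'i \<Rightarrow> 'e) \<Rightarrow>
     ('m \<Rightarrow> 'i \<Rightarrow> 'e) \<Rightarrow> ('m \<Rightarrow> 'i \<Rightarrow> 'e) \<Rightarrow> 'm \<Rightarrow> 'i \<Rightarrow> 'e" where
  "difference_tensor D nab X Y = D X Y - nab X Y"

text \<open>\<open>Ts X\<close> is the adjoint of \<open>T X\<close>; since \<open>g\<close> is nondegenerate, this determines \<open>Ts X Y\<close> on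
  every open set where \<open>X\<close> and \<open>Y\<close> are defined.\<close>

definition adjoint_tensor ::
    "('i, 'm, 'e::euclidean_space) atlas \<Rightarrow> ('m \<Rightarrow> ('i \<Rightarrow> 'e) \<Rightarrow> ('i \<Rightarrow> 'e) \<Rightarrow> real) \<Rightarrow>
     (('m \<Rightarrow> 'i \<Rightarrow> 'e) \<Rightarrow> ('m \<Rightarrow> 'i \<Rightarrow> 'e) \<Rightarrow> 'm \<Rightarrow> 'i \<Rightarrow> 'e) \<Rightarrow>
     (('m \<Rightarrow> 'i \<Rightarrow> 'e) \<Rightarrow> ('m \<Rightarrow> 'i \<Rightarrow> 'e) \<Rightarrow> 'm \<Rightarrow> 'i \<Rightarrow> 'e) \<Rightarrow> bool" where
  "adjoint_tensor M g T Ts \<longleftrightarrow>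
     (\<forall>U X Y. mopen M U \<and> vector_field M U X \<and> vector_field M U Y \<longrightarrow>
        vector_field M U (Ts X Y) \<and>
        (\<forall>Z. vector_field M U Z \<longrightarrow>
           (\<forall>p\<in>U. g p (Ts X Y p) (Z p) = g p (Y p) (T X Z p))))"

definition cov_deriv ::
    "(('m \<Rightarrow> 'i \<Rightarrow> 'e::euclidean_space) \<Rightarrow> ('m \<Rightarrow> 'i \<Rightarrow> 'e) \<Rightarrow> 'm \<Rightarrow> 'i \<Rightarrow> 'e) \<Rightarrow>
     ('m \<Rightarrow> 'i \<Rightarrow> 'e) \<Rightarrow>
     (('m \<Rightarrow> 'i \<Rightarrow> 'e) \<Rightarrow> ('m \<Rightarrow> 'i \<Rightarrow> 'e) \<Rightarrow> 'm \<Rightarrow> 'i \<Rightarrow> 'e) \<Rightarrow>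
     ('m \<Rightarrow> 'i \<Rightarrow> 'e) \<Rightarrow> ('m \<Rightarrow> 'i \<Rightarrow> 'e) \<Rightarrow> 'm \<Rightarrow> 'i \<Rightarrow> 'e" where
  "cov_deriv D X T Y Z = D X (T Y Z) - T (D X Y) Z - T Y (D X Z)"

definition frame_trace ::
    "(nat \<Rightarrow> 'm \<Rightarrow> 'i \<Rightarrow> 'e::euclidean_space) \<Rightarrow>
     (('m \<Rightarrow> 'i \<Rightarrow> 'e) \<Rightarrow> ('m \<Rightarrow> 'i \<Rightarrow> 'e) \<Rightarrow> 'm \<Rightarrow> 'i \<Rightarrow> 'e) \<Rightarrow> 'm \<Rightarrow> 'i \<Rightarrow> 'e" where
  "frame_trace E T = (\<Sum>k<DIM('e). T (E k) (E k))"

text \<open>The metric trace of \<open>T\<close> is identically zero.\<close>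

definition trace_vanishes ::
    "('i, 'm, 'e::euclidean_space) atlas \<Rightarrow> ('m \<Rightarrow> ('i \<Rightarrow> 'e) \<Rightarrow> ('i \<Rightarrow> 'e) \<Rightarrow> real) \<Rightarrow>
     (('m \<Rightarrow> 'i \<Rightarrow> 'e) \<Rightarrow> ('m \<Rightarrow> 'i \<Rightarrow> 'e) \<Rightarrow> 'm \<Rightarrow> 'i \<Rightarrow> 'e) \<Rightarrow> bool" where
  "trace_vanishes M g T \<longleftrightarrow>
     (\<forall>U E. orthonormal_frame M g U E \<longrightarrow> (\<forall>p\<in>U. frame_trace E T p = 0))"

section \<open>The tangent bundle and its canonical Hermitian structure\<close>

definition tangent_bundle ::
    "('i, 'm, 'e::euclidean_space) atlas \<Rightarrow> ('i, 'm \<times> ('i \<Rightarrow> 'e), 'e \<times> 'e) atlas" where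
  "tangent_bundle M =
     \<lparr>idx = idx M,
      cdom = (\<lambda>i. {(p, v). p \<in> cdom M i \<and> v \<in> tangent_space M p}),
      chart = (\<lambda>i (p, v). (chart M i p, v i))\<rparr>"

text \<open>The vector field on \<open>cdom M i\<close> with constant components \<open>a\<close> in the chart \<open>i\<close>.\<close>

definition const_field :: "('i, 'm, 'e::euclidean_space) atlas \<Rightarrow> 'i \<Rightarrow> 'e \<Rightarrow> 'm \<Rightarrow> 'i \<Rightarrow> 'e" where
  "const_field M i a p j =
     (if i \<in> charts_at M p \<and> j \<in> charts_at M p then dtrans M i j p a else 0)"

text \<open>The Christoffel symbols \<open>\<Gamma>(a, b)\<close> in the chart \<open>i\<close>, as a bilinear map.\<close>

definition christoffel ::
    "('i, 'm, 'e::euclidean_space) atlas \<Rightarrow>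
     (('m \<Rightarrow> 'i \<Rightarrow> 'e) \<Rightarrow> ('m \<Rightarrow> 'i \<Rightarrow> 'e) \<Rightarrow> 'm \<Rightarrow> 'i \<Rightarrow> 'e) \<Rightarrow>
     'i \<Rightarrow> 'm \<Rightarrow> 'e \<Rightarrow> 'e \<Rightarrow> 'e" where
  "christoffel M nab i p a b = nab (const_field M i a) (const_field M i b) p i"

text \<open>In induced coordinates \<open>(x, y)\<close> of the tangent bundle, the horizontal lift is
  \<open>(X, - \<Gamma>(X, y))\<close> and the vertical lift is \<open>(0, X)\<close>.\<close>

definition hlift ::
    "('i, 'm, 'e::euclidean_space) atlas \<Rightarrow>
     (('m \<Rightarrow> 'i \<Rightarrow> 'e) \<Rightarrow> ('m \<Rightarrow> 'i \<Rightarrow> 'e) \<Rightarrow> 'm \<Rightarrow> 'i \<Rightarrow> 'e) \<Rightarrow>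
     ('m \<Rightarrow> 'i \<Rightarrow> 'e) \<Rightarrow> 'm \<times> ('i \<Rightarrow> 'e) \<Rightarrow> 'i \<Rightarrow> 'e \<times> 'e" where
  "hlift M nab X = (\<lambda>(p, v) i.
     if i \<in> charts_at M p then (X p i, - christoffel M nab i p (X p i) (v i)) else 0)"

definition vlift ::
    "('i, 'm, 'e::euclidean_space) atlas \<Rightarrow> ('m \<Rightarrow> 'i \<Rightarrow> 'e) \<Rightarrow>
     'm \<times> ('i \<Rightarrow> 'e) \<Rightarrow> 'i \<Rightarrow> 'e \<times> 'e" where
  "vlift M X = (\<lambda>(p, v) i. if i \<in> charts_at M p then (0, X p i) else 0)"

definition canonical_hermitian ::
    "('i, 'm, 'e::euclidean_space) atlas \<Rightarrow>
     (('m \<Rightarrow> 'i \<Rightarrow> 'e) \<Rightarrow> ('m \<Rightarrow> 'i \<Rightarrow> 'e) \<Rightarrow> 'm \<Rightarrow> 'i \<Rightarrow> 'e) \<Rightarrow>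
     ('m \<Rightarrow> ('i \<Rightarrow> 'e) \<Rightarrow> ('i \<Rightarrow> 'e) \<Rightarrow> real) \<Rightarrow>
     ('m \<times> ('i \<Rightarrow> 'e) \<Rightarrow> ('i \<Rightarrow> 'e \<times> 'e) \<Rightarrow> 'i \<Rightarrow> 'e \<times> 'e) \<Rightarrow>
     ('m \<times> ('i \<Rightarrow> 'e) \<Rightarrow> ('i \<Rightarrow> 'e \<times> 'e) \<Rightarrow> ('i \<Rightarrow> 'e \<times> 'e) \<Rightarrow> real) \<Rightarrow> bool" where
  "canonical_hermitian M nab g J\<^sub>1 g\<^sub>1 \<longleftrightarrow>
     (\<forall>\<xi>\<in>carrier_of (tangent_bundle M).
        \<forall>u\<in>tangent_space (tangent_bundle M) \<xi>. \<forall>v\<in>tangent_space (tangent_bundle M) \<xi>.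
        \<forall>w\<in>tangent_space (tangent_bundle M) \<xi>. \<forall>a b.
          J\<^sub>1 \<xi> (a \<cdot> u + b \<cdot> v) = a \<cdot> J\<^sub>1 \<xi> u + b \<cdot> J\<^sub>1 \<xi> v \<and>
          g\<^sub>1 \<xi> u v = g\<^sub>1 \<xi> v u \<and>
          g\<^sub>1 \<xi> (a \<cdot> u + b \<cdot> v) w = a * g\<^sub>1 \<xi> u w + b * g\<^sub>1 \<xi> v w) \<and>
     (\<forall>U X Y. mopen M U \<and> vector_field M U X \<and> vector_field M U Y \<longrightarrow>
        (\<forall>\<xi>\<in>carrier_of (tangent_bundle M). fst \<xi> \<in> U \<longrightarrow>
           J\<^sub>1 \<xi> (hlift M nab X \<xi>) = vlift M X \<xi> \<and>
           J\<^sub>1 \<xi> (vlift M X \<xi>) = - hlift M nab X \<xi> \<and>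
           g\<^sub>1 \<xi> (hlift M nab X \<xi>) (hlift M nab Y \<xi>) = g (fst \<xi>) (X (fst \<xi>)) (Y (fst \<xi>)) \<and>
           g\<^sub>1 \<xi> (vlift M X \<xi>) (vlift M Y \<xi>) = g (fst \<xi>) (X (fst \<xi>)) (Y (fst \<xi>)) \<and>
           g\<^sub>1 \<xi> (hlift M nab X \<xi>) (vlift M Y \<xi>) = 0))"

section \<open>The Chern connection and its Ricci form\<close>

definition fundamental_form ::
    "('m \<Rightarrow> ('i \<Rightarrow> 'e) \<Rightarrow> 'i \<Rightarrow> 'e) \<Rightarrow> ('m \<Rightarrow> ('i \<Rightarrow> 'e) \<Rightarrow> ('i \<Rightarrow> 'e) \<Rightarrow> real) \<Rightarrow>
     'm \<Rightarrow> ('i \<Rightarrow> 'e) \<Rightarrow> ('i \<Rightarrow> 'e) \<Rightarrow> real" where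
  "fundamental_form J g p u v = g p (J p u) v"

text \<open>The exterior derivative of a 2-form, normalised without the factor \<open>1/3\<close>; this is the
  normalisation for which the formula below yields a connection preserving \<open>J\<close>.\<close>

definition ext_deriv ::
    "('i, 'm, 'e::euclidean_space) atlas \<Rightarrow> ('m \<Rightarrow> ('i \<Rightarrow> 'e) \<Rightarrow> ('i \<Rightarrow> 'e) \<Rightarrow> real) \<Rightarrow>
     ('m \<Rightarrow> 'i \<Rightarrow> 'e) \<Rightarrow> ('m \<Rightarrow> 'i \<Rightarrow> 'e) \<Rightarrow> ('m \<Rightarrow> 'i \<Rightarrow> 'e) \<Rightarrow> 'm \<Rightarrow> real" where
  "ext_deriv M \<omega> X Y Z p =
     dir_deriv M X (\<lambda>q. \<omega> q (Y q) (Z q)) p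
     + dir_deriv M Y (\<lambda>q. \<omega> q (Z q) (X q)) p
     + dir_deriv M Z (\<lambda>q. \<omega> q (X q) (Y q)) p
     - \<omega> p (lie_bracket M X Y p) (Z p)
     - \<omega> p (lie_bracket M Y Z p) (X p)
     - \<omega> p (lie_bracket M Z X p) (Y p)"

definition chern_connection ::
    "('i, 'm, 'e::euclidean_space) atlas \<Rightarrow> ('m \<Rightarrow> ('i \<Rightarrow> 'e) \<Rightarrow> 'i \<Rightarrow> 'e) \<Rightarrow>
     ('m \<Rightarrow> ('i \<Rightarrow> 'e) \<Rightarrow> ('i \<Rightarrow> 'e) \<Rightarrow> real) \<Rightarrow>
     (('m \<Rightarrow> 'i \<Rightarrow> 'e) \<Rightarrow> ('m \<Rightarrow> 'i \<Rightarrow> 'e) \<Rightarrow> 'm \<Rightarrow> 'i \<Rightarrow> 'e) \<Rightarrow> bool" where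
  "chern_connection N J g C \<longleftrightarrow>
     connection N C \<and>
     (\<exists>LC. levi_civita N g LC \<and>
       (\<forall>U X Y Z. mopen N U \<and> vector_field N U X \<and> vector_field N U Y \<and> vector_field N U Z \<longrightarrow>
         (\<forall>p\<in>U. g p (C X Y p) (Z p) =
            g p (LC X Y p) (Z p)
            - 1 / 2 * ext_deriv N (fundamental_form J g) (\<lambda>q. J q (X q)) Y Z p)))"

text \<open>The Ricci form computed in the orthonormal frame \<open>E\<close>.\<close>

definition ricci_form ::
    "('i, 'm, 'e::euclidean_space) atlas \<Rightarrow> ('m \<Rightarrow> ('i \<Rightarrow> 'e) \<Rightarrow> 'i \<Rightarrow> 'e) \<Rightarrow>
     ('m \<Rightarrow> ('i \<Rightarrow> 'e) \<Rightarrow> ('i \<Rightarrow> 'e) \<Rightarrow> real) \<Rightarrow>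
     (('m \<Rightarrow> 'i \<Rightarrow> 'e) \<Rightarrow> ('m \<Rightarrow> 'i \<Rightarrow> 'e) \<Rightarrow> 'm \<Rightarrow> 'i \<Rightarrow> 'e) \<Rightarrow>
     (nat \<Rightarrow> 'm \<Rightarrow> 'i \<Rightarrow> 'e) \<Rightarrow> ('m \<Rightarrow> 'i \<Rightarrow> 'e) \<Rightarrow> ('m \<Rightarrow> 'i \<Rightarrow> 'e) \<Rightarrow> 'm \<Rightarrow> real" where
  "ricci_form N J g C E X Y p =
     1 / 2 * (\<Sum>k<DIM('e). g p (curvature N C X Y (E k) p) (J p (E k p)))"

definition ricci_form_vanishes ::
    "('i, 'm, 'e::euclidean_space) atlas \<Rightarrow> ('m \<Rightarrow> ('i \<Rightarrow> 'e) \<Rightarrow> 'i \<Rightarrow> 'e) \<Rightarrow>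
     ('m \<Rightarrow> ('i \<Rightarrow> 'e) \<Rightarrow> ('i \<Rightarrow> 'e) \<Rightarrow> real) \<Rightarrow>
     (('m \<Rightarrow> 'i \<Rightarrow> 'e) \<Rightarrow> ('m \<Rightarrow> 'i \<Rightarrow> 'e) \<Rightarrow> 'm \<Rightarrow> 'i \<Rightarrow> 'e) \<Rightarrow> bool" where
  "ricci_form_vanishes N J g C \<longleftrightarrow>
     (\<forall>U E X Y. orthonormal_frame N g U E \<and> vector_field N U X \<and> vector_field N U Y \<longrightarrow>
        (\<forall>p\<in>U. ricci_form N J g C E X Y p = 0))"

end

theory Submission
  imports Defs
begin

text \<open>
  The first claim is a frame computation: the coefficients of \<open>D\<^sub>X E\<^sub>k\<close> in an orthonormal
  frame are antisymmetric, so differentiating the frame does not contribute to the trace.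

  For the second claim put \<open>S = \<gamma> + \<gamma>\<^sup>*\<close> and \<open>A = \<nabla> + S/2\<close>. Since \<open>\<nabla>\<close> is flat, the lifted coordinate
  fields have only the brackets \<open>[X\<^sup>h, Y\<^sup>v] = (\<nabla>\<^sub>X Y)\<^sup>v\<close>, and the Koszul formula gives
  \<open>C(X\<^sup>h, Y\<^sup>h) = A(X, Y)\<^sup>h\<close>, \<open>C(X\<^sup>h, Y\<^sup>v) = A(X, Y)\<^sup>v\<close>, \<open>C(X\<^sup>v, Y\<^sup>h) = S(X, Y)\<^sup>v/2\<close>,
  \<open>C(X\<^sup>v, Y\<^sup>v) = - S(X, Y)\<^sup>h/2\<close> for the Chern connection \<open>C\<close>. Hence the Ricci form can only be
  nonzero on pairs \<open>(X\<^sup>h, Y\<^sup>v)\<close>, where it is a multiple of the trace of \<open>S\<^sub>W - [A\<^sub>X, S\<^sub>Y]\<close> with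
  \<open>W = \<nabla>\<^sub>X Y\<close>. This trace vanishes because \<open>A\<close> is metric, \<open>S\<^sub>Y\<close> is symmetric, and
  \<open>tr S\<^sub>Z = 2 \<langle>tr \<gamma>\<^sup>*, Z\<rangle> = 0\<close>. Arbitrary frames of lifts make flat coordinates unnecessary.
\<close>

section \<open>Calculus of smooth functions\<close>

text \<open>On two horizontal or two vertical arguments the curvature of \<open>C\<close> preserves
  the splitting into horizontal and vertical vectors, whereas \<open>J\<^sub>1\<close> exchanges the
  two summands, so every term of the Ricci trace pairs orthogonal vectors. On a mixed pair the
  curvature exchanges the summands too, and \<open>Z\<^sup>h\<close> and \<open>Z\<^sup>v\<close>
  contribute equally. The obstacle is that \<open>J\<^sub>1\<close> and \<open>g\<^sub>1\<close> are
  described only pointwise: smoothness of \<open>J\<^sub>1 X\<close> is not given, although the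
  formula for \<open>C\<close> applies an exterior derivative to it. Lifts of coordinate fields
  avoid this, because \<open>J\<^sub>1\<close> maps them to such lifts and all their products are
  functions pulled back from the base, up to sign. General fields are reached through tensoriality:
  inside one chart domain the coordinate fields form a frame, so pointwise dependence follows
  without cut-off functions. The half in \<open>A\<close> has its origin in the metric:
  \<open>\<nabla>\<close> fails to preserve it by exactly \<open>S\<close>, and each of the two
  arguments absorbs one half.\<close>

lemma frechet_derivative_cong_open:
  assumes "open S" "x \<in> S" "\<And>y. y \<in> S \<Longrightarrow> f y = g y"
  shows "frechet_derivative f (at x) = frechet_derivative g (at x)"
proof -
  \<comment> \<open>\<open>frechet_derivative\<close> is a choice among derivatives, so agreement of
    the two predicates already gives equality. Later this permits replacing functions whose
    smoothness is not yet known.\<close>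
  have "(f has_derivative f') (at x) \<longleftrightarrow> (g has_derivative f') (at x)" for f'
    using assms has_derivative_transform_within_open[of f f' x UNIV S g]
      has_derivative_transform_within_open[of g f' x UNIV S f] by auto
  then show ?thesis by (simp add: frechet_derivative_def)
qed

lemma Ck_on_subset: "Ck_on k S f \<Longrightarrow> T \<subseteq> S \<Longrightarrow> Ck_on k T f"
  by (induction k arbitrary: f) (auto intro: continuous_on_subset differentiable_on_subset)

lemma Ck_on_cong:
  assumes "open S" "\<And>x. x \<in> S \<Longrightarrow> f x = g x" "Ck_on k S f"
  shows "Ck_on k S g"
  using assms(2,3)
proof (induction k arbitrary: f g)
  case 0
  then show ?case by (simp cong: continuous_on_cong_simp)
next
  case (Suc k)
  have "g differentiable_on S"
    using Suc.prems differentiable_transform_within[of f _ S 1 g]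
    by (auto simp: differentiable_on_def)
  moreover have "Ck_on k S (\<lambda>x. frechet_derivative g (at x) v)" for v
  proof (rule Suc.IH[of "\<lambda>x. frechet_derivative f (at x) v"])
    show "frechet_derivative f (at x) v = frechet_derivative g (at x) v" if "x \<in> S" for x
      using frechet_derivative_cong_open[OF assms(1) that, of f g] Suc.prems(1) by simp
  qed (use Suc.prems in simp)
  ultimately show ?case by simp
qed

lemma Ck_on_SucD: "Ck_on (Suc k) S f \<Longrightarrow> Ck_on k S f"
proof (induction k arbitrary: f)
  case 0
  then show ?case by (auto intro: differentiable_imp_continuous_on)
qed simp

text \<open>Lets a derivative be exhibited instead of computing \<open>frechet_derivative\<close>;
  uniqueness of derivatives identifies the two. The closure proofs below rest on it.\<close>

lemma Ck_on_SucI: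
  assumes S: "open S"
    and D: "\<And>x. x \<in> S \<Longrightarrow> (f has_derivative f' x) (at x)"
    and C: "\<And>v. Ck_on k S (\<lambda>x. f' x v)"
  shows "Ck_on (Suc k) S f"
proof -
  have "f differentiable_on S"
    using D by (meson differentiableI differentiable_at_imp_differentiable_on)
  moreover have "Ck_on k S (\<lambda>x. frechet_derivative f (at x) v)" for v
    by (rule Ck_on_cong[OF S _ C[of v]]) (metis D frechet_derivative_at)
  ultimately show ?thesis by simp
qed

lemma Ck_on_Suc_has_derivative:
  assumes "open S" "Ck_on (Suc k) S f" "x \<in> S"
  shows "(f has_derivative frechet_derivative f (at x)) (at x)"
proof -
  have "f differentiable at x"
    using assms by (simp add: differentiable_on_eq_differentiable_at)
  then show ?thesis
    by (simp add: frechet_derivative_works)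
qed

lemma Ck_on_const: "open S \<Longrightarrow> Ck_on k S (\<lambda>x. c)"
proof (induction k arbitrary: c)
  case (Suc k)
  show ?case
    by (rule Ck_on_SucI[where f' = "\<lambda>x v. 0"]) (use Suc in auto)
qed simp

lemma Ck_on_bounded_linear:
  assumes "open S" "bounded_linear h"
  shows "Ck_on k S f \<Longrightarrow> Ck_on k S (\<lambda>x. h (f x))"
proof (induction k arbitrary: f)
  case 0
  then show ?case
    using assms(2) by (auto intro: bounded_linear.continuous_on)
next
  case (Suc k)
  show ?case
  proof (rule Ck_on_SucI[OF assms(1), where f' = "\<lambda>x v. h (frechet_derivative f (at x) v)"])
    show "((\<lambda>x. h (f x)) has_derivative (\<lambda>v. h (frechet_derivative f (at x) v))) (at x)"
      if "x \<in> S" for x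
      using bounded_linear.has_derivative[OF assms(2) Ck_on_Suc_has_derivative[OF assms(1)
          Suc.prems that]] .
  qed (use Suc in auto)
qed

lemma Ck_on_add:
  assumes "open S"
  shows "Ck_on k S f \<Longrightarrow> Ck_on k S g \<Longrightarrow> Ck_on k S (\<lambda>x. f x + g x)"
proof (induction k arbitrary: f g)
  case 0
  then show ?case by (auto intro: continuous_on_add)
next
  case (Suc k)
  show ?case
    by (rule Ck_on_SucI[OF assms(1),
          where f' = "\<lambda>x v. frechet_derivative f (at x) v + frechet_derivative g (at x) v"])
      (use Suc in \<open>auto intro!: has_derivative_add Ck_on_Suc_has_derivative[OF assms, of k] simp
          del: Ck_on.simps
        simp: Ck_on.simps(2)[of k S f] Ck_on.simps(2)[of k S g]\<close>)
qed

lemma Ck_on_sum: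
  assumes "open S"
  shows "(\<And>i. i \<in> I \<Longrightarrow> Ck_on k S (f i)) \<Longrightarrow> Ck_on k S (\<lambda>x. \<Sum>i\<in>I. f i x)"
  by (induction I rule: infinite_finite_induct) (auto intro: Ck_on_const Ck_on_add assms)

text \<open>By the product rule the derivative pairs one undifferentiated factor with one
  differentiated factor, so the induction hypothesis also needs the undifferentiated factors at the
  lower order; \<open>Ck_on_SucD\<close> supplies them.\<close>

lemma Ck_on_bilinear:
  assumes "open S" "bounded_bilinear h"
  shows "Ck_on k S f \<Longrightarrow> Ck_on k S g \<Longrightarrow> Ck_on k S (\<lambda>x. h (f x) (g x))"
proof (induction k arbitrary: f g)
  case 0
  then show ?case
    using assms(2) by (auto intro: bounded_bilinear.continuous_on)
next
  case (Suc k)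
  note fg = Suc.prems
  show ?case
  proof (rule Ck_on_SucI[OF assms(1), where f' = "\<lambda>x v. h (f x) (frechet_derivative g (at x) v)
      + h (frechet_derivative f (at x) v) (g x)"])
    show "((\<lambda>x. h (f x) (g x)) has_derivative (\<lambda>v. h (f x) (frechet_derivative g (at x) v)
      + h (frechet_derivative f (at x) v) (g x))) (at x)" if "x \<in> S" for x
      using bounded_bilinear.FDERIV[OF assms(2) Ck_on_Suc_has_derivative[OF assms(1) fg(1) that]
          Ck_on_Suc_has_derivative[OF assms(1) fg(2) that]] .
    show "Ck_on k S (\<lambda>x. h (f x) (frechet_derivative g (at x) v)
      + h (frechet_derivative f (at x) v) (g x))" for v
      using fg Ck_on_SucD[OF fg(1)] Ck_on_SucD[OF fg(2)]
      by (intro Ck_on_add assms Suc.IH) auto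
  qed
qed

lemma frechet_derivative_sum_Basis:
  fixes f :: "'a::euclidean_space \<Rightarrow> 'b::real_normed_vector"
  assumes "f differentiable at x"
  shows "frechet_derivative f (at x) v = (\<Sum>b\<in>Basis. (v \<bullet> b) *\<^sub>R frechet_derivative f (at x) b)"
  using linear_sum[OF linear_frechet_derivative[OF assms], of "\<lambda>b. (v \<bullet> b) *\<^sub>R b" Basis]
    linear_scale[OF linear_frechet_derivative[OF assms]]
  by (simp add: euclidean_representation)

text \<open>\<open>Ck_on\<close> differentiates in a fixed direction, but the chain rule evaluates
  the derivative of \<open>f\<close> in a direction depending on \<open>x\<close>. Expanding that
  direction in \<open>Basis\<close> leaves fixed directions with variable scalar coefficients, to
  which the bilinear rule applies.\<close>

lemma Ck_on_compose:
  fixes f :: "'b::euclidean_space \<Rightarrow> 'c::real_normed_vector" and h :: "'a::euclidean_space \<Rightarrow> 'b"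
  assumes "open S" "open T" "h ` S \<subseteq> T"
  shows "Ck_on k T f \<Longrightarrow> Ck_on k S h \<Longrightarrow> Ck_on k S (\<lambda>x. f (h x))"
proof (induction k arbitrary: f)
  case 0
  then show ?case
    using assms(3) by (auto intro: continuous_on_compose2)
next
  case (Suc k)
  note fh = Suc.prems
  have df: "(f has_derivative frechet_derivative f (at (h x))) (at (h x))" if "x \<in> S" for x
    using Ck_on_Suc_has_derivative[OF assms(2) fh(1)] that assms(3) by auto
  show ?case
  proof (rule Ck_on_SucI[OF assms(1), where f' = "\<lambda>x v. \<Sum>b\<in>Basis.
      (frechet_derivative h (at x) v \<bullet> b) *\<^sub>R frechet_derivative f (at (h x)) b"])
    fix x assume x: "x \<in> S"
    have "f differentiable at (h x)"
      using df[OF x] by (rule differentiableI)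
    then have "(\<lambda>v. \<Sum>b\<in>Basis. (frechet_derivative h (at x) v \<bullet> b) *\<^sub>R frechet_derivative f (at
        (h x)) b)
        = (\<lambda>v. frechet_derivative f (at (h x)) (frechet_derivative h (at x) v))"
      by (subst (2) frechet_derivative_sum_Basis) auto
    then show "((\<lambda>x. f (h x)) has_derivative (\<lambda>v. \<Sum>b\<in>Basis.
      (frechet_derivative h (at x) v \<bullet> b) *\<^sub>R frechet_derivative f (at (h x)) b)) (at x)"
      using diff_chain_at[OF Ck_on_Suc_has_derivative[OF assms(1) fh(2) x] df[OF x]]
      by (simp add: o_def)
  next
    fix v
    show "Ck_on k S (\<lambda>x. \<Sum>b\<in>Basis.
      (frechet_derivative h (at x) v \<bullet> b) *\<^sub>R frechet_derivative f (at (h x)) b)"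
      using fh Ck_on_SucD[OF fh(2)]
      by (intro Ck_on_sum assms Ck_on_bilinear[OF _ bounded_bilinear_scaleR]
          Ck_on_bounded_linear[OF _ bounded_linear_inner_left] Suc.IH) auto
  qed
qed

text \<open>The exponent is arbitrary in the induction because differentiation lowers it by one. The
  value \<open>- 1 / 2\<close> will normalise vectors in the Gram-Schmidt process.\<close>

lemma Ck_on_powr:
  fixes f :: "'a::euclidean_space \<Rightarrow> real"
  assumes "open S" "\<And>x. x \<in> S \<Longrightarrow> f x > 0"
  shows "Ck_on k S f \<Longrightarrow> Ck_on k S (\<lambda>x. f x powr a)"
proof (induction k arbitrary: a)
  case 0
  then show ?case
    using assms(2) by (fastforce intro!: continuous_intros)
next
  case (Suc k)
  show ?case
  proof (rule Ck_on_SucI[OF assms(1), where f'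
      = "\<lambda>x v. a * f x powr (a - 1) * frechet_derivative f (at x) v"])
    fix x assume x: "x \<in> S"
    have "((\<lambda>y. y powr a) has_derivative (\<lambda>h. a * f x powr (a - 1) * h)) (at (f x))"
      using has_real_derivative_powr[OF assms(2)[OF x], of a]
      by (simp add: has_field_derivative_def)
    then show "((\<lambda>x. f x powr a) has_derivative (\<lambda>v. a * f x powr (a - 1) * frechet_derivative f
        (at x) v)) (at x)"
      using diff_chain_at[OF Ck_on_Suc_has_derivative[OF assms(1) Suc.prems x]]
      by (fastforce simp: o_def)
  next
    fix v
    show "Ck_on k S (\<lambda>x. a * f x powr (a - 1) * frechet_derivative f (at x) v)"
      using Suc Ck_on_SucD[OF Suc.prems]
      by (intro Ck_on_bilinear[OF assms(1) bounded_bilinear_mult] Ck_on_const assms Suc.IH) auto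
  qed
qed

lemma smooth_on_subset: "smooth_on S f \<Longrightarrow> T \<subseteq> S \<Longrightarrow> smooth_on T f"
  by (auto simp: smooth_on_def intro: Ck_on_subset)

lemma smooth_on_cong: "open S \<Longrightarrow> smooth_on S f \<Longrightarrow> (\<And>x. x \<in> S \<Longrightarrow> f x = g x) \<Longrightarrow> smooth_on S g"
  unfolding smooth_on_def by (metis Ck_on_cong)

lemma smooth_on_const: "open S \<Longrightarrow> smooth_on S (\<lambda>x. c)"
  by (auto simp: smooth_on_def intro: Ck_on_const)

lemma smooth_on_bounded_linear: "open S \<Longrightarrow> bounded_linear h \<Longrightarrow> smooth_on S f \<Longrightarrow>
    smooth_on S (\<lambda>x. h (f x))"
  by (auto simp: smooth_on_def intro: Ck_on_bounded_linear)

lemma smooth_on_add: "open S \<Longrightarrow> smooth_on S f \<Longrightarrow> smooth_on S g \<Longrightarrow> smooth_on S (\<lambda>x. f x + g x)"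
  by (auto simp: smooth_on_def intro: Ck_on_add)

lemma smooth_on_sum: "open S \<Longrightarrow> (\<And>i. i \<in> I \<Longrightarrow> smooth_on S (f i)) \<Longrightarrow> smooth_on S (\<lambda>x. \<Sum>i\<in>I. f i x)"
  by (auto simp: smooth_on_def intro: Ck_on_sum)

lemma smooth_on_bilinear:
  "open S \<Longrightarrow> bounded_bilinear h \<Longrightarrow> smooth_on S f \<Longrightarrow> smooth_on S g \<Longrightarrow> smooth_on S (\<lambda>x. h (f x) (g x))"
  by (auto simp: smooth_on_def intro: Ck_on_bilinear)

lemmas smooth_on_scaleR = smooth_on_bilinear[OF _ bounded_bilinear_scaleR]
lemmas smooth_on_mult = smooth_on_bilinear[OF _ bounded_bilinear_mult]

lemma smooth_on_uminus: "open S \<Longrightarrow> smooth_on S f \<Longrightarrow> smooth_on S (\<lambda>x. - f x)"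
  using smooth_on_bounded_linear[OF _ bounded_linear_minus[OF bounded_linear_ident]] by blast

lemma smooth_on_inner_left: "open S \<Longrightarrow> smooth_on S f \<Longrightarrow> smooth_on S (\<lambda>x. f x \<bullet> b)"
  using smooth_on_bounded_linear[OF _ bounded_linear_inner_left] .

lemma smooth_on_compose:
  fixes f :: "'b::euclidean_space \<Rightarrow> 'c::real_normed_vector" and h :: "'a::euclidean_space \<Rightarrow> 'b"
  shows "open S \<Longrightarrow> open T \<Longrightarrow> h ` S \<subseteq> T \<Longrightarrow> smooth_on T f \<Longrightarrow> smooth_on S h \<Longrightarrow> smooth_on S (\<lambda>x. f (h x))"
  unfolding smooth_on_def using Ck_on_compose[of S T h _ f] by blast

lemma smooth_on_powr:
  fixes f :: "'a::euclidean_space \<Rightarrow> real"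
  shows "open S \<Longrightarrow> smooth_on S f \<Longrightarrow> (\<And>x. x \<in> S \<Longrightarrow> f x > 0) \<Longrightarrow> smooth_on S (\<lambda>x. f x powr a)"
  unfolding smooth_on_def using Ck_on_powr[of S f] by blast

lemma smooth_on_ident: "open S \<Longrightarrow> smooth_on S (\<lambda>x. x)"
proof -
  assume S: "open S"
  have "Ck_on k S (\<lambda>x. x)" for k
    by (cases k) (auto simp: S intro: Ck_on_SucI[where f' = "\<lambda>x v. v"] Ck_on_const)
  then show ?thesis by (simp add: smooth_on_def)
qed

lemma smooth_on_fst: "open S \<Longrightarrow> smooth_on S fst"
  using smooth_on_bounded_linear[OF _ bounded_linear_fst smooth_on_ident] .

lemma smooth_on_snd: "open S \<Longrightarrow> smooth_on S snd"
  using smooth_on_bounded_linear[OF _ bounded_linear_snd smooth_on_ident] .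

lemma smooth_on_Pair:
  assumes "open S" "smooth_on S f" "smooth_on S g"
  shows "smooth_on S (\<lambda>x. (f x, g x))"
proof -
  have "smooth_on S (\<lambda>x. (f x, 0) + (0, g x))"
    by (intro smooth_on_add smooth_on_bounded_linear[where h = "\<lambda>y. (y, 0)"]
        smooth_on_bounded_linear[where h = "\<lambda>y. (0, y)"] assms bounded_linear_Pair
        bounded_linear_ident bounded_linear_zero)
  then show ?thesis by simp
qed

lemma smooth_on_frechet: "smooth_on S f \<Longrightarrow> smooth_on S (\<lambda>x. frechet_derivative f (at x) v)"
  unfolding smooth_on_def by (metis Ck_on.simps(2))

lemma smooth_on_has_derivative:
  "open S \<Longrightarrow> smooth_on S f \<Longrightarrow> x \<in> S \<Longrightarrow> (f has_derivative frechet_derivative f (at x)) (at x)"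
  using Ck_on_Suc_has_derivative unfolding smooth_on_def by blast

lemma smooth_on_differentiable: "open S \<Longrightarrow> smooth_on S f \<Longrightarrow> x \<in> S \<Longrightarrow> f differentiable at x"
  using smooth_on_has_derivative differentiableI by blast

lemma smooth_on_continuous_on: "smooth_on S f \<Longrightarrow> continuous_on S f"
  unfolding smooth_on_def by (metis Ck_on.simps(1))

lemma smooth_on_frechet_apply:
  fixes f :: "'a::euclidean_space \<Rightarrow> 'b::real_normed_vector"
  assumes S: "open S" and f: "smooth_on S f" and h: "smooth_on S h"
  shows "smooth_on S (\<lambda>x. frechet_derivative f (at x) (h x))"
proof (rule smooth_on_cong[OF S])
  show "smooth_on S (\<lambda>x. \<Sum>b\<in>Basis. (h x \<bullet> b) *\<^sub>R frechet_derivative f (at x) b)"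
    by (intro smooth_on_sum smooth_on_scaleR smooth_on_inner_left smooth_on_frechet S f h)
qed (use frechet_derivative_sum_Basis[symmetric] smooth_on_differentiable[OF S f] in blast)

text \<open>Product rule for the pairing of a derivative with a variable direction: linearity in the
  direction gives the first term, and freezing the direction at \<open>h x\<close> leaves a second
  derivative of \<open>f\<close>.\<close>

lemma frechet_derivative_apply_deriv:
  fixes f :: "'a::euclidean_space \<Rightarrow> 'b::real_normed_vector"
  assumes S: "open S" "x \<in> S" and f: "smooth_on S f" and h: "smooth_on S h"
  shows "frechet_derivative (\<lambda>x. frechet_derivative f (at x) (h x)) (at x) a
    = frechet_derivative f (at x) (frechet_derivative h (at x) a)
      + frechet_derivative (\<lambda>y. frechet_derivative f (at y) (h x)) (at x) a"
proof -
  let ?f = "\<lambda>b x. frechet_derivative f (at x) b"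
  have expand: "frechet_derivative f (at y) v = (\<Sum>b\<in>Basis. (v \<bullet> b) *\<^sub>R ?f b y)" if "y \<in> S" for y v
    using frechet_derivative_sum_Basis smooth_on_differentiable[OF S(1) f that] by blast
  have D: "(?f b has_derivative frechet_derivative (?f b) (at x)) (at x)" for b
    by (intro smooth_on_has_derivative[OF S(1) _ S(2)] smooth_on_frechet f)
  have "frechet_derivative (\<lambda>y. frechet_derivative f (at y) (h y)) (at x) a
      = frechet_derivative (\<lambda>y. \<Sum>b\<in>Basis. (h y \<bullet> b) *\<^sub>R ?f b y) (at x) a"
    by (subst frechet_derivative_cong_open[OF S, of _ "\<lambda>y. \<Sum>b\<in>Basis. (h y \<bullet> b) *\<^sub>R ?f b y"])
      (use expand in auto)
  also have "((\<lambda>y. \<Sum>b\<in>Basis. (h y \<bullet> b) *\<^sub>R ?f b y) has_derivative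
      (\<lambda>a. \<Sum>b\<in>Basis. (h x \<bullet> b) *\<^sub>R frechet_derivative (?f b) (at x) a
        + (frechet_derivative h (at x) a \<bullet> b) *\<^sub>R ?f b x)) (at x)"
    using smooth_on_has_derivative[OF S(1) h S(2)] D
    by (intro has_derivative_sum has_derivative_scaleR has_derivative_inner_left)
  then have "frechet_derivative (\<lambda>y. \<Sum>b\<in>Basis. (h y \<bullet> b) *\<^sub>R ?f b y) (at x) a
      = (\<Sum>b\<in>Basis. (h x \<bullet> b) *\<^sub>R frechet_derivative (?f b) (at x) a)
        + frechet_derivative f (at x) (frechet_derivative h (at x) a)"
    using frechet_derivative_at expand[OF S(2), of "frechet_derivative h (at x) a"]
    by (fastforce simp: sum.distrib fun_eq_iff)
  also have "(\<Sum>b\<in>Basis. (h x \<bullet> b) *\<^sub>R frechet_derivative (?f b) (at x) a)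
      = frechet_derivative (\<lambda>y. \<Sum>b\<in>Basis. (h x \<bullet> b) *\<^sub>R ?f b y) (at x) a"
  proof -
    have "((\<lambda>y. \<Sum>b\<in>Basis. (h x \<bullet> b) *\<^sub>R ?f b y) has_derivative
      (\<lambda>a. \<Sum>b\<in>Basis. (h x \<bullet> b) *\<^sub>R frechet_derivative (?f b) (at x) a)) (at x)"
      by (intro has_derivative_sum has_derivative_scaleR_right D)
    from frechet_derivative_at[OF this] show ?thesis by (simp add: fun_eq_iff)
  qed
  also have "\<dots> = frechet_derivative (\<lambda>y. frechet_derivative f (at y) (h x)) (at x) a"
    by (subst frechet_derivative_cong_open[OF S, of _ "\<lambda>y. frechet_derivative f (at y) (h x)"])
      (use expand in auto)
  finally show ?thesis by (simp add: add.commute)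
qed

lemma frechet_derivative_fst:
  fixes f :: "'a::euclidean_space \<Rightarrow> 'c::real_normed_vector" and z :: "'a \<times> 'b::euclidean_space"
  assumes "f differentiable at (fst z)"
  shows "frechet_derivative (\<lambda>z. f (fst z)) (at z) w = frechet_derivative f (at (fst z)) (fst w)"
proof -
  have "((\<lambda>z. f (fst z)) has_derivative (\<lambda>w. frechet_derivative f (at (fst z)) (fst w))) (at z)"
    using diff_chain_at[OF has_derivative_fst[OF has_derivative_ident] assms[unfolded
        frechet_derivative_works]]
    by (simp add: o_def)
  then show ?thesis by (metis frechet_derivative_at)
qed

lemma smooth_on_fst_compose:
  assumes "open S" "smooth_on S f"
  shows "smooth_on (S \<times> (UNIV :: 'b::euclidean_space set)) (\<lambda>z. f (fst z))"
  using smooth_on_compose[OF _ assms(1) _ assms(2) smooth_on_fst[of "S \<times> UNIV"]] assms(1)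
  by (fastforce simp: open_Times)

section \<open>Symmetry of second derivatives\<close>

lemma has_real_derivative_along:
  assumes "(f has_derivative f') (at (c s))" "(c has_vector_derivative v) (at s)"
  shows "((\<lambda>s. f (c s)) has_real_derivative f' v) (at s)"
  unfolding has_real_derivative_iff_has_vector_derivative
  using vector_derivative_diff_chain_within[of c v s UNIV f f'] assms
  by (auto simp: o_def intro: has_derivative_at_withinI)

text \<open>The mean value theorem is used along \<open>v\<close> for the increment of
  \<open>f\<close> in direction \<open>w\<close>, then along \<open>w\<close> for the derivative of
  \<open>f\<close> in direction \<open>v\<close>.\<close>

lemma second_difference_mean_value:
  fixes f :: "'a::euclidean_space \<Rightarrow> real"
  assumes S: "open S" and f: "smooth_on S f" and h: "h > 0"
    and in_S: "\<And>s t. 0 \<le> s \<Longrightarrow> s \<le> h \<Longrightarrow> 0 \<le> t \<Longrightarrow> t \<le> h \<Longrightarrow> x + s *\<^sub>R v + t *\<^sub>R w \<in> S"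
  shows "\<exists>s t. 0 < s \<and> s < h \<and> 0 < t \<and> t < h \<and>
    f (x + h *\<^sub>R v + h *\<^sub>R w) - f (x + h *\<^sub>R v) - f (x + h *\<^sub>R w) + f x
    = h * h * frechet_derivative (\<lambda>x. frechet_derivative f (at x) v) (at (x + s *\<^sub>R v + t *\<^sub>R w)) w"
proof -
  define fv where "fv = (\<lambda>x. frechet_derivative f (at x) v)"
  have fv: "smooth_on S fv"
    unfolding fv_def by (rule smooth_on_frechet[OF f])
  have d1: "((\<lambda>s. f (x + s *\<^sub>R v + t *\<^sub>R w)) has_real_derivative fv (x + s *\<^sub>R v + t *\<^sub>R w)) (at s)"
    if "0 \<le> s" "s \<le> h" "0 \<le> t" "t \<le> h" for s t
  proof -
    have "((\<lambda>s. x + s *\<^sub>R v + t *\<^sub>R w) has_vector_derivative v) (at s)"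
      by (auto intro!: derivative_eq_intros)
    then show ?thesis
      using has_real_derivative_along[of f _ "\<lambda>s. x + s *\<^sub>R v + t *\<^sub>R w" s v,
          OF smooth_on_has_derivative[OF S f in_S[OF that]]]
      unfolding fv_def by blast
  qed
  have d2: "((\<lambda>t. fv (x + s *\<^sub>R v + t *\<^sub>R w)) has_real_derivative
      frechet_derivative fv (at (x + s *\<^sub>R v + t *\<^sub>R w)) w) (at t)"
    if "0 \<le> s" "s \<le> h" "0 \<le> t" "t \<le> h" for s t
  proof -
    have "((\<lambda>t. x + s *\<^sub>R v + t *\<^sub>R w) has_vector_derivative w) (at t)"
      by (auto intro!: derivative_eq_intros)
    then show ?thesis
      using has_real_derivative_along[of fv _ "\<lambda>t. x + s *\<^sub>R v + t *\<^sub>R w" t w,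
          OF smooth_on_has_derivative[OF S fv in_S[OF that]]]
      by blast
  qed
  \<comment> \<open>The summands \<open>0 *\<^sub>R v\<close> and \<open>0 *\<^sub>R w\<close> are
    kept so that all four corners have the form required by \<open>d1\<close>.\<close>
  obtain s where s: "0 < s" "s < h" and eq1:
    "(f (x + h *\<^sub>R v + h *\<^sub>R w) - f (x + h *\<^sub>R v + 0 *\<^sub>R w)) - (f (x + 0 *\<^sub>R v + h *\<^sub>R w) - f (x
        + 0 *\<^sub>R v + 0 *\<^sub>R w))
     = (h - 0) * (fv (x + s *\<^sub>R v + h *\<^sub>R w) - fv (x + s *\<^sub>R v + 0 *\<^sub>R w))"
  proof -
    have "\<exists>z>0. z < h \<and> (f (x + h *\<^sub>R v + h *\<^sub>R w) - f (x + h *\<^sub>R v + 0 *\<^sub>R w)) - (f (x + 0 *\<^sub>R v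
        + h *\<^sub>R w) - f (x + 0 *\<^sub>R v + 0 *\<^sub>R w))
     = (h - 0) * (fv (x + z *\<^sub>R v + h *\<^sub>R w) - fv (x + z *\<^sub>R v + 0 *\<^sub>R w))"
      by (rule MVT2[OF h, of "\<lambda>s. f (x + s *\<^sub>R v + h *\<^sub>R w) - f (x + s *\<^sub>R v + 0 *\<^sub>R w)"
        "\<lambda>s. fv (x + s *\<^sub>R v + h *\<^sub>R w) - fv (x + s *\<^sub>R v + 0 *\<^sub>R w)"])
        (use d1 h in \<open>intro DERIV_diff; simp del: scaleR_zero_left\<close>)
    then show ?thesis using that by blast
  qed
  obtain t where t: "0 < t" "t < h" and eq2:
    "fv (x + s *\<^sub>R v + h *\<^sub>R w) - fv (x + s *\<^sub>R v + 0 *\<^sub>R w)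
      = (h - 0) * frechet_derivative fv (at (x + s *\<^sub>R v + t *\<^sub>R w)) w"
    using MVT2[OF h, of "\<lambda>t. fv (x + s *\<^sub>R v + t *\<^sub>R w)"
        "\<lambda>t. frechet_derivative fv (at (x + s *\<^sub>R v + t *\<^sub>R w)) w", OF d2] s by auto
  have "f (x + h *\<^sub>R v + h *\<^sub>R w) - f (x + h *\<^sub>R v) - f (x + h *\<^sub>R w) + f x
    = h * h * frechet_derivative fv (at (x + s *\<^sub>R v + t *\<^sub>R w)) w"
    using eq1 unfolding eq2 by simp
  with s t show ?thesis unfolding fv_def by blast
qed

text \<open>The second difference over a parallelogram is symmetric in \<open>v\<close> and
  \<open>w\<close>, and equals \<open>h * h\<close> times either mixed derivative at some point of
  it. Continuity then forbids different values at \<open>x\<close>.\<close>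

theorem symmetric_second_derivative:
  fixes f :: "'a::euclidean_space \<Rightarrow> real"
  assumes S: "open S" and f: "smooth_on S f" and x: "x \<in> S"
  shows "frechet_derivative (\<lambda>x. frechet_derivative f (at x) v) (at x) w
       = frechet_derivative (\<lambda>x. frechet_derivative f (at x) w) (at x) v" (is "?A x = ?B x")
proof (rule ccontr)
  assume ne: "?A x \<noteq> ?B x"
  \<comment> \<open>Half the gap: values of \<open>?A\<close> and \<open>?B\<close> within
    \<open>e\<close> of \<open>?A x\<close> and \<open>?B x\<close> cannot coincide.\<close>
  define e where "e = \<bar>?A x - ?B x\<bar> / 2"
  have e: "e > 0" using ne by (simp add: e_def)
  have c: "continuous_on S ?A" "continuous_on S ?B"
    by (intro smooth_on_continuous_on smooth_on_frechet f)+
  obtain d1 where d1: "d1 > 0" "\<And>y. y \<in> S \<Longrightarrow> dist y x < d1 \<Longrightarrow> dist (?A y) (?A x) < e"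
    using c(1) x e unfolding continuous_on_iff by blast
  obtain d2 where d2: "d2 > 0" "\<And>y. y \<in> S \<Longrightarrow> dist y x < d2 \<Longrightarrow> dist (?B y) (?B x) < e"
    using c(2) x e unfolding continuous_on_iff by blast
  obtain d3 where d3: "d3 > 0" "ball x d3 \<subseteq> S"
    using S x open_contains_ball by blast
  define d where "d = min d1 (min d2 d3)"
  \<comment> \<open>This side length keeps the whole parallelogram in the ball of radius
    \<open>d\<close>; the summand \<open>1\<close> keeps the denominator positive.\<close>
  define h where "h = d / (2 * (norm v + norm w + 1))"
  have d: "d > 0" using d1 d2 d3 by (simp add: d_def)
  have h: "h > 0" unfolding h_def using d
    by (intro divide_pos_pos mult_pos_pos add_nonneg_pos add_nonneg_nonneg) auto
  have near: "dist (x + s *\<^sub>R v + t *\<^sub>R w) x < d" if "0 \<le> s" "s \<le> h" "0 \<le> t" "t \<le> h" for s t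
  proof -
    have "dist (x + s *\<^sub>R v + t *\<^sub>R w) x \<le> s * norm v + t * norm w"
      using that norm_triangle_ineq[of "s *\<^sub>R v" "t *\<^sub>R w"] by (simp add: dist_norm)
    also have "\<dots> \<le> h * norm v + h * norm w"
      using that by (intro add_mono mult_right_mono) auto
    also have "\<dots> < h * (2 * (norm v + norm w + 1))"
      using h mult_nonneg_nonneg[of h "norm v"] mult_nonneg_nonneg[of h "norm w"]
        norm_ge_zero[of v] norm_ge_zero[of w] unfolding distrib_left by linarith
    also have "\<dots> = d"
      using norm_ge_zero[of v] norm_ge_zero[of w] by (simp add: h_def add_nonneg_eq_0_iff)
    finally show ?thesis .
  qed
  have in_S: "x + s *\<^sub>R v + t *\<^sub>R w \<in> S" if "0 \<le> s" "s \<le> h" "0 \<le> t" "t \<le> h" for s t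
    using near[OF that] d3(2) by (auto simp: d_def dist_commute)
  obtain s t where st: "0 < s" "s < h" "0 < t" "t < h"
    "f (x + h *\<^sub>R v + h *\<^sub>R w) - f (x + h *\<^sub>R v) - f (x + h *\<^sub>R w) + f x
      = h * h * ?A (x + s *\<^sub>R v + t *\<^sub>R w)"
    using second_difference_mean_value[OF S f h in_S] by blast
  have in_S': "x + s *\<^sub>R w + t *\<^sub>R v \<in> S" if "0 \<le> s" "s \<le> h" "0 \<le> t" "t \<le> h" for s t
    using in_S[OF that(3,4,1,2)] by (simp add: algebra_simps)
  obtain s' t' where st': "0 < s'" "s' < h" "0 < t'" "t' < h"
    "f (x + h *\<^sub>R w + h *\<^sub>R v) - f (x + h *\<^sub>R w) - f (x + h *\<^sub>R v) + f x
      = h * h * ?B (x + s' *\<^sub>R w + t' *\<^sub>R v)"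
    using second_difference_mean_value[OF S f h in_S'] by blast
  have sw: "x + s' *\<^sub>R w + t' *\<^sub>R v = x + t' *\<^sub>R v + s' *\<^sub>R w"
    "x + h *\<^sub>R w + h *\<^sub>R v = x + h *\<^sub>R v + h *\<^sub>R w"
    by (simp_all add: algebra_simps)
  have "h * h * ?A (x + s *\<^sub>R v + t *\<^sub>R w) = h * h * ?B (x + t' *\<^sub>R v + s' *\<^sub>R w)"
    using st(5) st'(5) unfolding sw by linarith
  then have "?A (x + s *\<^sub>R v + t *\<^sub>R w) = ?B (x + t' *\<^sub>R v + s' *\<^sub>R w)"
    using h by simp
  moreover have "dist (?A (x + s *\<^sub>R v + t *\<^sub>R w)) (?A x) < e"
    using st near[of s t] by (intro d1 in_S) (auto simp: d_def)
  moreover have "dist (?B (x + t' *\<^sub>R v + s' *\<^sub>R w)) (?B x) < e"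
    using st' near[of t' s'] by (intro d2 in_S) (auto simp: d_def)
  ultimately show False
    unfolding e_def dist_real_def by (simp add: abs_if split: if_splits)
qed

section \<open>Tangent vectors\<close>

lemma sum_fun_apply [simp]: "(\<Sum>k\<in>K. f k) x = (\<Sum>k\<in>K. f k x)"
  by (induction K rule: infinite_finite_induct) auto

lemma vscale_apply [simp]: "(a \<cdot> v) i = a *\<^sub>R v i"
  by (simp add: vscale_def)

lemma vscale_simps [simp]:
  fixes v :: "'i \<Rightarrow> 'e::real_vector"
  shows "1 \<cdot> v = v" "0 \<cdot> v = 0" "a \<cdot> (0 :: 'i \<Rightarrow> 'e) = 0" "a \<cdot> b \<cdot> v = (a * b) \<cdot> v" "(- 1) \<cdot> v = - v"
    "a \<cdot> (- v) = (- a) \<cdot> v"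
  by (auto simp: fun_eq_iff)

lemma vscale_add_right: "a \<cdot> (v + w) = a \<cdot> v + a \<cdot> w"
  and vscale_diff_right: "a \<cdot> (v - w) = a \<cdot> v - a \<cdot> w"
  and vscale_minus_left: "(- a) \<cdot> v = - (a \<cdot> v)"
  by (auto simp: fun_eq_iff algebra_simps)

lemma vscale_sum_right: "a \<cdot> (\<Sum>k\<in>K. v k) = (\<Sum>k\<in>K. a \<cdot> v k)"
  by (auto simp: fun_eq_iff scaleR_sum_right)

text \<open>The local part of a smooth atlas, in a form that passes from \<open>M\<close> to
  \<open>tangent_bundle M\<close> by chart computations alone.\<close>

locale smooth_atlas =
  fixes M :: "('i, 'm, 'e::euclidean_space) atlas"
  assumes inj_chart: "i \<in> idx M \<Longrightarrow> inj_on (chart M i) (cdom M i)"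
    and open_overlap: "i \<in> idx M \<Longrightarrow> j \<in> idx M \<Longrightarrow> open (chart M i ` (cdom M i \<inter> cdom M j))"
    and smooth_transition: "i \<in> idx M \<Longrightarrow> j \<in> idx M \<Longrightarrow>
      smooth_on (chart M i ` (cdom M i \<inter> cdom M j)) (transition M i j)"
begin

lemma charts_at_iff: "i \<in> charts_at M p \<longleftrightarrow> i \<in> idx M \<and> p \<in> cdom M i"
  by (simp add: charts_at_def)

lemma param_chart [simp]: "i \<in> idx M \<Longrightarrow> p \<in> cdom M i \<Longrightarrow> param M i (chart M i p) = p"
  by (simp add: param_def inv_into_f_f inj_chart)

lemma transition_chart [simp]:
  "i \<in> idx M \<Longrightarrow> p \<in> cdom M i \<Longrightarrow> transition M i j (chart M i p) = chart M j p"
  by (simp add: transition_def)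

lemma mopen_imp_open: "mopen M U \<Longrightarrow> i \<in> idx M \<Longrightarrow> open (chart M i ` (U \<inter> cdom M i))"
  by (simp add: mopen_def)

lemma mopen_cdom: "i \<in> idx M \<Longrightarrow> mopen M (cdom M i)"
  using open_overlap by (auto simp: mopen_def carrier_of_def Int_commute)

lemma mopen_carrier: "mopen M U \<Longrightarrow> U \<subseteq> carrier_of M"
  by (simp add: mopen_def)

lemma carrier_chart: "p \<in> carrier_of M \<Longrightarrow> \<exists>i. i \<in> charts_at M p"
  by (auto simp: carrier_of_def charts_at_def)

lemma mopen_Int:
  assumes "mopen M U" "mopen M V"
  shows "mopen M (U \<inter> V)"
proof -
  have "chart M i ` (U \<inter> V \<inter> cdom M i) = chart M i ` (U \<inter> cdom M i) \<inter> chart M i ` (V \<inter> cdom M i)"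
    if "i \<in> idx M" for i
    using inj_on_image_Int[OF inj_chart[OF that], of "U \<inter> cdom M i" "V \<inter> cdom M i"]
    by (simp add: Int_ac)
  then show ?thesis
    using assms by (auto simp: mopen_def)
qed

lemma has_derivative_transition:
  assumes "i \<in> charts_at M p" "j \<in> charts_at M p"
  shows "(transition M i j has_derivative dtrans M i j p) (at (chart M i p))"
  unfolding dtrans_def
  by (rule smooth_on_has_derivative[OF open_overlap smooth_transition])
    (use assms in \<open>auto simp: charts_at_iff\<close>)

lemma linear_dtrans: "i \<in> charts_at M p \<Longrightarrow> j \<in> charts_at M p \<Longrightarrow> linear (dtrans M i j p)"
  using has_derivative_transition has_derivative_linear by blast

text \<open>Chain rule: near \<open>chart M i p\<close> the transition from \<open>i\<close> to
  \<open>k\<close> factors through \<open>j\<close>. This cocycle identity makes the components of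
  \<open>const_field\<close> compatible.\<close>

lemma dtrans_comp:
  assumes "i \<in> charts_at M p" "j \<in> charts_at M p" "k \<in> charts_at M p"
  shows "dtrans M j k p (dtrans M i j p v) = dtrans M i k p v"
proof -
  let ?U = "cdom M j \<inter> cdom M k"
  have i: "i \<in> idx M" "p \<in> cdom M i" and U: "mopen M ?U" "p \<in> ?U"
    using assms by (auto simp: charts_at_iff mopen_Int mopen_cdom)
  have "(transition M j k \<circ> transition M i j has_derivative dtrans M j k p \<circ> dtrans M i j p)
      (at (chart M i p))"
    using has_derivative_transition[OF assms(1,2)] has_derivative_transition[OF assms(2,3)] i
    by (intro diff_chain_at) auto
  then have "(transition M i k has_derivative dtrans M j k p \<circ> dtrans M i j p) (at (chart M i p))"
    by (rule has_derivative_transform_within_open[OF _ mopen_imp_open[OF U(1) i(1)]])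
      (use i U assms in \<open>auto simp: charts_at_iff\<close>)
  then show ?thesis
    using has_derivative_unique[OF _ has_derivative_transition[OF assms(1,3)]] by (metis comp_apply)
qed

lemma dtrans_self: "i \<in> charts_at M p \<Longrightarrow> dtrans M i i p v = v"
proof -
  assume i: "i \<in> charts_at M p"
  have "(transition M i i has_derivative (\<lambda>v. v)) (at (chart M i p))"
    by (rule has_derivative_transform_within_open[OF has_derivative_ident open_overlap[of i i]])
      (use i in \<open>auto simp: charts_at_iff\<close>)
  then show ?thesis
    using has_derivative_unique[OF _ has_derivative_transition[OF i i]] by metis
qed

lemma tangentI:
  "(\<And>i j. i \<in> charts_at M p \<Longrightarrow> j \<in> charts_at M p \<Longrightarrow> dtrans M i j p (v i) = v j) \<Longrightarrow>
   (\<And>i. i \<notin> charts_at M p \<Longrightarrow> v i = 0) \<Longrightarrow> v \<in> tangent_space M p"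
  unfolding tangent_space_def by (intro CollectI conjI ballI allI impI) simp_all

lemma tangent_transform:
  "v \<in> tangent_space M p \<Longrightarrow> i \<in> charts_at M p \<Longrightarrow> j \<in> charts_at M p \<Longrightarrow> dtrans M i j p (v i) = v j"
  unfolding tangent_space_def by (drule CollectD, rule sym, blast)

lemma tangent_outside: "v \<in> tangent_space M p \<Longrightarrow> i \<notin> charts_at M p \<Longrightarrow> v i = 0"
  by (simp add: tangent_space_def)

lemma tangent_zero [simp]: "0 \<in> tangent_space M p"
  by (rule tangentI) (auto simp: linear_0[OF linear_dtrans])

lemma tangent_add [simp]:
  "u \<in> tangent_space M p \<Longrightarrow> v \<in> tangent_space M p \<Longrightarrow> u + v \<in> tangent_space M p"
  by (rule tangentI) (auto simp: linear_add[OF linear_dtrans] tangent_transform tangent_outside)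

lemma tangent_scale [simp]: "v \<in> tangent_space M p \<Longrightarrow> a \<cdot> v \<in> tangent_space M p"
  by (rule tangentI) (auto simp: linear_scale[OF linear_dtrans] tangent_transform tangent_outside)

lemma tangent_uminus [simp]: "v \<in> tangent_space M p \<Longrightarrow> - v \<in> tangent_space M p"
  using tangent_scale[of v p "- 1"] by simp

lemma tangent_diff [simp]:
  "u \<in> tangent_space M p \<Longrightarrow> v \<in> tangent_space M p \<Longrightarrow> u - v \<in> tangent_space M p"
  using tangent_add[of u p "- v"] by simp

lemma tangent_sum [simp]:
  "(\<And>k. k \<in> K \<Longrightarrow> v k \<in> tangent_space M p) \<Longrightarrow> (\<Sum>k\<in>K. v k) \<in> tangent_space M p"
  by (induction K rule: infinite_finite_induct) auto

text \<open>One component determines a tangent vector, through the derivatives of the transitions,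
  so equalities can be checked in a single chart.\<close>

lemma tangent_eqI:
  assumes "u \<in> tangent_space M p" "v \<in> tangent_space M p" "i \<in> charts_at M p" "u i = v i"
  shows "u = v"
proof
  fix j show "u j = v j"
    using assms tangent_transform[of _ p i j] tangent_outside[of _ p j]
    by (cases "j \<in> charts_at M p") metis+
qed

lemma const_field_tangent [simp]: "const_field M i a p \<in> tangent_space M p"
  by (rule tangentI) (auto simp: const_field_def dtrans_comp linear_0[OF linear_dtrans])

lemma const_field_apply: "i \<in> charts_at M p \<Longrightarrow> const_field M i a p i = a"
  by (simp add: const_field_def dtrans_self)

lemma const_field_add: "const_field M i (a + b) = const_field M i a + const_field M i b"
  using linear_add[OF linear_dtrans] by (fastforce simp: const_field_def fun_eq_iff)

lemma const_field_scale: "const_field M i (r *\<^sub>R a) = (\<lambda>p. r \<cdot> const_field M i a p)"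
  using linear_scale[OF linear_dtrans] by (fastforce simp: const_field_def fun_eq_iff)

lemma tangent_eq_const_field:
  "u \<in> tangent_space M p \<Longrightarrow> i \<in> charts_at M p \<Longrightarrow> u = const_field M i (u i) p"
  by (rule tangent_eqI) (auto simp: const_field_apply)

lemma tangent_expand:
  assumes "u \<in> tangent_space M p" "i \<in> charts_at M p"
  shows "u = (\<Sum>b\<in>Basis. (u i \<bullet> b) \<cdot> const_field M i b p)"
  by (rule tangent_eqI[OF _ _ assms(2)])
    (use assms in \<open>auto simp: const_field_apply euclidean_representation\<close>)

section \<open>Smooth functions and vector fields\<close>

lemma smooth_funI:
  "(\<And>i. i \<in> idx M \<Longrightarrow> smooth_on (chart M i ` (U \<inter> cdom M i)) (\<lambda>x. f (param M i x))) \<Longrightarrow>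
      smooth_fun M U f"
  by (simp add: smooth_fun_def o_def)

lemma smooth_funD:
  "smooth_fun M U f \<Longrightarrow> i \<in> idx M \<Longrightarrow> smooth_on (chart M i ` (U \<inter> cdom M i)) (\<lambda>x. f (param M i x))"
  by (simp add: smooth_fun_def o_def)

lemma smooth_fun_const: "mopen M U \<Longrightarrow> smooth_fun M U (\<lambda>p. c)"
  by (rule smooth_funI) (intro smooth_on_const mopen_imp_open)

lemma smooth_fun_add:
  "mopen M U \<Longrightarrow> smooth_fun M U f \<Longrightarrow> smooth_fun M U h \<Longrightarrow> smooth_fun M U (\<lambda>p. f p + h p)"
  by (rule smooth_funI) (intro smooth_on_add mopen_imp_open smooth_funD)

lemma smooth_fun_mult:
  "mopen M U \<Longrightarrow> smooth_fun M U f \<Longrightarrow> smooth_fun M U h \<Longrightarrow> smooth_fun M U (\<lambda>p. f p * h p)"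
  by (rule smooth_funI) (intro smooth_on_mult mopen_imp_open smooth_funD)

lemma smooth_fun_uminus: "mopen M U \<Longrightarrow> smooth_fun M U f \<Longrightarrow> smooth_fun M U (\<lambda>p. - f p)"
  by (rule smooth_funI) (intro smooth_on_uminus mopen_imp_open smooth_funD)

lemma smooth_fun_sum:
  "mopen M U \<Longrightarrow> (\<And>k. k \<in> K \<Longrightarrow> smooth_fun M U (f k)) \<Longrightarrow> smooth_fun M U (\<lambda>p. \<Sum>k\<in>K. f k p)"
  by (rule smooth_funI) (intro smooth_on_sum mopen_imp_open smooth_funD)

lemma smooth_fun_powr:
  assumes "mopen M U" "smooth_fun M U f" "\<And>p. p \<in> U \<Longrightarrow> f p > 0"
  shows "smooth_fun M U (\<lambda>p. f p powr a)"
  by (rule smooth_funI, rule smooth_on_powr[OF mopen_imp_open smooth_funD])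
    (use assms in auto)

lemma transition_image:
  assumes "i \<in> idx M" "j \<in> idx M" "U \<subseteq> cdom M i"
  shows "transition M j i ` (chart M j ` (U \<inter> cdom M j)) \<subseteq> chart M i ` (U \<inter> cdom M i)"
  using assms by auto

lemma smooth_transition_subset:
  assumes "i \<in> idx M" "j \<in> idx M" "U \<subseteq> cdom M i"
  shows "smooth_on (chart M j ` (U \<inter> cdom M j)) (transition M j i)"
  by (rule smooth_on_subset[OF smooth_transition]) (use assms in auto)

lemma smooth_on_change_chart:
  assumes "mopen M U" "i \<in> idx M" "j \<in> idx M" "U \<subseteq> cdom M i"
    and "smooth_on (chart M i ` (U \<inter> cdom M i)) F"
  shows "smooth_on (chart M j ` (U \<inter> cdom M j)) (\<lambda>x. F (transition M j i x))"
  by (rule smooth_on_compose[OF mopen_imp_open mopen_imp_open transition_image assms(5)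
        smooth_transition_subset]) (use assms in auto)

lemma smooth_fun_single_chart:
  assumes "mopen M U" "i \<in> idx M" "U \<subseteq> cdom M i"
    and "smooth_on (chart M i ` (U \<inter> cdom M i)) (\<lambda>x. f (param M i x))"
  shows "smooth_fun M U f"
proof (rule smooth_funI)
  fix j assume j: "j \<in> idx M"
  show "smooth_on (chart M j ` (U \<inter> cdom M j)) (\<lambda>x. f (param M j x))"
    by (rule smooth_on_cong[OF mopen_imp_open[OF assms(1) j]
          smooth_on_change_chart[OF assms(1,2) j assms(3,4)]])
      (use assms j in auto)
qed

lemma vector_fieldI:
  "(\<And>p. p \<in> U \<Longrightarrow> X p \<in> tangent_space M p) \<Longrightarrow>
   (\<And>i. i \<in> idx M \<Longrightarrow> smooth_on (chart M i ` (U \<inter> cdom M i)) (\<lambda>x. X (param M i x) i)) \<Longrightarrow>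
   vector_field M U X"
  by (simp add: vector_field_def)

lemma vector_field_tangent: "vector_field M U X \<Longrightarrow> p \<in> U \<Longrightarrow> X p \<in> tangent_space M p"
  by (simp add: vector_field_def)

lemma vector_field_smooth:
  "vector_field M U X \<Longrightarrow> i \<in> idx M \<Longrightarrow>
    smooth_on (chart M i ` (U \<inter> cdom M i)) (\<lambda>x. X (param M i x) i)"
  by (simp add: vector_field_def)

lemma vector_field_subset: "vector_field M U X \<Longrightarrow> V \<subseteq> U \<Longrightarrow> vector_field M V X"
  by (rule vector_fieldI, blast dest: vector_field_tangent, rule smooth_on_subset[OF
      vector_field_smooth]) auto

lemma vector_field_cong:
  assumes "mopen M U" "vector_field M U X" "\<And>p. p \<in> U \<Longrightarrow> X p = Y p"
  shows "vector_field M U Y"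
proof (rule vector_fieldI)
  fix i assume "i \<in> idx M"
  then show "smooth_on (chart M i ` (U \<inter> cdom M i)) (\<lambda>x. Y (param M i x) i)"
    by (intro smooth_on_cong[OF mopen_imp_open[OF assms(1)] vector_field_smooth[OF assms(2)]])
      (auto simp: assms(3))
qed (use assms vector_field_tangent in metis)

lemma vector_field_add:
  assumes "mopen M U" "vector_field M U X" "vector_field M U Y"
  shows "vector_field M U (X + Y)"
proof (rule vector_fieldI)
  fix i assume i: "i \<in> idx M"
  show "smooth_on (chart M i ` (U \<inter> cdom M i)) (\<lambda>x. (X + Y) (param M i x) i)"
    using smooth_on_add[OF mopen_imp_open vector_field_smooth vector_field_smooth] assms i by simp
qed (use assms in \<open>auto simp: vector_field_tangent\<close>)

lemma vector_field_scale:
  assumes "mopen M U" "smooth_fun M U f" "vector_field M U X"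
  shows "vector_field M U (\<lambda>p. f p \<cdot> X p)"
proof (rule vector_fieldI)
  fix i assume i: "i \<in> idx M"
  show "smooth_on (chart M i ` (U \<inter> cdom M i)) (\<lambda>x. (f (param M i x) \<cdot> X (param M i x)) i)"
    using smooth_on_scaleR[OF mopen_imp_open smooth_funD vector_field_smooth] assms i by simp
qed (use assms in \<open>auto simp: vector_field_tangent\<close>)

lemma vector_field_zero: "mopen M U \<Longrightarrow> vector_field M U 0"
  by (rule vector_fieldI) (auto intro: smooth_on_const mopen_imp_open)

lemma vector_field_uminus:
  assumes "mopen M U" "vector_field M U X"
  shows "vector_field M U (- X)"
  using vector_field_scale[OF assms(1) smooth_fun_const[OF assms(1), of "- 1"] assms(2)]
  by (simp add: fun_Compl_def)

lemma vector_field_diff: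
  assumes "mopen M U" "vector_field M U X" "vector_field M U Y"
  shows "vector_field M U (X - Y)"
  using vector_field_add[OF assms(1,2) vector_field_uminus[OF assms(1,3)]] by simp

lemma vector_field_sum:
  assumes "mopen M U" "\<And>k. k \<in> K \<Longrightarrow> vector_field M U (X k)"
  shows "vector_field M U (\<Sum>k\<in>K. X k)"
  using assms(2)
  by (induction K rule: infinite_finite_induct)
      (auto intro: vector_field_zero vector_field_add assms(1))

text \<open>In any other chart the component is the derivative of the transition applied to the
  given component, hence a smooth expression in the coordinates.\<close>

lemma vector_field_single_chart:
  assumes U: "mopen M U" "U \<subseteq> cdom M i" and i: "i \<in> idx M"
    and X: "\<And>p. p \<in> U \<Longrightarrow> X p \<in> tangent_space M p"
      "smooth_on (chart M i ` (U \<inter> cdom M i)) (\<lambda>x. X (param M i x) i)"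
  shows "vector_field M U X"
proof (rule vector_fieldI[OF X(1)])
  fix j assume j: "j \<in> idx M"
  let ?S = "chart M i ` (U \<inter> cdom M i \<inter> cdom M j)"
  let ?V = "U \<inter> cdom M j"
  have V: "mopen M ?V" "?V \<subseteq> cdom M i"
    using U j by (auto intro: mopen_Int mopen_cdom)
  have S: "open (chart M i ` (?V \<inter> cdom M i))"
    by (rule mopen_imp_open[OF V(1) i])
  have "smooth_on (chart M i ` (?V \<inter> cdom M i))
      (\<lambda>x. frechet_derivative (transition M i j) (at x) (X (param M i x) i))"
    by (intro smooth_on_frechet_apply[OF S] smooth_on_subset[OF smooth_transition[OF i j]]
        smooth_on_subset[OF X(2)]) auto
  from smooth_on_change_chart[OF V(1) i j V(2) this]
  have *: "smooth_on (chart M j ` (U \<inter> cdom M j)) (\<lambda>x. frechet_derivative (transition M i j)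
      (at (transition M j i x)) (X (param M i (transition M j i x)) i))"
    by (simp add: Int_ac)
  show "smooth_on (chart M j ` (U \<inter> cdom M j)) (\<lambda>x. X (param M j x) j)"
  proof (rule smooth_on_cong[OF mopen_imp_open[OF U(1) j] *])
    fix x assume "x \<in> chart M j ` (U \<inter> cdom M j)"
    then obtain p where p: "x = chart M j p" "p \<in> U" "p \<in> cdom M j" by blast
    have "dtrans M i j p (X p i) = X p j"
      using tangent_transform[OF X(1)[OF p(2)]] p U i j by (auto simp: charts_at_iff)
    then show "frechet_derivative (transition M i j)
      (at (transition M j i x)) (X (param M i (transition M j i x)) i) = X (param M j x) j"
      using p U i j by (auto simp: dtrans_def)
  qed
qed

lemma vector_field_const_field:
  assumes "mopen M U" "U \<subseteq> cdom M i" "i \<in> idx M"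
  shows "vector_field M U (const_field M i a)"
proof (rule vector_field_single_chart[OF assms const_field_tangent])
  show "smooth_on (chart M i ` (U \<inter> cdom M i)) (\<lambda>x. const_field M i a (param M i x) i)"
    by (rule smooth_on_cong[OF mopen_imp_open[OF assms(1,3)] smooth_on_const[of _ a]])
      (use assms in \<open>auto simp: const_field_apply charts_at_iff mopen_imp_open\<close>)
qed

lemma smooth_fun_component:
  assumes "mopen M U" "U \<subseteq> cdom M i" "i \<in> idx M" "vector_field M U X"
  shows "smooth_fun M U (\<lambda>p. X p i \<bullet> b)"
  by (rule smooth_fun_single_chart[OF assms(1,3,2)])
    (use assms in \<open>auto intro!: smooth_on_inner_left vector_field_smooth mopen_imp_open\<close>)

lemma vector_field_expand:
  assumes "p \<in> U" "U \<subseteq> cdom M i" "i \<in> idx M" "vector_field M U X"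
  shows "X p = (\<Sum>b\<in>Basis. (X p i \<bullet> b) \<cdot> const_field M i b p)"
  using tangent_expand[of "X p" p i] assms by (auto simp: vector_field_tangent charts_at_iff)

section \<open>Directional derivatives and Lie brackets\<close>

lemma some_chart: "i \<in> charts_at M p \<Longrightarrow> (SOME i. i \<in> charts_at M p) \<in> charts_at M p"
  by (metis someI)

lemma smooth_fun_has_derivative:
  assumes "mopen M U" "p \<in> U" "smooth_fun M U f" "i \<in> charts_at M p"
  shows "((\<lambda>x. f (param M i x)) has_derivative
    frechet_derivative (\<lambda>x. f (param M i x)) (at (chart M i p))) (at (chart M i p))"
  by (rule smooth_on_has_derivative[OF mopen_imp_open[OF assms(1)] smooth_funD[OF assms(3)]])
    (use assms in \<open>auto simp: charts_at_iff\<close>)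

lemma vector_field_has_derivative:
  assumes "mopen M U" "p \<in> U" "vector_field M U X" "i \<in> charts_at M p"
  shows "((\<lambda>x. X (param M i x) i) has_derivative
    frechet_derivative (\<lambda>x. X (param M i x) i) (at (chart M i p))) (at (chart M i p))"
  by (rule smooth_on_has_derivative[OF mopen_imp_open[OF assms(1)] vector_field_smooth[OF
      assms(3)]])
    (use assms in \<open>auto simp: charts_at_iff\<close>)

text \<open>The chart in \<open>dir_deriv\<close> is an unknown choice. The chain rule transfers the
  derivative to chart \<open>i\<close>, and the transformation law of \<open>X p\<close> absorbs the
  derivative of the transition.\<close>

lemma dir_deriv_chart:
  assumes U: "mopen M U" "p \<in> U" and f: "smooth_fun M U f" and X: "X p \<in> tangent_space M p"
    and i: "i \<in> charts_at M p"
  shows "dir_deriv M X f p = frechet_derivative (\<lambda>x. f (param M i x)) (at (chart M i p)) (X p i)"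
proof -
  define j where "j = (SOME i. i \<in> charts_at M p)"
  have j: "j \<in> charts_at M p"
    unfolding j_def by (rule some_chart[OF i])
  let ?f = "\<lambda>i x. f (param M i x)"
  have "(?f i \<circ> transition M j i has_derivative
      frechet_derivative (?f i) (at (chart M i p)) \<circ> dtrans M j i p) (at (chart M j p))"
    using has_derivative_transition[OF j i] smooth_fun_has_derivative[OF U f i] j
    by (intro diff_chain_at) (auto simp: charts_at_iff)
  then have "(?f j has_derivative
      frechet_derivative (?f i) (at (chart M i p)) \<circ> dtrans M j i p) (at (chart M j p))"
    by (rule has_derivative_transform_within_open[OF _
          mopen_imp_open[OF mopen_cdom[of i], of j]])
      (use i j in \<open>auto simp: charts_at_iff\<close>)
  then have "frechet_derivative (?f j) (at (chart M j p)) (X p j)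
      = frechet_derivative (?f i) (at (chart M i p)) (dtrans M j i p (X p j))"
    using frechet_derivative_at by (metis comp_apply)
  also have "dtrans M j i p (X p j) = X p i"
    using tangent_transform[OF X j i] .
  finally show ?thesis
    by (simp add: dir_deriv_def j_def Let_def o_def)
qed

text \<open>Applies before smoothness is known: expressions in the metric of the tangent bundle can
  be replaced by functions pulled back from the base, whose derivatives are then computed. The
  fields only have to agree at \<open>p\<close>.\<close>

lemma dir_deriv_cong:
  assumes U: "mopen M U" "p \<in> U" and eq: "\<And>q. q \<in> U \<Longrightarrow> f q = h q" and X: "X p = Y p"
  shows "dir_deriv M X f p = dir_deriv M Y h p"
proof -
  obtain i where "i \<in> charts_at M p"
    using carrier_chart mopen_carrier U by blast
  then have j: "(SOME i. i \<in> charts_at M p) \<in> charts_at M p" (is "?j \<in> _")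
    by (rule some_chart)
  have "frechet_derivative (f \<circ> param M ?j) (at (chart M ?j p))
      = frechet_derivative (h \<circ> param M ?j) (at (chart M ?j p))"
    by (rule frechet_derivative_cong_open[OF mopen_imp_open[OF U(1), of ?j]])
      (use j U eq in \<open>auto simp: charts_at_iff\<close>)
  then show ?thesis
    by (simp add: dir_deriv_def Let_def X)
qed

context
  fixes U p
  assumes U: "mopen M U" "p \<in> U"
begin

lemma dir_deriv_const: "dir_deriv M X (\<lambda>q. c) p = 0"
  by (simp add: dir_deriv_def Let_def o_def)

lemma dir_deriv_add:
  assumes "smooth_fun M U f" "smooth_fun M U h" "X p \<in> tangent_space M p"
  shows "dir_deriv M X (\<lambda>q. f q + h q) p = dir_deriv M X f p + dir_deriv M X h p"
proof -
  obtain i where i: "i \<in> charts_at M p"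
    using carrier_chart mopen_carrier U by blast
  have "frechet_derivative (\<lambda>x. f (param M i x) + h (param M i x)) (at (chart M i p))
      = (\<lambda>v. frechet_derivative (\<lambda>x. f (param M i x)) (at (chart M i p)) v
        + frechet_derivative (\<lambda>x. h (param M i x)) (at (chart M i p)) v)"
    by (intro frechet_derivative_at[symmetric] has_derivative_add
        smooth_fun_has_derivative[OF U] assms i)
  then show ?thesis
    using assms i U by (simp add: dir_deriv_chart[OF U _ _ i] smooth_fun_add)
qed

lemma dir_deriv_mult:
  assumes "smooth_fun M U f" "smooth_fun M U h" "X p \<in> tangent_space M p"
  shows "dir_deriv M X (\<lambda>q. f q * h q) p = f p * dir_deriv M X h p + dir_deriv M X f p * h p"
proof -
  obtain i where i: "i \<in> charts_at M p"
    using carrier_chart mopen_carrier U by blast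
  have "frechet_derivative (\<lambda>x. f (param M i x) * h (param M i x)) (at (chart M i p))
      = (\<lambda>v. f (param M i (chart M i p)) * frechet_derivative (\<lambda>x. h (param M i x)) (at
          (chart M i p)) v
        + frechet_derivative (\<lambda>x. f (param M i x)) (at (chart M i p)) v * h (param M i
            (chart M i p)))"
    by (intro frechet_derivative_at[symmetric] has_derivative_mult
        smooth_fun_has_derivative[OF U] assms i)
  then show ?thesis
    using assms i U by (simp add: dir_deriv_chart[OF U _ _ i] smooth_fun_mult charts_at_iff)
qed

lemma dir_deriv_sum:
  assumes "\<And>k. k \<in> K \<Longrightarrow> smooth_fun M U (f k)" "X p \<in> tangent_space M p"
  shows "dir_deriv M X (\<lambda>q. \<Sum>k\<in>K. f k q) p = (\<Sum>k\<in>K. dir_deriv M X (f k) p)"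
  using assms(1)
proof (induction K rule: infinite_finite_induct)
  case (insert k K)
  then show ?case
    using dir_deriv_add[of "f k" "\<lambda>q. \<Sum>k\<in>K. f k q" X] assms(2)
    by (simp add: smooth_fun_sum[OF U(1)])
qed (simp_all add: dir_deriv_const)

lemma dir_deriv_linear_field:
  assumes "smooth_fun M U f" "X p \<in> tangent_space M p" "Y p \<in> tangent_space M p"
    "Z p = a \<cdot> X p + b \<cdot> Y p"
  shows "dir_deriv M Z f p = a * dir_deriv M X f p + b * dir_deriv M Y f p"
proof -
  obtain i where i: "i \<in> charts_at M p"
    using carrier_chart mopen_carrier U by blast
  have lin: "linear (frechet_derivative (\<lambda>x. f (param M i x)) (at (chart M i p)))"
    using has_derivative_linear[OF smooth_fun_has_derivative[OF U assms(1) i]] .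
  have "Z p \<in> tangent_space M p" "Z p i = a *\<^sub>R X p i + b *\<^sub>R Y p i"
    using assms by auto
  then show ?thesis
    using assms(1-3) i by (simp add: dir_deriv_chart[OF U _ _ i] linear_add[OF lin] linear_scale[OF
        lin])
qed

end

lemma smooth_fun_dir_deriv:
  assumes U: "mopen M U" and f: "smooth_fun M U f" and X: "vector_field M U X"
  shows "smooth_fun M U (dir_deriv M X f)"
proof (rule smooth_funI)
  fix i assume i: "i \<in> idx M"
  note S = mopen_imp_open[OF U i]
  show "smooth_on (chart M i ` (U \<inter> cdom M i)) (\<lambda>x. dir_deriv M X f (param M i x))"
    by (rule smooth_on_cong[OF S smooth_on_frechet_apply[OF S smooth_funD[OF f i]
        vector_field_smooth[OF X i]]])
      (use i U X in \<open>auto simp: charts_at_iff dir_deriv_chart[OF U _ f] vector_field_tangent\<close>)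
qed

lemma lie_bracket_apply:
  "i \<in> charts_at M p \<Longrightarrow> lie_bracket M X Y p i =
    frechet_derivative (\<lambda>x. Y (param M i x) i) (at (chart M i p)) (X p i)
    - frechet_derivative (\<lambda>x. X (param M i x) i) (at (chart M i p)) (Y p i)"
  by (simp add: lie_bracket_def)

lemma lie_bracket_swap: "lie_bracket M Y X = - lie_bracket M X Y"
  by (auto simp: fun_eq_iff lie_bracket_def)

text \<open>The first-order terms form the bracket, and the second-order terms cancel by symmetry of
  second derivatives.\<close>

lemma dir_deriv_commutator:
  assumes U: "mopen M U" "p \<in> U" and f: "smooth_fun M U f"
    and X: "vector_field M U X" and Y: "vector_field M U Y"
  shows "dir_deriv M (lie_bracket M X Y) f p
    = dir_deriv M X (dir_deriv M Y f) p - dir_deriv M Y (dir_deriv M X f) p"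
proof -
  \<comment> \<open>The chart chosen by \<open>dir_deriv\<close> itself: the left side then unfolds
    directly, although \<open>lie_bracket\<close> is not yet known to give tangent vectors.\<close>
  define i where "i = (SOME i. i \<in> charts_at M p)"
  have i: "i \<in> charts_at M p"
    unfolding i_def using carrier_chart mopen_carrier U some_chart by blast
  define F where "F = (\<lambda>x. f (param M i x))"
  let ?S = "chart M i ` (U \<inter> cdom M i)" and ?x = "chart M i p"
  have S: "open ?S" "?x \<in> ?S"
    using i U by (auto intro: mopen_imp_open simp: charts_at_iff)
  have F: "smooth_on ?S F"
    unfolding F_def using i f by (auto intro: smooth_funD simp: charts_at_iff)
  have second: "dir_deriv M X (dir_deriv M Y f) p
      = frechet_derivative F (at ?x) (frechet_derivative (\<lambda>x. Y (param M i x) i) (at ?x) (X p i))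
      + frechet_derivative (\<lambda>y. frechet_derivative F (at y) (Y p i)) (at ?x) (X p i)"
    if X: "vector_field M U X" and Y: "vector_field M U Y" for X Y
  proof -
    have "dir_deriv M X (dir_deriv M Y f) p
        = frechet_derivative (\<lambda>x. dir_deriv M Y f (param M i x)) (at ?x) (X p i)"
      by (rule dir_deriv_chart[OF U smooth_fun_dir_deriv[OF U(1) f Y] _ i])
        (use X U in \<open>auto simp: vector_field_tangent\<close>)
    also have "frechet_derivative (\<lambda>x. dir_deriv M Y f (param M i x)) (at ?x)
        = frechet_derivative (\<lambda>x. frechet_derivative F (at x) (Y (param M i x) i)) (at ?x)"
      by (rule frechet_derivative_cong_open[OF S])
        (use i Y in \<open>auto simp: F_def charts_at_iff dir_deriv_chart[OF U(1) _ f]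
            vector_field_tangent\<close>)
    also have "\<dots> (X p i) = frechet_derivative F (at ?x) (frechet_derivative (\<lambda>x. Y
        (param M i x) i) (at ?x) (X p i))
      + frechet_derivative (\<lambda>y. frechet_derivative F (at y) (Y (param M i ?x) i)) (at ?x) (X p i)"
      using i by (intro frechet_derivative_apply_deriv[OF S F] vector_field_smooth[OF Y])
          (simp add: charts_at_iff)
    finally show ?thesis
      using i by (simp add: charts_at_iff)
  qed
  have lin: "linear (frechet_derivative F (at ?x))"
    using has_derivative_linear[OF smooth_on_has_derivative[OF S(1) F S(2)]] .
  have "dir_deriv M (lie_bracket M X Y) f p
      = frechet_derivative F (at ?x) (lie_bracket M X Y p i)"
    by (simp add: dir_deriv_def i_def F_def o_def Let_def)
  then show ?thesis
    using symmetric_second_derivative[OF S(1) F S(2), of "X p i" "Y p i"]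
    by (simp add: second X Y lie_bracket_apply[OF i] linear_diff[OF lin])
qed

end

section \<open>Tensorial operators and connections\<close>

context smooth_atlas
begin

text \<open>Linearity over smooth functions, evaluated at \<open>p\<close>. The clause on agreement
  over \<open>U\<close> is there because fields are total functions with arbitrary values outside
  \<open>U\<close>. For operators with values in tangent vectors, \<open>L\<close> is one component
  of the result, which lives in a real vector space.\<close>

definition tensorial_at :: "'m set \<Rightarrow> 'm \<Rightarrow> (('m \<Rightarrow> 'i \<Rightarrow> 'e) \<Rightarrow> 'v::real_vector) \<Rightarrow> bool" where
  "tensorial_at U p L \<longleftrightarrow> (\<forall>X X' f. vector_field M U X \<and> vector_field M U X' \<and> smooth_fun M U f \<longrightarrow>
     ((\<forall>q\<in>U. X q = X' q) \<longrightarrow> L X = L X') \<and>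
     L (X + X') = L X + L X' \<and> L (\<lambda>q. f q \<cdot> X q) = f p *\<^sub>R L X)"

lemma tensorial_atI:
  assumes "\<And>X X'. vector_field M U X \<Longrightarrow> vector_field M U X' \<Longrightarrow> (\<And>q. q \<in> U \<Longrightarrow> X q = X' q) \<Longrightarrow> L X = L X'"
    and "\<And>X X'. vector_field M U X \<Longrightarrow> vector_field M U X' \<Longrightarrow> L (X + X') = L X + L X'"
    and "\<And>X f. vector_field M U X \<Longrightarrow> smooth_fun M U f \<Longrightarrow> L (\<lambda>q. f q \<cdot> X q) = f p *\<^sub>R L X"
  shows "tensorial_at U p L"
  using assms unfolding tensorial_at_def by blast

context
  fixes U p and L :: "('m \<Rightarrow> 'i \<Rightarrow> 'e) \<Rightarrow> 'v::real_vector"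
  assumes L: "tensorial_at U p L" and U: "mopen M U"
begin

lemma tensorial_cong:
  "vector_field M U X \<Longrightarrow> vector_field M U X' \<Longrightarrow> (\<And>q. q \<in> U \<Longrightarrow> X q = X' q) \<Longrightarrow> L X = L X'"
  using L smooth_fun_const[OF U, of 0] unfolding tensorial_at_def by blast

lemma tensorial_add: "vector_field M U X \<Longrightarrow> vector_field M U X' \<Longrightarrow> L (X + X') = L X + L X'"
  using L smooth_fun_const[OF U, of 0] unfolding tensorial_at_def by blast

lemma tensorial_scale: "vector_field M U X \<Longrightarrow> smooth_fun M U f \<Longrightarrow> L (\<lambda>q. f q \<cdot> X q) = f p *\<^sub>R L X"
  using L unfolding tensorial_at_def by blast

lemma tensorial_zero: "L 0 = 0"
  using tensorial_add[of 0 0] vector_field_zero[OF U] by simp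

lemma tensorial_sum:
  assumes "\<And>k. k \<in> K \<Longrightarrow> vector_field M U (X k)"
  shows "L (\<Sum>k\<in>K. X k) = (\<Sum>k\<in>K. L (X k))"
  using assms
  by (induction K rule: infinite_finite_induct)
    (auto simp: tensorial_zero tensorial_add vector_field_sum[OF U])

text \<open>Inside a chart domain the coordinate fields form a frame over all of \<open>U\<close>,
  so \<open>X\<close> is a combination of them with smooth coefficients on the whole of
  \<open>U\<close>, and only the values of these coefficients at \<open>p\<close> survive.\<close>

lemma tensorial_expand:
  assumes "U \<subseteq> cdom M i" "i \<in> idx M" "vector_field M U X"
  shows "L X = (\<Sum>b\<in>Basis. (X p i \<bullet> b) *\<^sub>R L (const_field M i b))"
proof -
  let ?X = "\<lambda>b q. (X q i \<bullet> b) \<cdot> const_field M i b q"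
  have c: "vector_field M U (const_field M i b)" "smooth_fun M U (\<lambda>q. X q i \<bullet> b)" for b
    using assms U by (auto intro: vector_field_const_field smooth_fun_component)
  then have v: "vector_field M U (?X b)" for b
    by (intro vector_field_scale U)
  have "L X = L (\<Sum>b\<in>Basis. ?X b)"
    by (rule tensorial_cong)
      (use assms v vector_field_expand[OF _ assms] in \<open>auto intro: vector_field_sum[OF U]\<close>)
  also have "\<dots> = (\<Sum>b\<in>Basis. L (?X b))"
    by (rule tensorial_sum) (rule v)
  finally show ?thesis
    by (simp add: tensorial_scale c)
qed

text \<open>Since the right side of \<open>tensorial_expand\<close> depends on \<open>X p\<close>
  alone, the linear relation may hold at \<open>p\<close> alone, with constant coefficients.\<close>

lemma tensorial_lincomb:
  assumes i: "U \<subseteq> cdom M i" "i \<in> idx M" and X: "vector_field M U X"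
    and Z: "\<And>k. k \<in> K \<Longrightarrow> vector_field M U (Z k)"
    and eq: "X p = (\<Sum>k\<in>K. c k \<cdot> Z k p)"
  shows "L X = (\<Sum>k\<in>K. c k *\<^sub>R L (Z k))"
proof -
  have "L X = (\<Sum>b\<in>Basis. (\<Sum>k\<in>K. c k * (Z k p i \<bullet> b)) *\<^sub>R L (const_field M i b))"
    by (subst tensorial_expand[OF i X]) (simp add: eq inner_sum_left)
  also have "\<dots> = (\<Sum>k\<in>K. c k *\<^sub>R (\<Sum>b\<in>Basis. (Z k p i \<bullet> b) *\<^sub>R L (const_field M i b)))"
    unfolding scaleR_sum_left scaleR_sum_right scaleR_scaleR by (rule sum.swap)
  finally show ?thesis
    using tensorial_expand[OF i Z] by simp
qed

end

lemma tensorial_split: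
  assumes "tensorial_at U p L" "mopen M U" "U \<subseteq> cdom M i" "i \<in> idx M"
    and "vector_field M U X" "vector_field M U Y" "vector_field M U Z" "X p = Y p + Z p"
  shows "L X = L Y + L Z"
  using tensorial_lincomb[OF assms(1-5), of UNIV "\<lambda>b. if b then Y else Z" "\<lambda>_. 1"] assms(6-8)
  by (simp add: UNIV_bool)

end

locale atlas_connection = smooth_atlas M
  for M :: "('i, 'm, 'e::euclidean_space) atlas" +
  fixes nab :: "('m \<Rightarrow> 'i \<Rightarrow> 'e) \<Rightarrow> ('m \<Rightarrow> 'i \<Rightarrow> 'e) \<Rightarrow> 'm \<Rightarrow> 'i \<Rightarrow> 'e"
  assumes connection: "connection M nab"
begin

context
  fixes U
  assumes U: "mopen M U"
begin

lemma connection_vector_field: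
  "vector_field M U X \<Longrightarrow> vector_field M U Y \<Longrightarrow> vector_field M U (nab X Y)"
  using connection smooth_fun_const[OF U, of 0] U unfolding connection_def by blast

lemma connection_cong:
  "vector_field M U X \<Longrightarrow> vector_field M U X' \<Longrightarrow> vector_field M U Y \<Longrightarrow> vector_field M U Y' \<Longrightarrow>
   (\<And>q. q \<in> U \<Longrightarrow> X q = X' q) \<Longrightarrow> (\<And>q. q \<in> U \<Longrightarrow> Y q = Y' q) \<Longrightarrow> p \<in> U \<Longrightarrow> nab X Y p = nab X' Y' p"
  using connection smooth_fun_const[OF U, of 0] U unfolding connection_def by blast

lemma connection_add_left:
  "vector_field M U X \<Longrightarrow> vector_field M U X' \<Longrightarrow> vector_field M U Y \<Longrightarrow> p \<in> U \<Longrightarrow>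
   nab (X + X') Y p = nab X Y p + nab X' Y p"
  using connection smooth_fun_const[OF U, of 0] U unfolding connection_def by blast

lemma connection_add_right:
  "vector_field M U X \<Longrightarrow> vector_field M U Y \<Longrightarrow> vector_field M U Y' \<Longrightarrow> p \<in> U \<Longrightarrow>
   nab X (Y + Y') p = nab X Y p + nab X Y' p"
  using connection smooth_fun_const[OF U, of 0] U unfolding connection_def by blast

lemma connection_scale_left:
  "vector_field M U X \<Longrightarrow> vector_field M U Y \<Longrightarrow> smooth_fun M U f \<Longrightarrow> p \<in> U \<Longrightarrow>
   nab (\<lambda>q. f q \<cdot> X q) Y p = f p \<cdot> nab X Y p"
  using connection U unfolding connection_def by blast

lemma connection_leibniz:
  "vector_field M U X \<Longrightarrow> vector_field M U Y \<Longrightarrow> smooth_fun M U f \<Longrightarrow> p \<in> U \<Longrightarrow>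
   nab X (\<lambda>q. f q \<cdot> Y q) p = dir_deriv M X f p \<cdot> Y p + f p \<cdot> nab X Y p"
  using connection U unfolding connection_def by blast

lemma connection_scale_const_right:
  "vector_field M U X \<Longrightarrow> vector_field M U Y \<Longrightarrow> p \<in> U \<Longrightarrow>
   nab X (\<lambda>q. c \<cdot> Y q) p = c \<cdot> nab X Y p"
  using connection_leibniz[OF _ _ smooth_fun_const[OF U, of c]] dir_deriv_const[OF U] by simp

lemma connection_uminus_left:
  "vector_field M U X \<Longrightarrow> vector_field M U Y \<Longrightarrow> p \<in> U \<Longrightarrow> nab (- X) Y p = - nab X Y p"
  using connection_scale_left[OF _ _ smooth_fun_const[OF U, of "- 1"], of X Y p]
  by (simp add: fun_Compl_def)

lemma connection_uminus_right:
  "vector_field M U X \<Longrightarrow> vector_field M U Y \<Longrightarrow> p \<in> U \<Longrightarrow> nab X (- Y) p = - nab X Y p"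
  using connection_scale_const_right[of X Y p "- 1"] by (simp add: fun_Compl_def)

lemma connection_zero_left: "vector_field M U Y \<Longrightarrow> p \<in> U \<Longrightarrow> nab 0 Y p = 0"
  using connection_add_left[of 0 0 Y p] vector_field_zero[OF U] by simp

lemma connection_zero_right: "vector_field M U X \<Longrightarrow> p \<in> U \<Longrightarrow> nab X 0 p = 0"
  using connection_add_right[of X 0 0 p] vector_field_zero[OF U] by simp

lemma connection_sum_right:
  assumes "vector_field M U X" "p \<in> U" "\<And>k. k \<in> K \<Longrightarrow> vector_field M U (Y k)"
  shows "nab X (\<Sum>k\<in>K. Y k) p = (\<Sum>k\<in>K. nab X (Y k) p)"
  using assms(3)
proof (induction K rule: infinite_finite_induct)
  case (insert k K)
  then show ?case
    using assms(1,2) connection_add_right[of X "Y k" "\<Sum>k\<in>K. Y k" p] vector_field_sum[OF U, of K Y]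
    by (simp del: sum_fun_apply plus_fun_apply)
qed (simp_all add: connection_zero_right assms)

lemma connection_tensorial:
  assumes "p \<in> U" "vector_field M U Y"
  shows "tensorial_at U p (\<lambda>X. nab X Y p j)"
proof (rule tensorial_atI)
  fix X X' assume "vector_field M U X" "vector_field M U X'" "\<And>q. q \<in> U \<Longrightarrow> X q = X' q"
  then show "nab X Y p j = nab X' Y p j"
    using connection_cong[of X X' Y Y p] assms by simp
qed (simp_all add: assms connection_add_left connection_scale_left)

end

section \<open>Christoffel symbols as bilinear maps\<close>

context
  fixes i p
  assumes i: "i \<in> idx M" "p \<in> cdom M i"
begin

lemma const_field_on_cdom: "vector_field M (cdom M i) (const_field M i a)"
  by (rule vector_field_const_field[OF mopen_cdom order_refl]) (use i in auto)

lemma christoffel_add_left: "christoffel M nab i p (a + a') b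
    = christoffel M nab i p a b + christoffel M nab i p a' b"
  unfolding christoffel_def const_field_add
  by (simp add: connection_add_left[OF mopen_cdom[OF i(1)] const_field_on_cdom const_field_on_cdom
      const_field_on_cdom i(2)])

lemma christoffel_add_right: "christoffel M nab i p a (b + b')
    = christoffel M nab i p a b + christoffel M nab i p a b'"
  unfolding christoffel_def const_field_add
  by (simp add: connection_add_right[OF mopen_cdom[OF i(1)] const_field_on_cdom const_field_on_cdom
      const_field_on_cdom i(2)])

lemma christoffel_scale_left: "christoffel M nab i p (r *\<^sub>R a) b = r *\<^sub>R christoffel M nab i p a b"
  unfolding christoffel_def const_field_scale
  by (simp add: connection_scale_left[OF mopen_cdom[OF i(1)] const_field_on_cdom const_field_on_cdom
        smooth_fun_const[OF mopen_cdom[OF i(1)]] i(2)])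

lemma christoffel_scale_right: "christoffel M nab i p a (r *\<^sub>R b) = r *\<^sub>R christoffel M nab i p a b"
  unfolding christoffel_def const_field_scale
  by (simp add: connection_scale_const_right[OF mopen_cdom[OF i(1)] const_field_on_cdom
      const_field_on_cdom i(2)])

lemma linear_christoffel_left: "linear (\<lambda>a. christoffel M nab i p a b)"
  by (rule linearI) (simp_all add: christoffel_add_left christoffel_scale_left)

lemma linear_christoffel_right: "linear (christoffel M nab i p a)"
  by (rule linearI) (simp_all add: christoffel_add_right christoffel_scale_right)

lemma christoffel_expand:
  "christoffel M nab i p a b
    = (\<Sum>c\<in>Basis. \<Sum>d\<in>Basis. ((a \<bullet> c) * (b \<bullet> d)) *\<^sub>R christoffel M nab i p c d)"
proof -
  have "christoffel M nab i p a b = christoffel M nab i p (\<Sum>c\<in>Basis. (a \<bullet> c) *\<^sub>R c) b"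
    by (simp add: euclidean_representation)
  also have "\<dots> = (\<Sum>c\<in>Basis. (a \<bullet> c) *\<^sub>R christoffel M nab i p c b)"
    by (simp add: linear_sum[OF linear_christoffel_left] christoffel_scale_left)
  also have "\<dots> = (\<Sum>c\<in>Basis. (a \<bullet> c) *\<^sub>R christoffel M nab i p c (\<Sum>d\<in>Basis. (b \<bullet> d) *\<^sub>R d))"
    by (simp add: euclidean_representation)
  also have "\<dots> = (\<Sum>c\<in>Basis. \<Sum>d\<in>Basis. ((a \<bullet> c) * (b \<bullet> d)) *\<^sub>R christoffel M nab i p c d)"
    by (simp add: linear_sum[OF linear_christoffel_right] christoffel_scale_right scaleR_sum_right)
  finally show ?thesis .
qed

end

lemma connection_lincomb:
  assumes "mopen M U" "p \<in> U" "U \<subseteq> cdom M i" "i \<in> idx M" "vector_field M U X" "vector_field M U Y"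
    and "\<And>k. k \<in> K \<Longrightarrow> vector_field M U (Z k)" "X p = (\<Sum>k\<in>K. c k \<cdot> Z k p)"
  shows "nab X Y p = (\<Sum>k\<in>K. c k \<cdot> nab (Z k) Y p)"
proof
  fix j show "nab X Y p j = (\<Sum>k\<in>K. c k \<cdot> nab (Z k) Y p) j"
    using tensorial_lincomb[OF connection_tensorial[OF assms(1,2,6)] assms(1,3,4,5,7,8)] by simp
qed

text \<open>In the differentiated argument the expansion must hold on all of \<open>U\<close>, and
  the derivatives of its coefficients appear; contrast \<open>connection_lincomb\<close>.\<close>

lemma connection_expand_right:
  assumes U: "mopen M U" "p \<in> U" and X: "vector_field M U X" and Y: "vector_field M U Y"
    and Z: "\<And>k. k \<in> K \<Longrightarrow> vector_field M U (Z k)" and f: "\<And>k. k \<in> K \<Longrightarrow> smooth_fun M U (f k)"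
    and eq: "\<And>q. q \<in> U \<Longrightarrow> Y q = (\<Sum>k\<in>K. f k q \<cdot> Z k q)"
  shows "nab X Y p = (\<Sum>k\<in>K. dir_deriv M X (f k) p \<cdot> Z k p + f k p \<cdot> nab X (Z k) p)"
proof -
  let ?Z = "\<lambda>k q. f k q \<cdot> Z k q"
  have Z': "vector_field M U (?Z k)" if "k \<in> K" for k
    by (rule vector_field_scale[OF U(1) f[OF that] Z[OF that]])
  have "nab X Y p = nab X (\<Sum>k\<in>K. ?Z k) p"
    by (rule connection_cong[OF U(1) X X Y vector_field_sum[OF U(1) Z'] refl _ U(2)])
        (simp_all add: eq fun_eq_iff)
  also have "\<dots> = (\<Sum>k\<in>K. nab X (?Z k) p)"
    by (rule connection_sum_right[OF U(1) X U(2) Z'])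
  also have "\<dots> = (\<Sum>k\<in>K. dir_deriv M X (f k) p \<cdot> Z k p + f k p \<cdot> nab X (Z k) p)"
    by (rule sum.cong[OF refl connection_leibniz[OF U(1) X Z f U(2)]])
  finally show ?thesis .
qed

text \<open>\<open>Y\<close> is expanded in coordinate fields: the Leibniz terms reassemble to the
  derivative of its component, and the remaining terms, after expanding \<open>X\<close> too, to the
  Christoffel symbol. Shrinking to \<open>U \<inter> cdom M i\<close> makes the expansion
  available.\<close>

lemma connection_in_chart:
  assumes U: "mopen M U" "p \<in> U" and i: "i \<in> charts_at M p"
    and X: "vector_field M U X" and Y: "vector_field M U Y"
  shows "nab X Y p i = frechet_derivative (\<lambda>x. Y (param M i x) i) (at (chart M i p)) (X p i)
    + christoffel M nab i p (X p i) (Y p i)"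
proof -
  let ?V = "U \<inter> cdom M i"
  have i': "i \<in> idx M" "p \<in> cdom M i" using i by (auto simp: charts_at_iff)
  have V: "mopen M ?V" "p \<in> ?V" "?V \<subseteq> cdom M i"
    using U i' by (auto intro: mopen_Int mopen_cdom)
  have XY: "vector_field M ?V X" "vector_field M ?V Y"
    using X Y by (auto intro: vector_field_subset)
  have c: "vector_field M ?V (const_field M i b)" for b
    using V i' by (intro vector_field_const_field)
  have y: "smooth_fun M ?V (\<lambda>q. Y q i \<bullet> b)" for b
    using V i' XY by (intro smooth_fun_component)
  let ?Y = "\<lambda>b q. (Y q i \<bullet> b) \<cdot> const_field M i b q"
  let ?D = "frechet_derivative (\<lambda>x. Y (param M i x) i) (at (chart M i p))"
  have D: "((\<lambda>x. Y (param M i x) i) has_derivative ?D) (at (chart M i p))"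
    by (rule vector_field_has_derivative[OF U Y i])
  have dir: "dir_deriv M X (\<lambda>q. Y q i \<bullet> b) p = ?D (X p i) \<bullet> b" for b
    using dir_deriv_chart[OF V(1,2) y _ i, of X] XY V frechet_derivative_at[OF
        has_derivative_inner_left[OF D, of b]]
    by (metis vector_field_tangent)
  have yv: "vector_field M ?V (?Y b)" for b
    by (rule vector_field_scale[OF V(1) y c])
  have "nab X Y p i = nab X (\<Sum>b\<in>Basis. ?Y b) p i"
    by (subst connection_cong[OF V(1) XY(1) XY(1) XY(2), of "\<Sum>b\<in>Basis. ?Y b"])
      (use V vector_field_expand[OF _ V(3) i'(1) XY(2)] yv in \<open>auto intro!: vector_field_sum\<close>)
  also have "\<dots> = (\<Sum>b\<in>Basis. nab X (?Y b) p i)"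
    using connection_sum_right[OF V(1) XY(1) V(2), of Basis ?Y] yv by simp
  also have "\<dots> = (\<Sum>b\<in>Basis. (?D (X p i) \<bullet> b) *\<^sub>R b + (Y p i \<bullet> b) *\<^sub>R nab X (const_field M i b) p i)"
    using connection_leibniz[OF V(1) XY(1) c y V(2)] dir const_field_apply[OF i]
    by (intro sum.cong) simp_all
  also have "\<dots> = ?D (X p i) + (\<Sum>b\<in>Basis. (Y p i \<bullet> b) *\<^sub>R nab X (const_field M i b) p i)"
    by (simp add: sum.distrib euclidean_representation)
  also have "(\<Sum>b\<in>Basis. (Y p i \<bullet> b) *\<^sub>R nab X (const_field M i b) p i)
      = (\<Sum>b\<in>Basis. \<Sum>a\<in>Basis. ((X p i \<bullet> a) * (Y p i \<bullet> b)) *\<^sub>R christoffel M nab i p a b)"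
    using tensorial_expand[OF connection_tensorial[OF V(1,2) c] V(1,3) i'(1) XY(1)]
    by (auto simp: christoffel_def scaleR_sum_right mult.commute intro!: sum.cong)
  also have "\<dots> = christoffel M nab i p (X p i) (Y p i)"
    by (subst sum.swap, subst christoffel_expand[OF i', of "X p i" "Y p i"]) (rule refl)
  finally show ?thesis .
qed

end

section \<open>Curvature as a tensor\<close>

text \<open>A torsion-free connection expresses the Lie bracket as a difference of covariant
  derivatives, so smoothness and the algebraic rules of the bracket follow from the connection
  axioms instead of chart computations.\<close>

locale torsion_free_atlas = smooth_atlas M
  for M :: "('i, 'm, 'e::euclidean_space) atlas" +
  fixes T :: "('m \<Rightarrow> 'i \<Rightarrow> 'e) \<Rightarrow> ('m \<Rightarrow> 'i \<Rightarrow> 'e) \<Rightarrow> 'm \<Rightarrow> 'i \<Rightarrow> 'e"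
  assumes T_connection: "connection M T" and T_torsion_free: "torsion_free M T"
begin

sublocale T: atlas_connection M T
  by standard (rule T_connection)

context
  fixes U
  assumes U: "mopen M U"
begin

lemma lie_bracket_eq:
  "vector_field M U X \<Longrightarrow> vector_field M U Y \<Longrightarrow> p \<in> U \<Longrightarrow> lie_bracket M X Y p = T X Y p - T Y X p"
  using T_torsion_free U unfolding torsion_free_def by metis

lemma vector_field_lie_bracket:
  assumes "vector_field M U X" "vector_field M U Y"
  shows "vector_field M U (lie_bracket M X Y)"
  by (rule vector_field_cong[OF U vector_field_diff[OF U T.connection_vector_field[OF U assms]
          T.connection_vector_field[OF U assms(2,1)]]])
    (simp add: lie_bracket_eq assms)

lemma lie_bracket_cong:
  assumes "vector_field M U X" "vector_field M U X'" "vector_field M U Y" "vector_field M U Y'"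
    and "\<And>q. q \<in> U \<Longrightarrow> X q = X' q" "\<And>q. q \<in> U \<Longrightarrow> Y q = Y' q" "p \<in> U"
  shows "lie_bracket M X Y p = lie_bracket M X' Y' p"
  using T.connection_cong[OF U assms] T.connection_cong[OF U assms(3,4,1,2,6,5,7)] assms
  by (simp add: lie_bracket_eq)

lemma lie_bracket_add_left:
  assumes "vector_field M U X" "vector_field M U X'" "vector_field M U Y" "p \<in> U"
  shows "lie_bracket M (X + X') Y p = lie_bracket M X Y p + lie_bracket M X' Y p"
  using assms
  by (simp add: lie_bracket_eq vector_field_add[OF U] T.connection_add_left[OF U]
      T.connection_add_right[OF U])

lemma lie_bracket_scale_left:
  assumes "vector_field M U X" "vector_field M U Y" "smooth_fun M U f" "p \<in> U"
  shows "lie_bracket M (\<lambda>q. f q \<cdot> X q) Y p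
      = f p \<cdot> lie_bracket M X Y p + (- dir_deriv M Y f p) \<cdot> X p"
  using assms
  by (simp add: lie_bracket_eq vector_field_scale[OF U] T.connection_scale_left[OF U]
      T.connection_leibniz[OF U] vscale_diff_right vscale_minus_left)

end

end

text \<open>\<open>T\<close> controls the brackets, while the curvature is that of an arbitrary
  connection \<open>C\<close>; on the tangent bundle these will be the Levi-Civita and the Chern
  connection.\<close>

locale curvature_atlas = torsion_free_atlas M T + atlas_connection M C
  for M :: "('i, 'm, 'e::euclidean_space) atlas" and T C
begin

lemma vector_field_curvature:
  assumes U: "mopen M U" and "vector_field M U X" "vector_field M U Y" "vector_field M U Z"
  shows "vector_field M U (curvature M C X Y Z)"
  unfolding curvature_def
  by (intro vector_field_add[OF U] vector_field_diff[OF U] connection_vector_field[OF U]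
      vector_field_lie_bracket[OF U] assms)

context
  fixes U p
  assumes U: "mopen M U" and p: "p \<in> U"
begin

lemma curvature_cong:
  assumes "vector_field M U X" "vector_field M U X'" "vector_field M U Y" "vector_field M U Y'"
    and "vector_field M U Z" "vector_field M U Z'"
    and "\<And>q. q \<in> U \<Longrightarrow> X q = X' q" "\<And>q. q \<in> U \<Longrightarrow> Y q = Y' q" "\<And>q. q \<in> U \<Longrightarrow> Z q = Z' q"
  shows "curvature M C X Y Z p = curvature M C X' Y' Z' p"
proof -
  have "C (lie_bracket M X Y) Z p = C (lie_bracket M X' Y') Z' p"
    by (rule connection_cong[OF U]) (use assms p in \<open>auto intro: vector_field_lie_bracket[OF U]
        lie_bracket_cong[OF U]\<close>)
  moreover have "C X (C Y Z) p = C X' (C Y' Z') p"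
    by (rule connection_cong[OF U]) (use assms p in \<open>auto intro: connection_vector_field[OF U]
        connection_cong[OF U]\<close>)
  moreover have "C Y (C X Z) p = C Y' (C X' Z') p"
    by (rule connection_cong[OF U]) (use assms p in \<open>auto intro: connection_vector_field[OF U]
        connection_cong[OF U]\<close>)
  ultimately show ?thesis by (simp add: curvature_def)
qed

lemma curvature_swap:
  assumes "vector_field M U X" "vector_field M U Y" "vector_field M U Z"
  shows "curvature M C Y X Z p = - curvature M C X Y Z p"
proof -
  have "C (lie_bracket M Y X) Z p = - C (lie_bracket M X Y) Z p"
    using assms p by (subst lie_bracket_swap[of Y X])
        (intro connection_uminus_left[OF U] vector_field_lie_bracket[OF U])
  then show ?thesis by (simp add: curvature_def)
qed

text \<open>The non-tensorial part of the bracket of \<open>f \<cdot> X\<close> with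
  \<open>Y\<close> cancels the Leibniz term from differentiating \<open>f \<cdot> C X Z\<close>
  along \<open>Y\<close>.\<close>

lemma curvature_tensorial_1:
  assumes Y: "vector_field M U Y" and Z: "vector_field M U Z"
  shows "tensorial_at U p (\<lambda>X. curvature M C X Y Z p j)"
proof (rule tensorial_atI)
  fix X X' assume "vector_field M U X" "vector_field M U X'" "\<And>q. q \<in> U \<Longrightarrow> X q = X' q"
  then have "curvature M C X Y Z p = curvature M C X' Y Z p"
    using Y Z by (intro curvature_cong) auto
  then show "curvature M C X Y Z p j = curvature M C X' Y Z p j" by simp
next
  fix X X' assume X: "vector_field M U X" and X': "vector_field M U X'"
  note vf = X X' Y Z vector_field_add[OF U] vector_field_lie_bracket[OF U]
      connection_vector_field[OF U]
  have "C (lie_bracket M (X + X') Y) Z p = C (lie_bracket M X Y + lie_bracket M X' Y) Z p"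
    by (rule connection_cong[OF U]) (use p in \<open>auto intro: vf simp: lie_bracket_add_left[OF U X X'
        Y]\<close>)
  also have "\<dots> = C (lie_bracket M X Y) Z p + C (lie_bracket M X' Y) Z p"
    by (intro connection_add_left[OF U] vf p)
  finally have 1: "C (lie_bracket M (X + X') Y) Z p = \<dots>" .
  have "C Y (C (X + X') Z) p = C Y (C X Z + C X' Z) p"
    by (rule connection_cong[OF U]) (use p in \<open>auto intro: vf simp: connection_add_left[OF U X X'
        Z]\<close>)
  also have "\<dots> = C Y (C X Z) p + C Y (C X' Z) p"
    by (intro connection_add_right[OF U] vf p)
  finally have 2: "C Y (C (X + X') Z) p = \<dots>" .
  have 3: "C (X + X') (C Y Z) p = C X (C Y Z) p + C X' (C Y Z) p"
    by (intro connection_add_left[OF U] vf p)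
  show "curvature M C (X + X') Y Z p j = curvature M C X Y Z p j + curvature M C X' Y Z p j"
    by (simp add: curvature_def 1 2 3)
next
  fix X f assume X: "vector_field M U X" and f: "smooth_fun M U f"
  note vf = X Y Z f vector_field_add[OF U] vector_field_lie_bracket[OF U]
      connection_vector_field[OF U]
    vector_field_scale[OF U] smooth_fun_uminus[OF U] smooth_fun_dir_deriv[OF U]
  let ?W = "(\<lambda>q. f q \<cdot> lie_bracket M X Y q) + (\<lambda>q. (- dir_deriv M Y f q) \<cdot> X q)"
  have "C (lie_bracket M (\<lambda>q. f q \<cdot> X q) Y) Z p = C ?W Z p"
    by (rule connection_cong[OF U])
      (use p lie_bracket_scale_left[OF U X Y f] in \<open>auto intro!: vf\<close>)
  also have "\<dots> = C (\<lambda>q. f q \<cdot> lie_bracket M X Y q) Z p + C (\<lambda>q. (- dir_deriv M Y f q) \<cdot> X q) Z p"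
    by (intro connection_add_left[OF U] vf p)
  also have "C (\<lambda>q. f q \<cdot> lie_bracket M X Y q) Z p = f p \<cdot> C (lie_bracket M X Y) Z p"
    by (intro connection_scale_left[OF U] vf p)
  also have "C (\<lambda>q. (- dir_deriv M Y f q) \<cdot> X q) Z p = (- dir_deriv M Y f p) \<cdot> C X Z p"
    by (intro connection_scale_left[OF U] vf p)
  finally have 1: "C (lie_bracket M (\<lambda>q. f q \<cdot> X q) Y) Z p
    = f p \<cdot> C (lie_bracket M X Y) Z p + (- dir_deriv M Y f p) \<cdot> C X Z p" .
  have "C Y (C (\<lambda>q. f q \<cdot> X q) Z) p = C Y (\<lambda>q. f q \<cdot> C X Z q) p"
    by (rule connection_cong[OF U])
      (use p connection_scale_left[OF U X Z f] in \<open>auto intro!: vf\<close>)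
  also have "\<dots> = dir_deriv M Y f p \<cdot> C X Z p + f p \<cdot> C Y (C X Z) p"
    by (intro connection_leibniz[OF U] vf p)
  finally have 2: "C Y (C (\<lambda>q. f q \<cdot> X q) Z) p = \<dots>" .
  have 3: "C (\<lambda>q. f q \<cdot> X q) (C Y Z) p = f p \<cdot> C X (C Y Z) p"
    by (intro connection_scale_left[OF U] vf p)
  show "curvature M C (\<lambda>q. f q \<cdot> X q) Y Z p j = f p *\<^sub>R curvature M C X Y Z p j"
    by (simp add: curvature_def 1 2 3 algebra_simps)
qed

text \<open>Transferred from the first argument by antisymmetry.\<close>

lemma curvature_tensorial_2:
  assumes X: "vector_field M U X" and Z: "vector_field M U Z"
  shows "tensorial_at U p (\<lambda>Y. curvature M C X Y Z p j)"
proof (rule tensorial_atI)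
  note T = curvature_tensorial_1[OF X Z, of j]
  fix Y Y' assume Y: "vector_field M U Y" "vector_field M U Y'"
  show "curvature M C X Y Z p j = curvature M C X Y' Z p j" if "\<And>q. q \<in> U \<Longrightarrow> Y q = Y' q"
    using tensorial_cong[OF T U Y that] Y X Z by (simp add: curvature_swap[of _ X])
  show "curvature M C X (Y + Y') Z p j = curvature M C X Y Z p j + curvature M C X Y' Z p j"
    using tensorial_add[OF T U Y] Y X Z by (simp add: curvature_swap[of _ X] vector_field_add[OF U])
next
  note T = curvature_tensorial_1[OF X Z, of j]
  fix Y f assume Y: "vector_field M U Y" and f: "smooth_fun M U f"
  show "curvature M C X (\<lambda>q. f q \<cdot> Y q) Z p j = f p *\<^sub>R curvature M C X Y Z p j"
    using tensorial_scale[OF T U Y f] Y X Z f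
        by (simp add: curvature_swap[of _ X] vector_field_scale[OF U])
qed

text \<open>Products of a first derivative of \<open>f\<close> with a derivative of \<open>Z\<close>
  cancel between the two orders of differentiation; the second derivatives of \<open>f\<close>
  cancel against the derivative along the bracket, by \<open>dir_deriv_commutator\<close>.\<close>

lemma curvature_tensorial_3:
  assumes X: "vector_field M U X" and Y: "vector_field M U Y"
  shows "tensorial_at U p (\<lambda>Z. curvature M C X Y Z p j)"
proof (rule tensorial_atI)
  fix Z Z' assume "vector_field M U Z" "vector_field M U Z'" "\<And>q. q \<in> U \<Longrightarrow> Z q = Z' q"
  then have "curvature M C X Y Z p = curvature M C X Y Z' p"
    using X Y by (intro curvature_cong) auto
  then show "curvature M C X Y Z p j = curvature M C X Y Z' p j" by simp
next
  fix Z Z' assume Z: "vector_field M U Z" and Z': "vector_field M U Z'"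
  note vf = X Y Z Z' vector_field_add[OF U] vector_field_lie_bracket[OF U]
      connection_vector_field[OF U]
  have add: "C V (C W (Z + Z')) p = C V (C W Z) p + C V (C W Z') p"
    if V: "vector_field M U V" and W: "vector_field M U W" for V W
  proof -
    have "C V (C W (Z + Z')) p = C V (C W Z + C W Z') p"
      by (rule connection_cong[OF U])
        (use p V W in \<open>auto intro: vf simp: connection_add_right[OF U W Z Z']\<close>)
    also have "\<dots> = C V (C W Z) p + C V (C W Z') p"
      by (intro connection_add_right[OF U] vf p V W)
    finally show ?thesis .
  qed
  have "C (lie_bracket M X Y) (Z + Z') p = C (lie_bracket M X Y) Z p + C (lie_bracket M X Y) Z' p"
    by (intro connection_add_right[OF U] vf p)
  then show "curvature M C X Y (Z + Z') p j = curvature M C X Y Z p j + curvature M C X Y Z' p j"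
    by (simp add: curvature_def add X Y)
next
  fix Z f assume Z: "vector_field M U Z" and f: "smooth_fun M U f"
  note vf = X Y Z f vector_field_add[OF U] vector_field_lie_bracket[OF U]
      connection_vector_field[OF U]
    vector_field_scale[OF U] smooth_fun_uminus[OF U] smooth_fun_dir_deriv[OF U]
  have second: "C V (C W (\<lambda>q. f q \<cdot> Z q)) p = dir_deriv M V (dir_deriv M W f) p \<cdot> Z p
      + dir_deriv M W f p \<cdot> C V Z p + dir_deriv M V f p \<cdot> C W Z p + f p \<cdot> C V (C W Z) p"
    if V: "vector_field M U V" and W: "vector_field M U W" for V W
  proof -
    have "C V (C W (\<lambda>q. f q \<cdot> Z q)) p
        = C V ((\<lambda>q. dir_deriv M W f q \<cdot> Z q) + (\<lambda>q. f q \<cdot> C W Z q)) p"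
      by (rule connection_cong[OF U])
        (use p V W connection_leibniz[OF U W Z f] in \<open>auto intro!: vf\<close>)
    also have "\<dots> = C V (\<lambda>q. dir_deriv M W f q \<cdot> Z q) p + C V (\<lambda>q. f q \<cdot> C W Z q) p"
      by (intro connection_add_right[OF U] vf p V W)
    also have "C V (\<lambda>q. dir_deriv M W f q \<cdot> Z q) p
        = dir_deriv M V (dir_deriv M W f) p \<cdot> Z p + dir_deriv M W f p \<cdot> C V Z p"
      by (intro connection_leibniz[OF U] vf p V W)
    also have "C V (\<lambda>q. f q \<cdot> C W Z q) p = dir_deriv M V f p \<cdot> C W Z p + f p \<cdot> C V (C W Z) p"
      by (intro connection_leibniz[OF U] vf p V W)
    finally show ?thesis by (simp only: add.assoc)
  qed
  have "C (lie_bracket M X Y) (\<lambda>q. f q \<cdot> Z q) p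
      = dir_deriv M (lie_bracket M X Y) f p \<cdot> Z p + f p \<cdot> C (lie_bracket M X Y) Z p"
    by (intro connection_leibniz[OF U] vf p)
  then show "curvature M C X Y (\<lambda>q. f q \<cdot> Z q) p j = f p *\<^sub>R curvature M C X Y Z p j"
    by (simp add: curvature_def second X Y dir_deriv_commutator[OF U p f X Y] algebra_simps)
qed

end

end

section \<open>Metrics\<close>

text \<open>Separates the pointwise algebra from positivity and smoothness:
  \<open>canonical_hermitian\<close> states symmetry and linearity of \<open>g\<^sub>1\<close>
  directly, so this is the form in which that metric is available.\<close>

locale metric_atlas = smooth_atlas M
  for M :: "('i, 'm, 'e::euclidean_space) atlas" +
  fixes g :: "'m \<Rightarrow> ('i \<Rightarrow> 'e) \<Rightarrow> ('i \<Rightarrow> 'e) \<Rightarrow> real"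
  assumes metric_sym: "p \<in> carrier_of M \<Longrightarrow> u \<in> tangent_space M p \<Longrightarrow> v \<in> tangent_space M p \<Longrightarrow>
      g p u v = g p v u"
    and metric_linear: "p \<in> carrier_of M \<Longrightarrow> u \<in> tangent_space M p \<Longrightarrow> v \<in> tangent_space M p \<Longrightarrow>
      w \<in> tangent_space M p \<Longrightarrow> g p (a \<cdot> u + b \<cdot> v) w = a * g p u w + b * g p v w"
begin

context
  fixes p
  assumes p: "p \<in> carrier_of M"
begin

lemma metric_scale_left:
  "u \<in> tangent_space M p \<Longrightarrow> w \<in> tangent_space M p \<Longrightarrow> g p (a \<cdot> u) w = a * g p u w"
  using metric_linear[OF p, of u u w a 0] by simp

lemma metric_add_left:
  "u \<in> tangent_space M p \<Longrightarrow> v \<in> tangent_space M p \<Longrightarrow> w \<in> tangent_space M p \<Longrightarrow>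
   g p (u + v) w = g p u w + g p v w"
  using metric_linear[OF p, of u v w 1 1] by simp

lemma metric_diff_left:
  "u \<in> tangent_space M p \<Longrightarrow> v \<in> tangent_space M p \<Longrightarrow> w \<in> tangent_space M p \<Longrightarrow>
   g p (u - v) w = g p u w - g p v w"
  using metric_linear[OF p, of u v w 1 "- 1"] by simp

lemma metric_uminus_left:
  "u \<in> tangent_space M p \<Longrightarrow> w \<in> tangent_space M p \<Longrightarrow> g p (- u) w = - g p u w"
  using metric_scale_left[of u w "- 1"] by simp

lemma metric_zero_left: "w \<in> tangent_space M p \<Longrightarrow> g p 0 w = 0"
  using metric_scale_left[of 0 w 0] by simp

lemma metric_sum_left:
  assumes "w \<in> tangent_space M p" "\<And>k. k \<in> K \<Longrightarrow> u k \<in> tangent_space M p"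
  shows "g p (\<Sum>k\<in>K. u k) w = (\<Sum>k\<in>K. g p (u k) w)"
  using assms(2)
proof (induction K rule: infinite_finite_induct)
  case (insert k K)
  then show ?case
    using assms(1) metric_add_left[of "u k" "\<Sum>k\<in>K. u k" w]
        by (simp del: sum_fun_apply plus_fun_apply)
qed (simp_all add: metric_zero_left assms)

lemma metric_scale_right:
  "u \<in> tangent_space M p \<Longrightarrow> w \<in> tangent_space M p \<Longrightarrow> g p w (a \<cdot> u) = a * g p w u"
  using metric_scale_left[of u w a] by (simp add: metric_sym[OF p, of w])

lemma metric_add_right:
  "u \<in> tangent_space M p \<Longrightarrow> v \<in> tangent_space M p \<Longrightarrow> w \<in> tangent_space M p \<Longrightarrow>
   g p w (u + v) = g p w u + g p w v"
  using metric_add_left[of u v w] by (simp add: metric_sym[OF p, of w])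

lemma metric_diff_right:
  "u \<in> tangent_space M p \<Longrightarrow> v \<in> tangent_space M p \<Longrightarrow> w \<in> tangent_space M p \<Longrightarrow>
   g p w (u - v) = g p w u - g p w v"
  using metric_diff_left[of u v w] by (simp add: metric_sym[OF p, of w])

lemma metric_uminus_right:
  "u \<in> tangent_space M p \<Longrightarrow> w \<in> tangent_space M p \<Longrightarrow> g p w (- u) = - g p w u"
  using metric_uminus_left[of u w] by (simp add: metric_sym[OF p, of w])

lemma metric_sum_right:
  assumes "w \<in> tangent_space M p" "\<And>k. k \<in> K \<Longrightarrow> u k \<in> tangent_space M p"
  shows "g p w (\<Sum>k\<in>K. u k) = (\<Sum>k\<in>K. g p w (u k))"
proof -
  have "g p w (\<Sum>k\<in>K. u k) = g p (\<Sum>k\<in>K. u k) w"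
    using assms by (intro metric_sym[OF p] tangent_sum)
  then show ?thesis
    using metric_sum_left[OF assms] assms by (simp add: metric_sym[OF p, of w])
qed

text \<open>Orthonormality alone yields independence, by pairing a vanishing combination with each
  member; read in a chart, \<open>DIM('e)\<close> independent vectors span. The index set is
  arbitrary because the frame of lifts will be indexed by pairs.\<close>

lemma orthonormal_expand:
  assumes K: "finite K" "card K = DIM('e)" and e: "\<And>k. k \<in> K \<Longrightarrow> e k \<in> tangent_space M p"
    and orth: "\<And>k l. k \<in> K \<Longrightarrow> l \<in> K \<Longrightarrow> g p (e k) (e l) = (if k = l then 1 else 0)"
    and v: "v \<in> tangent_space M p"
  shows "v = (\<Sum>k\<in>K. g p v (e k) \<cdot> e k)"
proof -
  obtain i where i: "i \<in> charts_at M p"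
    using carrier_chart[OF p] by blast
  have coeff: "g p (\<Sum>k\<in>K. c k \<cdot> e k) (e l) = c l" if "l \<in> K" for c l
  proof -
    have "g p (\<Sum>k\<in>K. c k \<cdot> e k) (e l) = (\<Sum>k\<in>K. c k * (if k = l then 1 else 0))"
      using that e orth by (simp add: metric_sum_left metric_scale_left del: sum_fun_apply)
    then show ?thesis using that K(1) by (simp add: if_distrib cong: if_cong)
  qed
  have inj: "inj_on (\<lambda>k. e k i) K"
  proof (rule inj_onI)
    fix k l assume kl: "k \<in> K" "l \<in> K" "e k i = e l i"
    then have "e k = e l" using tangent_eqI[OF e e i] by blast
    then show "k = l" using orth[OF kl(1,2)] orth[OF kl(1,1)] by (auto split: if_splits)
  qed
  let ?B = "(\<lambda>k. e k i) ` K"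
  have "independent ?B"
  proof (rule independent_if_scalars_zero)
    show "finite ?B" using K by simp
    fix f x assume f: "(\<Sum>x\<in>?B. f x *\<^sub>R x) = 0" and x: "x \<in> ?B"
    obtain l where l: "l \<in> K" "x = e l i" using x by blast
    have "(\<Sum>k\<in>K. f (e k i) \<cdot> e k) = 0"
      by (rule tangent_eqI[OF _ _ i]) (use f e in \<open>auto simp: sum.reindex[OF inj] intro!:
          tangent_sum simp del: sum_fun_apply\<close>, simp)
    then show "f x = 0"
      using coeff[OF l(1), of "\<lambda>k. f (e k i)"] metric_zero_left[OF e[OF l(1)]] l by simp
  qed
  moreover have "card ?B = DIM('e)" using card_image[OF inj] K by simp
  ultimately have "v i \<in> span ?B"
    using card_ge_dim_independent[of ?B UNIV] by auto
  then obtain u where u: "v i = (\<Sum>x\<in>?B. u x *\<^sub>R x)"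
    using K(1) by (auto simp: span_finite)
  have v_eq: "v = (\<Sum>k\<in>K. u (e k i) \<cdot> e k)"
    by (rule tangent_eqI[OF v _ i]) (use u e in \<open>auto simp: sum.reindex[OF inj] intro!: tangent_sum
        simp del: sum_fun_apply\<close>, simp)
  have "g p v (e k) = u (e k i)" if "k \<in> K" for k
    using coeff[OF that, of "\<lambda>k. u (e k i)"] v_eq by simp
  then show ?thesis
    by (subst v_eq) (auto intro!: sum.cong simp del: sum_fun_apply)
qed

lemma parseval:
  assumes K: "finite K" "card K = DIM('e)" and e: "\<And>k. k \<in> K \<Longrightarrow> e k \<in> tangent_space M p"
    and orth: "\<And>k l. k \<in> K \<Longrightarrow> l \<in> K \<Longrightarrow> g p (e k) (e l) = (if k = l then 1 else 0)"
    and u: "u \<in> tangent_space M p" and v: "v \<in> tangent_space M p"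
  shows "g p u v = (\<Sum>k\<in>K. g p u (e k) * g p v (e k))"
proof -
  have "g p u v = g p (\<Sum>k\<in>K. g p u (e k) \<cdot> e k) v"
    using orthonormal_expand[OF K e orth u] by simp
  also have "\<dots> = (\<Sum>k\<in>K. g p (g p u (e k) \<cdot> e k) v)"
    using e v by (intro metric_sum_left) auto
  also have "\<dots> = (\<Sum>k\<in>K. g p u (e k) * g p v (e k))"
    using e v by (intro sum.cong) (auto simp: metric_scale_left metric_sym[OF p v])
  finally show ?thesis .
qed

end

text \<open>Metric compatibility in the three arguments, with torsion-freeness turning differences
  of derivatives into brackets. The right side involves no connection, so it determines
  \<open>L X Y p\<close> as soon as products with fields separate vectors.\<close>

lemma koszul:
  assumes lc: "levi_civita M g L" and U: "mopen M U" "p \<in> U"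
    and X: "vector_field M U X" and Y: "vector_field M U Y" and Z: "vector_field M U Z"
  shows "2 * g p (L X Y p) (Z p) =
    dir_deriv M X (\<lambda>q. g q (Y q) (Z q)) p + dir_deriv M Y (\<lambda>q. g q (X q) (Z q)) p
    - dir_deriv M Z (\<lambda>q. g q (X q) (Y q)) p
    + g p (lie_bracket M X Y p) (Z p) - g p (lie_bracket M X Z p) (Y p) - g p
        (lie_bracket M Y Z p) (X p)"
proof -
  interpret L: atlas_connection M L
    by unfold_locales (use lc in \<open>simp add: levi_civita_def\<close>)
  have tf: "lie_bracket M V W p = L V W p - L W V p"
      if "vector_field M U V" "vector_field M U W" for V W
    using lc U that unfolding levi_civita_def torsion_free_def by metis
  have met: "dir_deriv M V (\<lambda>q. g q (W q) (W' q)) p = g p (L V W p) (W' p) + g p (W p) (L V W' p)"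
    if "vector_field M U V" "vector_field M U W" "vector_field M U W'" for V W W'
    using lc U that unfolding levi_civita_def by metis
  have p: "p \<in> carrier_of M" using U mopen_carrier by blast
  have t: "X p \<in> tangent_space M p" "Y p \<in> tangent_space M p" "Z p \<in> tangent_space M p"
    using X Y Z U by (auto simp: vector_field_tangent)
  have tL: "L V W p \<in> tangent_space M p" if "vector_field M U V" "vector_field M U W" for V W
    using L.connection_vector_field[OF U(1) that] U by (auto simp: vector_field_tangent)
  note tLs = tL[OF X Y] tL[OF Y X] tL[OF X Z] tL[OF Z X] tL[OF Y Z] tL[OF Z Y]
  show ?thesis
    using metric_sym[OF p t(1) tLs(5)] metric_sym[OF p t(1) tLs(6)] metric_sym[OF p t(2) tLs(3)]
      metric_sym[OF p t(2) tLs(4)] metric_sym[OF p t(3) tLs(1)] metric_sym[OF p t(3) tLs(2)]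
    by (simp add: tf met X Y Z metric_diff_left[OF p] t tLs)
qed

lemma orthonormal_frame_subset:
  assumes "orthonormal_frame M g U E" "mopen M V" "V \<subseteq> U"
  shows "orthonormal_frame M g V E"
  using assms vector_field_subset[of U _ V] by (auto simp: orthonormal_frame_def)

end

locale riemannian_atlas = metric_atlas M g
  for M :: "('i, 'm, 'e::euclidean_space) atlas" and g +
  assumes metric_pos: "p \<in> carrier_of M \<Longrightarrow> u \<in> tangent_space M p \<Longrightarrow> u \<noteq> 0 \<Longrightarrow> 0 < g p u u"
    and metric_smooth: "mopen M U \<Longrightarrow> vector_field M U X \<Longrightarrow> vector_field M U Y \<Longrightarrow>
      smooth_fun M U (\<lambda>p. g p (X p) (Y p))"
begin

text \<open>The test field is the difference \<open>V - W\<close> itself, whose square length would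
  be positive. Testing against fields matches the form in which the adjoint is given.\<close>

lemma metric_nondegenerate:
  assumes U: "mopen M U" "p \<in> U" and V: "vector_field M U V" and W: "vector_field M U W"
    and eq: "\<And>Z. vector_field M U Z \<Longrightarrow> g p (V p) (Z p) = g p (W p) (Z p)"
  shows "V p = W p"
proof (rule ccontr)
  assume "V p \<noteq> W p"
  have p: "p \<in> carrier_of M" using U mopen_carrier by blast
  have t: "V p \<in> tangent_space M p" "W p \<in> tangent_space M p"
    using V W U by (auto simp: vector_field_tangent)
  have "0 < g p (V p - W p) (V p - W p)"
    using \<open>V p \<noteq> W p\<close> t by (intro metric_pos[OF p]) auto
  also have "\<dots> = g p (V p) ((V - W) p) - g p (W p) ((V - W) p)"
    using t by (simp add: metric_diff_left[OF p])
  also have "\<dots> = 0"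
    using eq[OF vector_field_diff[OF U(1) V W]] by (simp del: minus_apply)
  finally show False by simp
qed

text \<open>Gram-Schmidt applied to the coordinate fields. That the span condition is part of the
  induction is what keeps the next coordinate field outside the span of the previous vectors.\<close>

lemma exists_orthonormal_frame:
  assumes i: "i \<in> idx M"
  shows "\<exists>E. orthonormal_frame M g (cdom M i) E"
proof -
  let ?U = "cdom M i"
  have U: "mopen M ?U" by (rule mopen_cdom[OF i])
  have carrier: "p \<in> carrier_of M" if "p \<in> ?U" for p using U mopen_carrier that by blast
  have ch: "i \<in> charts_at M p" if "p \<in> ?U" for p using that i by (simp add: charts_at_iff)
  obtain b :: "nat \<Rightarrow> 'e" where b: "bij_betw b {0..<DIM('e)} Basis"
    using ex_bij_betw_nat_finite[OF finite_Basis] by blast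
  have "\<exists>E. (\<forall>k<m. vector_field M ?U (E k) \<and> (\<forall>p\<in>?U. E k p i \<in> span (b ` {..k}))) \<and>
     (\<forall>p\<in>?U. \<forall>k<m. \<forall>l<m. g p (E k p) (E l p) = (if k = l then 1 else 0))" if "m \<le> DIM('e)" for m
    using that
  proof (induction m)
    case (Suc m)
    from Suc.prems have "m \<le> DIM('e)" by simp
    from Suc.IH[OF this] obtain E where
      E1: "\<forall>k<m. vector_field M ?U (E k) \<and> (\<forall>p\<in>?U. E k p i \<in> span (b ` {..k}))"
      and E2: "\<forall>p\<in>?U. \<forall>k<m. \<forall>l<m. g p (E k p) (E l p) = (if k = l then 1 else 0)"
      by (elim exE conjE)
    have vf: "\<And>k. k < m \<Longrightarrow> vector_field M ?U (E k)"
      and sp: "\<And>k p. k < m \<Longrightarrow> p \<in> ?U \<Longrightarrow> E k p i \<in> span (b ` {..k})"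
      and orth: "\<And>p k l. p \<in> ?U \<Longrightarrow> k < m \<Longrightarrow> l < m \<Longrightarrow> g p (E k p) (E l p) = (if k = l then 1 else 0)"
      using E1 E2 by blast+
    let ?c = "const_field M i (b m)"
    define W where "W = ?c - (\<Sum>l<m. (\<lambda>q. g q (?c q) (E l q) \<cdot> E l q))"
    have c: "vector_field M ?U ?c" by (rule vector_field_const_field[OF U order_refl i])
    have W: "vector_field M ?U W"
      unfolding W_def
      by (intro vector_field_diff[OF U] vector_field_sum[OF U] vector_field_scale[OF U]
          metric_smooth[OF U] c vf) auto
    have W_apply: "W p = ?c p - (\<Sum>l<m. g p (?c p) (E l p) \<cdot> E l p)" for p
      by (simp add: W_def fun_eq_iff)
    have tE: "E k p \<in> tangent_space M p" if "k < m" "p \<in> ?U" for k p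
      using vector_field_tangent[OF vf] that by blast
    have sum_span: "(\<Sum>l<m. g p (?c p) (E l p) \<cdot> E l p) i \<in> span (b ` {..<m})" if "p \<in> ?U" for p
    proof -
      have "E l p i \<in> span (b ` {..<m})" if "l < m" for l
        by (rule subsetD[OF span_mono sp[OF that \<open>p \<in> ?U\<close>]]) (use that in auto)
      then show ?thesis by (auto intro!: span_sum span_scale)
    qed
    have bm: "b m \<notin> span (b ` {..<m})"
    proof
      assume "b m \<in> span (b ` {..<m})"
      moreover have "b ` {..<m} \<subseteq> Basis - {b m}"
        using bij_betwE[OF b] inj_on_eq_iff[OF bij_betw_imp_inj_on[OF b], of _ m] Suc.prems by force
      ultimately have "b m \<in> span (Basis - {b m})" using span_mono by blast
      moreover have "b m \<in> Basis" using b Suc.prems unfolding bij_betw_def by auto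
      ultimately show False using independent_Basis unfolding dependent_def by blast
    qed
    have Wi: "W p i = b m - (\<Sum>l<m. g p (?c p) (E l p) \<cdot> E l p) i" if "p \<in> ?U" for p
      using const_field_apply[OF ch[OF that]] by (simp add: W_apply)
    have W0: "W p \<noteq> 0" if "p \<in> ?U" for p
    proof
      assume "W p = 0"
      then have "b m = (\<Sum>l<m. g p (?c p) (E l p) \<cdot> E l p) i" using Wi[OF that] by simp
      then show False using sum_span[OF that] bm by simp
    qed
    have W_span: "W p i \<in> span (b ` {..m})" if "p \<in> ?U" for p
      unfolding Wi[OF that]
      by (rule span_diff[OF span_base subsetD[OF span_mono sum_span[OF that]]]) auto
    have tW: "W p \<in> tangent_space M p" if "p \<in> ?U" for p
      using vector_field_tangent[OF W that] .
    have W_orth: "g p (W p) (E k p) = 0" if "p \<in> ?U" "k < m" for p k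
    proof -
      have "g p (W p) (E k p) = g p (?c p) (E k p) - (\<Sum>l<m. g p (g p (?c p) (E l p) \<cdot> E l p)
          (E k p))"
      proof -
        have t: "(\<Sum>l<m. g p (?c p) (E l p) \<cdot> E l p) \<in> tangent_space M p"
          using that tE by (intro tangent_sum) auto
        have "g p (\<Sum>l<m. g p (?c p) (E l p) \<cdot> E l p) (E k p)
            = (\<Sum>l<m. g p (g p (?c p) (E l p) \<cdot> E l p) (E k p))"
          using that tE by (intro metric_sum_left carrier) auto
        then show ?thesis
          unfolding W_apply
          using metric_diff_left[OF carrier[OF that(1)] const_field_tangent t tE[OF that(2,1)]] by
              simp
      qed
      also have "(\<Sum>l<m. g p (g p (?c p) (E l p) \<cdot> E l p) (E k p))
          = (\<Sum>l<m. if l = k then g p (?c p) (E l p) else 0)"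
        using that tE carrier orth by (intro sum.cong) (auto simp: metric_scale_left)
      also have "\<dots> = g p (?c p) (E k p)" using that by simp
      finally show ?thesis by simp
    qed
    define N where "N = (\<lambda>p. g p (W p) (W p))"
    have N: "N p > 0" if "p \<in> ?U" for p
      unfolding N_def using metric_pos[OF carrier tW W0] that by blast
    \<comment> \<open>\<open>N p powr (- 1 / 2)\<close> is the reciprocal length of
      \<open>W p\<close>, in a form covered by \<open>smooth_fun_powr\<close>.\<close>
    define F where "F = (\<lambda>p. (N p powr (- 1 / 2)) \<cdot> W p)"
    have F: "vector_field M ?U F"
      unfolding F_def
      by (intro vector_field_scale[OF U] smooth_fun_powr[OF U] N W)
        (auto simp: N_def intro: metric_smooth[OF U W W])
    have FF: "g p (F p) (F p) = 1" if "p \<in> ?U" for p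
    proof -
      have "g p (F p) (F p) = (N p powr (- 1 / 2)) * (N p powr (- 1 / 2)) * N p"
        using that tW carrier by (simp add: F_def metric_scale_left metric_scale_right N_def)
      also have "\<dots> = 1" using N[OF that] by (simp add: powr_add[symmetric] powr_minus_divide)
      finally show ?thesis .
    qed
    have FE: "g p (F p) (E k p) = 0" "g p (E k p) (F p) = 0" if "p \<in> ?U" "k < m" for p k
      using that tW tE carrier W_orth metric_sym[of p "E k p" "W p"]
      by (simp_all add: F_def metric_scale_left metric_scale_right)
    have Fi: "F p i \<in> span (b ` {..m})" if "p \<in> ?U" for p
      using W_span[OF that] by (simp add: F_def span_scale)
    show ?case
    proof (intro exI[of _ "E(m := F)"] conjI allI impI ballI)
      fix k assume "k < Suc m"
      then show "vector_field M ?U ((E(m := F)) k)" using vf F by (cases "k = m") auto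
      show "(E(m := F)) k p i \<in> span (b ` {..k})" if "p \<in> ?U" for p
        using sp Fi that \<open>k < Suc m\<close> by (cases "k = m") auto
    next
      fix p k l assume "p \<in> ?U" "k < Suc m" "l < Suc m"
      then show "g p ((E(m := F)) k p) ((E(m := F)) l p) = (if k = l then 1 else 0)"
        using orth FF FE by (cases "k = m"; cases "l = m") auto
    qed
  qed auto
  from this[of "DIM('e)"] show ?thesis
    using U unfolding orthonormal_frame_def by blast
qed

end

text \<open>Exchanging the indices negates the double sum. It removes the rotation of an orthonormal
  frame from a trace.\<close>

lemma sum_antisym_sym_eq_0:
  fixes t :: "'k \<Rightarrow> 'k \<Rightarrow> 'v::real_vector"
  assumes "\<And>k l. k \<in> K \<Longrightarrow> l \<in> K \<Longrightarrow> a k l = - a l k" "\<And>k l. k \<in> K \<Longrightarrow> l \<in> K \<Longrightarrow> t k l = t l k"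
  shows "(\<Sum>k\<in>K. \<Sum>l\<in>K. a k l *\<^sub>R t k l) = 0"
proof -
  have "(\<Sum>k\<in>K. \<Sum>l\<in>K. a k l *\<^sub>R t k l) = (\<Sum>k\<in>K. \<Sum>l\<in>K. - (a l k *\<^sub>R t l k))"
    using assms by (intro sum.cong refl) (metis scaleR_minus_left)
  also have "\<dots> = - (\<Sum>k\<in>K. \<Sum>l\<in>K. a k l *\<^sub>R t k l)"
    by (subst sum.swap) (simp add: sum_negf)
  finally have "2 *\<^sub>R (\<Sum>k\<in>K. \<Sum>l\<in>K. a k l *\<^sub>R t k l) = 0"
    unfolding scaleR_2 by (simp only: eq_neg_iff_add_eq_0)
  then show ?thesis by simp
qed

section \<open>The difference tensor of an affine-Riemann manifold\<close>

lemma smooth_manifold_imp_atlas: "smooth_manifold M \<Longrightarrow> smooth_atlas M"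
  unfolding smooth_manifold_def smooth_atlas_def by blast

locale affine_riemann_adjoint =
  fixes M :: "('i, 'm, 'e::euclidean_space) atlas"
    and nab D \<gamma>\<^sub>s :: "('m \<Rightarrow> 'i \<Rightarrow> 'e) \<Rightarrow> ('m \<Rightarrow> 'i \<Rightarrow> 'e) \<Rightarrow> 'm \<Rightarrow> 'i \<Rightarrow> 'e"
    and g :: "'m \<Rightarrow> ('i \<Rightarrow> 'e) \<Rightarrow> ('i \<Rightarrow> 'e) \<Rightarrow> real"
  assumes affine_riemann: "affine_riemann M nab g"
    and levi_civita: "levi_civita M g D"
    and adjoint: "adjoint_tensor M g (difference_tensor D nab) \<gamma>\<^sub>s"
begin

sublocale riemannian_atlas M g
proof -
  interpret smooth_atlas M
    using affine_riemann smooth_manifold_imp_atlas by (auto simp: affine_riemann_def)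
  have r: "riemannian_metric M g"
    using affine_riemann by (simp add: affine_riemann_def)
  show "riemannian_atlas M g"
  proof
    fix p u v w a b
    assume "p \<in> carrier_of M" "u \<in> tangent_space M p" "v \<in> tangent_space M p"
        "w \<in> tangent_space M p"
    then show "g p (a \<cdot> u + b \<cdot> v) w = a * g p u w + b * g p v w"
      using r unfolding riemannian_metric_def by blast
  next
    fix p u v assume "p \<in> carrier_of M" "u \<in> tangent_space M p" "v \<in> tangent_space M p"
    then show "g p u v = g p v u"
      using r unfolding riemannian_metric_def by blast
  next
    fix p u assume "p \<in> carrier_of M" "u \<in> tangent_space M p" "u \<noteq> 0"
    then show "0 < g p u u"
      using r unfolding riemannian_metric_def by blast
  next
    fix U X Y assume "mopen M U" "vector_field M U X" "vector_field M U Y"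
    then show "smooth_fun M U (\<lambda>p. g p (X p) (Y p))"
      using r[unfolded riemannian_metric_def, THEN conjunct2] by simp
  qed
qed

sublocale N: torsion_free_atlas M nab
  by standard (use affine_riemann in \<open>simp_all add: affine_riemann_def\<close>)

sublocale D: torsion_free_atlas M D
  by standard (use levi_civita in \<open>simp_all add: levi_civita_def\<close>)

abbreviation \<gamma> where "\<gamma> \<equiv> difference_tensor D nab"

text \<open>\<open>S\<close> is \<open>\<gamma> + \<gamma>\<^sup>*\<close>, that is \<open>\<nabla>g\<close> with an index raised; the connection \<open>A\<close> will turn out to be
  the restriction of the Chern connection to horizontal lifts.\<close>

definition S :: "('m \<Rightarrow> 'i \<Rightarrow> 'e) \<Rightarrow> ('m \<Rightarrow> 'i \<Rightarrow> 'e) \<Rightarrow> 'm \<Rightarrow> 'i \<Rightarrow> 'e" where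
  "S X Y = \<gamma> X Y + \<gamma>\<^sub>s X Y"

definition A :: "('m \<Rightarrow> 'i \<Rightarrow> 'e) \<Rightarrow> ('m \<Rightarrow> 'i \<Rightarrow> 'e) \<Rightarrow> 'm \<Rightarrow> 'i \<Rightarrow> 'e" where
  "A X Y = nab X Y + (\<lambda>q. (1 / 2) \<cdot> S X Y q)"

lemma \<gamma>_apply: "\<gamma> X Y p = D X Y p - nab X Y p"
  by (simp add: difference_tensor_def)

section \<open>Tensor calculus of \<gamma>, its adjoint and S\<close>

context
  fixes U
  assumes U: "mopen M U"
begin

lemma carrier_U: "p \<in> U \<Longrightarrow> p \<in> carrier_of M"
  using mopen_carrier[OF U] by blast

lemma vector_field_\<gamma>: "vector_field M U X \<Longrightarrow> vector_field M U Y \<Longrightarrow> vector_field M U (\<gamma> X Y)"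
  unfolding difference_tensor_def
  by (intro vector_field_diff[OF U] D.T.connection_vector_field[OF U]
      N.T.connection_vector_field[OF U])

lemma vector_field_\<gamma>\<^sub>s: "vector_field M U X \<Longrightarrow> vector_field M U Y \<Longrightarrow> vector_field M U (\<gamma>\<^sub>s X Y)"
  using adjoint U unfolding adjoint_tensor_def by blast

lemma vector_field_S: "vector_field M U X \<Longrightarrow> vector_field M U Y \<Longrightarrow> vector_field M U (S X Y)"
  unfolding S_def by (intro vector_field_add[OF U] vector_field_\<gamma> vector_field_\<gamma>\<^sub>s)

lemma vector_field_A: "vector_field M U X \<Longrightarrow> vector_field M U Y \<Longrightarrow> vector_field M U (A X Y)"
  unfolding A_def
  by (intro vector_field_add[OF U] N.T.connection_vector_field[OF U] vector_field_scale[OF U]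
      smooth_fun_const[OF U] vector_field_S)

lemma adjoint_eq:
  "vector_field M U X \<Longrightarrow> vector_field M U Y \<Longrightarrow> vector_field M U Z \<Longrightarrow> p \<in> U \<Longrightarrow>
   g p (\<gamma>\<^sub>s X Y p) (Z p) = g p (Y p) (\<gamma> X Z p)"
  using adjoint U unfolding adjoint_tensor_def by blast

text \<open>Both connections are torsion-free, so the antisymmetric parts of \<open>D\<close> and
  \<open>nab\<close> are the same bracket.\<close>

lemma \<gamma>_commute:
  assumes "vector_field M U X" "vector_field M U Y" "p \<in> U"
  shows "\<gamma> X Y p = \<gamma> Y X p"
  using N.lie_bracket_eq[OF U assms] D.lie_bracket_eq[OF U assms]
  by (simp add: difference_tensor_def algebra_simps)

lemma \<gamma>_cong_left:
  assumes "vector_field M U X" "vector_field M U X'" "vector_field M U Y"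
    "\<And>q. q \<in> U \<Longrightarrow> X q = X' q" "p \<in> U"
  shows "\<gamma> X Y p = \<gamma> X' Y p"
  using D.T.connection_cong[OF U assms(1,2,3,3,4) refl assms(5)]
    N.T.connection_cong[OF U assms(1,2,3,3,4) refl assms(5)]
  by (simp add: difference_tensor_def)

lemma \<gamma>_add_left:
  assumes "vector_field M U X" "vector_field M U X'" "vector_field M U Y" "p \<in> U"
  shows "\<gamma> (X + X') Y p = \<gamma> X Y p + \<gamma> X' Y p"
  by (simp add: difference_tensor_def D.T.connection_add_left[OF U assms]
      N.T.connection_add_left[OF U assms])

lemma \<gamma>_scale_left:
  assumes "vector_field M U X" "vector_field M U Y" "smooth_fun M U f" "p \<in> U"
  shows "\<gamma> (\<lambda>q. f q \<cdot> X q) Y p = f p \<cdot> \<gamma> X Y p"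
  by (simp add: difference_tensor_def D.T.connection_scale_left[OF U assms]
      N.T.connection_scale_left[OF U assms] vscale_diff_right)

text \<open>The adjoint is known only through its products with fields, so each property of
  \<open>\<gamma>\<close> is transported across the pairing by
  \<open>metric_nondegenerate\<close>.\<close>

lemma \<gamma>\<^sub>s_tensorial_left:
  assumes p: "p \<in> U" and Y: "vector_field M U Y"
  shows "tensorial_at U p (\<lambda>X. \<gamma>\<^sub>s X Y p j)"
proof -
  note vf = vector_field_\<gamma>\<^sub>s vector_field_add[OF U] vector_field_scale[OF U]
  note t = vector_field_tangent[OF _ p]
  have cong: "\<gamma>\<^sub>s X Y p = \<gamma>\<^sub>s X' Y p"
    if "vector_field M U X" "vector_field M U X'" "\<And>q. q \<in> U \<Longrightarrow> X q = X' q" for X X'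
    by (rule metric_nondegenerate[OF U p])
      (use that p Y \<gamma>_cong_left[OF that(1,2) _ that(3) p] in \<open>auto simp: adjoint_eq intro: vf\<close>)
  have add: "\<gamma>\<^sub>s (X + X') Y p = (\<gamma>\<^sub>s X Y + \<gamma>\<^sub>s X' Y) p"
    if X: "vector_field M U X" "vector_field M U X'" for X X'
  proof (rule metric_nondegenerate[OF U p])
    fix Z assume Z: "vector_field M U Z"
    show "g p (\<gamma>\<^sub>s (X + X') Y p) (Z p) = g p ((\<gamma>\<^sub>s X Y + \<gamma>\<^sub>s X' Y) p) (Z p)"
      using adjoint_eq[OF vector_field_add[OF U X] Y Z p] adjoint_eq[OF X(1) Y Z p] adjoint_eq[OF
          X(2) Y Z p]
        metric_add_left[OF carrier_U[OF p] t[OF vector_field_\<gamma>\<^sub>s[OF X(1) Y]] t[OF vector_field_\<gamma>\<^sub>s[OF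
            X(2) Y]] t[OF Z]]
        metric_add_right[OF carrier_U[OF p] t[OF vector_field_\<gamma>[OF X(1) Z]] t[OF vector_field_\<gamma>[OF
            X(2) Z]] t[OF Y]]
      by (simp add: \<gamma>_add_left[OF X Z p])
  qed (intro vf X Y)+
  have scale: "\<gamma>\<^sub>s (\<lambda>q. f q \<cdot> X q) Y p = (\<lambda>q. f q \<cdot> \<gamma>\<^sub>s X Y q) p"
    if X: "vector_field M U X" and f: "smooth_fun M U f" for X f
  proof (rule metric_nondegenerate[OF U p])
    fix Z assume Z: "vector_field M U Z"
    show "g p (\<gamma>\<^sub>s (\<lambda>q. f q \<cdot> X q) Y p) (Z p) = g p (f p \<cdot> \<gamma>\<^sub>s X Y p) (Z p)"
      using adjoint_eq[OF vector_field_scale[OF U f X] Y Z p] adjoint_eq[OF X Y Z p]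
        metric_scale_left[OF carrier_U[OF p] t[OF vector_field_\<gamma>\<^sub>s[OF X Y]] t[OF Z]]
        metric_scale_right[OF carrier_U[OF p] t[OF vector_field_\<gamma>[OF X Z]] t[OF Y]]
      by (simp add: \<gamma>_scale_left[OF X Z f p])
  qed (intro vf X Y f)+
  show ?thesis
    by (rule tensorial_atI, (rule fun_cong[OF cong]; blast), simp_all add: add scale del:
        vscale_apply)
      simp
qed

text \<open>Here linearity comes from the metric slot: \<open>Y\<close> enters
  \<open>g p (Y p) (\<gamma> X Z p)\<close> algebraically.\<close>

lemma \<gamma>\<^sub>s_tensorial_right:
  assumes p: "p \<in> U" and X: "vector_field M U X"
  shows "tensorial_at U p (\<lambda>Y. \<gamma>\<^sub>s X Y p j)"
proof -
  note vf = vector_field_\<gamma>\<^sub>s vector_field_add[OF U] vector_field_scale[OF U]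
  note t = vector_field_tangent[OF _ p]
  have cong: "\<gamma>\<^sub>s X Y p = \<gamma>\<^sub>s X Y' p"
    if "vector_field M U Y" "vector_field M U Y'" "\<And>q. q \<in> U \<Longrightarrow> Y q = Y' q" for Y Y'
    by (rule metric_nondegenerate[OF U p]) (use that p X in \<open>auto simp: adjoint_eq intro: vf\<close>)
  have add: "\<gamma>\<^sub>s X (Y + Y') p = (\<gamma>\<^sub>s X Y + \<gamma>\<^sub>s X Y') p"
    if Y: "vector_field M U Y" "vector_field M U Y'" for Y Y'
  proof (rule metric_nondegenerate[OF U p])
    fix Z assume Z: "vector_field M U Z"
    show "g p (\<gamma>\<^sub>s X (Y + Y') p) (Z p) = g p ((\<gamma>\<^sub>s X Y + \<gamma>\<^sub>s X Y') p) (Z p)"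
      using adjoint_eq[OF X vector_field_add[OF U Y] Z p] adjoint_eq[OF X Y(1) Z p] adjoint_eq[OF X
          Y(2) Z p]
        metric_add_left[OF carrier_U[OF p] t[OF vector_field_\<gamma>\<^sub>s[OF X Y(1)]] t[OF vector_field_\<gamma>\<^sub>s[OF
            X Y(2)]] t[OF Z]]
        metric_add_left[OF carrier_U[OF p] t[OF Y(1)] t[OF Y(2)] t[OF vector_field_\<gamma>[OF X Z]]]
      by simp
  qed (intro vf X Y)+
  have scale: "\<gamma>\<^sub>s X (\<lambda>q. f q \<cdot> Y q) p = (\<lambda>q. f q \<cdot> \<gamma>\<^sub>s X Y q) p"
    if Y: "vector_field M U Y" and f: "smooth_fun M U f" for Y f
  proof (rule metric_nondegenerate[OF U p])
    fix Z assume Z: "vector_field M U Z"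
    show "g p (\<gamma>\<^sub>s X (\<lambda>q. f q \<cdot> Y q) p) (Z p) = g p (f p \<cdot> \<gamma>\<^sub>s X Y p) (Z p)"
      using adjoint_eq[OF X vector_field_scale[OF U f Y] Z p] adjoint_eq[OF X Y Z p]
        metric_scale_left[OF carrier_U[OF p] t[OF vector_field_\<gamma>\<^sub>s[OF X Y]] t[OF Z]]
        metric_scale_left[OF carrier_U[OF p] t[OF Y] t[OF vector_field_\<gamma>[OF X Z]]]
      by simp
  qed (intro vf X Y f)+
  show ?thesis
    by (rule tensorial_atI, (rule fun_cong[OF cong]; blast), simp_all add: add scale del:
        vscale_apply)
      simp
qed

lemma metric_S:
  assumes X: "vector_field M U X" and Y: "vector_field M U Y" and Z: "vector_field M U Z"
      and p: "p \<in> U"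
  shows "g p (S X Y p) (Z p) = g p (\<gamma> X Y p) (Z p) + g p (Y p) (\<gamma> X Z p)"
  using metric_add_left[OF carrier_U[OF p] vector_field_tangent[OF vector_field_\<gamma>[OF X Y] p]
      vector_field_tangent[OF vector_field_\<gamma>\<^sub>s[OF X Y] p] vector_field_tangent[OF Z p]]
    adjoint_eq[OF X Y Z p] by (simp add: S_def)

text \<open>The right side of \<open>metric_S\<close> is symmetric in \<open>Y\<close> and
  \<open>Z\<close>: adding its adjoint to \<open>\<gamma> X\<close> makes it self-adjoint.\<close>

lemma S_symmetric:
  assumes X: "vector_field M U X" and Y: "vector_field M U Y" and Z: "vector_field M U Z"
      and p: "p \<in> U"
  shows "g p (S X Y p) (Z p) = g p (Y p) (S X Z p)"
proof -
  note t = vector_field_tangent[OF _ p] and sym = metric_sym[OF carrier_U[OF p]]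
  have "g p (Y p) (S X Z p) = g p (S X Z p) (Y p)"
    by (intro sym t vector_field_S X Y Z)
  moreover have "g p (\<gamma> X Z p) (Y p) = g p (Y p) (\<gamma> X Z p)" "g p (Z p) (\<gamma> X Y p)
      = g p (\<gamma> X Y p) (Z p)"
    by (intro sym t vector_field_\<gamma> X Y Z)+
  ultimately show ?thesis
    by (simp add: metric_S[OF X Y Z p] metric_S[OF X Z Y p])
qed

text \<open>Metric compatibility of \<open>D\<close> eliminates it from \<open>metric_S\<close>;
  what remains is the covariant derivative of \<open>g\<close> with respect to \<open>nab\<close>.
  In this form \<open>S\<close> can be compared with the Koszul formula on the tangent
  bundle.\<close>

lemma metric_S_eq:
  assumes X: "vector_field M U X" and Y: "vector_field M U Y" and Z: "vector_field M U Z"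
      and p: "p \<in> U"
  shows "g p (S X Y p) (Z p) =
    dir_deriv M X (\<lambda>q. g q (Y q) (Z q)) p - g p (nab X Y p) (Z p) - g p (Y p) (nab X Z p)"
proof -
  note t = vector_field_tangent[OF _ p]
  have "dir_deriv M X (\<lambda>q. g q (Y q) (Z q)) p = g p (D X Y p) (Z p) + g p (Y p) (D X Z p)"
    using levi_civita U X Y Z p unfolding levi_civita_def by blast
  moreover have "g p (\<gamma> X Y p) (Z p) = g p (D X Y p) (Z p) - g p (nab X Y p) (Z p)"
    unfolding \<gamma>_apply
    by (intro metric_diff_left[OF carrier_U[OF p]] t D.T.connection_vector_field[OF U]
        N.T.connection_vector_field[OF U] X Y Z)
  moreover have "g p (Y p) (\<gamma> X Z p) = g p (Y p) (D X Z p) - g p (Y p) (nab X Z p)"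
    unfolding \<gamma>_apply
    by (intro metric_diff_right[OF carrier_U[OF p]] t D.T.connection_vector_field[OF U]
        N.T.connection_vector_field[OF U] X Y Z)
  ultimately show ?thesis
    by (simp add: metric_S[OF X Y Z p])
qed

lemma S_cong:
  assumes "vector_field M U X" "vector_field M U X'" "vector_field M U Y" "vector_field M U Y'"
    "\<And>q. q \<in> U \<Longrightarrow> X q = X' q" "\<And>q. q \<in> U \<Longrightarrow> Y q = Y' q" "p \<in> U"
  shows "S X Y p = S X' Y' p"
proof (rule metric_nondegenerate[OF U assms(7)])
  fix Z assume Z: "vector_field M U Z"
  have "dir_deriv M X (\<lambda>q. g q (Y q) (Z q)) p = dir_deriv M X' (\<lambda>q. g q (Y' q) (Z q)) p"
    by (rule dir_deriv_cong[OF U assms(7)]) (use assms in auto)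
  then show "g p (S X Y p) (Z p) = g p (S X' Y' p) (Z p)"
    using N.T.connection_cong[OF U assms] N.T.connection_cong[OF U assms(1,2) Z Z assms(5) refl
        assms(7)]
    by (simp add: metric_S_eq[OF assms(1,3) Z assms(7)] metric_S_eq[OF assms(2,4) Z assms(7)]
        assms(6,7))
qed (use assms in \<open>auto intro: vector_field_S\<close>)

lemma S_add_left:
  assumes X: "vector_field M U X" and X': "vector_field M U X'" and Y: "vector_field M U Y"
      and p: "p \<in> U"
  shows "S (X + X') Y p = S X Y p + S X' Y p"
  using \<gamma>_add_left[OF X X' Y p] tensorial_add[OF \<gamma>\<^sub>s_tensorial_left[OF p Y] U X X']
  by (simp add: S_def fun_eq_iff)

lemma S_scale_left:
  assumes X: "vector_field M U X" and Y: "vector_field M U Y" and f: "smooth_fun M U f"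
      and p: "p \<in> U"
  shows "S (\<lambda>q. f q \<cdot> X q) Y p = f p \<cdot> S X Y p"
  using \<gamma>_scale_left[OF X Y f p] tensorial_scale[OF \<gamma>\<^sub>s_tensorial_left[OF p Y] U X f]
  by (simp add: S_def fun_eq_iff algebra_simps)

lemma S_add_right:
  assumes X: "vector_field M U X" and Y: "vector_field M U Y" and Y': "vector_field M U Y'"
      and p: "p \<in> U"
  shows "S X (Y + Y') p = S X Y p + S X Y' p"
proof -
  have "\<gamma> X (Y + Y') p = \<gamma> X Y p + \<gamma> X Y' p"
    using \<gamma>_add_left[OF Y Y' X p] by (simp add: \<gamma>_commute X Y Y' p vector_field_add[OF U])
  then show ?thesis
    using tensorial_add[OF \<gamma>\<^sub>s_tensorial_right[OF p X] U Y Y'] by (simp add: S_def fun_eq_iff)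
qed

lemma S_scale_right:
  assumes X: "vector_field M U X" and Y: "vector_field M U Y" and f: "smooth_fun M U f"
      and p: "p \<in> U"
  shows "S X (\<lambda>q. f q \<cdot> Y q) p = f p \<cdot> S X Y p"
proof -
  have "\<gamma> X (\<lambda>q. f q \<cdot> Y q) p = f p \<cdot> \<gamma> X Y p"
    using \<gamma>_scale_left[OF Y X f p] by (simp add: \<gamma>_commute X Y f p vector_field_scale[OF U])
  then show ?thesis
    using tensorial_scale[OF \<gamma>\<^sub>s_tensorial_right[OF p X] U Y f]
    by (simp add: S_def fun_eq_iff algebra_simps)
qed

lemma S_tensorial_left:
  assumes p: "p \<in> U" and Y: "vector_field M U Y"
  shows "tensorial_at U p (\<lambda>X. S X Y p j)"
  by (rule tensorial_atI, (rule fun_cong[OF S_cong[OF _ _ Y Y _ refl p]]; blast))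
    (simp_all add: S_add_left[OF _ _ Y p] S_scale_left[OF _ Y _ p])

text \<open>The defect of \<open>nab\<close> against the metric is \<open>S\<close>; since
  \<open>S X\<close> is symmetric, half of it in each argument compensates exactly.\<close>

lemma A_metric:
  assumes X: "vector_field M U X" and Y: "vector_field M U Y" and Z: "vector_field M U Z"
      and p: "p \<in> U"
  shows "dir_deriv M X (\<lambda>q. g q (Y q) (Z q)) p = g p (A X Y p) (Z p) + g p (Y p) (A X Z p)"
proof -
  note t = vector_field_tangent[OF _ p] and c = carrier_U[OF p]
  have "g p (A X Y p) (Z p) = g p (nab X Y p) (Z p) + 1 / 2 * g p (S X Y p) (Z p)"
    using t[OF vector_field_S[OF X Y]] t[OF N.T.connection_vector_field[OF U X Y]] t[OF Z]
    by (simp add: A_def metric_add_left[OF c] metric_scale_left[OF c])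
  moreover have "g p (Y p) (A X Z p) = g p (Y p) (nab X Z p) + 1 / 2 * g p (Y p) (S X Z p)"
    using t[OF vector_field_S[OF X Z]] t[OF N.T.connection_vector_field[OF U X Z]] t[OF Y]
    by (simp add: A_def metric_add_right[OF c] metric_scale_right[OF c])
  ultimately show ?thesis
    using metric_S_eq[OF X Y Z p] S_symmetric[OF X Y Z p] by simp
qed

end

lemma S_tensorial_right:
  assumes U: "mopen M U" and p: "p \<in> U" and X: "vector_field M U X"
  shows "tensorial_at U p (\<lambda>Y. S X Y p j)"
  by (rule tensorial_atI, (rule fun_cong[OF S_cong[OF U X X _ _ refl _ p]]; blast))
    (simp_all add: S_add_right[OF U X _ _ p] S_scale_right[OF U X _ _ p])

text \<open>A connection plus a tensor: the Leibniz term comes from \<open>nab\<close>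
  alone.\<close>

lemma connection_A: "connection M A"
  unfolding connection_def
proof (intro allI impI conjI ballI; (elim conjE)?)
  fix U X X' Y Y' and f :: "'m \<Rightarrow> real"
  assume U: "mopen M U" and vf: "vector_field M U X" "vector_field M U X'"
    "vector_field M U Y" "vector_field M U Y'" and f: "smooth_fun M U f"
  show "vector_field M U (A X Y)" by (rule vector_field_A[OF U vf(1,3)])
  fix p assume p: "p \<in> U"
  show "A X Y p = A X' Y' p" if eq: "\<forall>p\<in>U. X p = X' p \<and> Y p = Y' p"
  proof -
    have "S X Y p = S X' Y' p" "nab X Y p = nab X' Y' p"
      using eq p by (auto intro!: S_cong[OF U vf] N.T.connection_cong[OF U vf])
    then show ?thesis by (simp add: A_def)
  qed
  show "A (X + X') Y p = A X Y p + A X' Y p"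
    by (simp add: A_def S_add_left[OF U vf(1-3) p] N.T.connection_add_left[OF U vf(1-3) p]
        vscale_add_right)
  show "A (\<lambda>q. f q \<cdot> X q) Y p = f p \<cdot> A X Y p"
    by (simp add: A_def S_scale_left[OF U vf(1,3) f p] N.T.connection_scale_left[OF U vf(1,3) f p]
        vscale_add_right mult.commute)
  show "A X (Y + Y') p = A X Y p + A X Y' p"
    by (simp add: A_def S_add_right[OF U vf(1,3,4) p] N.T.connection_add_right[OF U vf(1,3,4) p]
        vscale_add_right)
  show "A X (\<lambda>q. f q \<cdot> Y q) p = dir_deriv M X f p \<cdot> Y p + f p \<cdot> A X Y p"
    by (simp add: A_def S_scale_right[OF U vf(1,3) f p] N.T.connection_leibniz[OF U vf(1,3) f p]
        vscale_add_right mult.commute)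
qed

sublocale A: atlas_connection M A
  by standard (rule connection_A)

text \<open>The product of two frame vectors is constant, and its derivative along \<open>X\<close>
  is the sum of the two sides. The operator \<open>B\<close> is a parameter so that the argument
  serves both \<open>D\<close> and \<open>A\<close>.\<close>

lemma metric_connection_antisym:
  assumes E: "orthonormal_frame M g U E" and p: "p \<in> U" and X: "vector_field M U X"
    and vf: "\<And>k. k < DIM('e) \<Longrightarrow> vector_field M U (B X (E k))"
    and metric: "\<And>k l. k < DIM('e) \<Longrightarrow> l < DIM('e) \<Longrightarrow>
      dir_deriv M X (\<lambda>q. g q (E k q) (E l q)) p
          = g p (B X (E k) p) (E l p) + g p (E k p) (B X (E l) p)"
    and kl: "k < DIM('e)" "l < DIM('e)"
  shows "g p (B X (E k) p) (E l p) = - g p (B X (E l) p) (E k p)"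
proof -
  have U: "mopen M U" and vE: "\<And>k. k < DIM('e) \<Longrightarrow> vector_field M U (E k)"
    using E by (auto simp: orthonormal_frame_def)
  have "dir_deriv M X (\<lambda>q. g q (E k q) (E l q)) p = dir_deriv M X (\<lambda>q. if k = l then 1 else 0) p"
    by (rule dir_deriv_cong[OF U p]) (use E kl in \<open>auto simp: orthonormal_frame_def\<close>)
  also have "\<dots> = 0" by (rule dir_deriv_const[OF U p])
  finally have "g p (B X (E k) p) (E l p) + g p (E k p) (B X (E l) p) = 0"
    using metric[OF kl] by simp
  moreover have "g p (E k p) (B X (E l) p) = g p (B X (E l) p) (E k p)"
    by (intro metric_sym[OF carrier_U[OF U p]] vector_field_tangent[OF _ p] vE vf kl)
  ultimately show ?thesis by simp
qed

lemma frame_expand: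
  assumes E: "orthonormal_frame M g U E" and p: "p \<in> U" and v: "v \<in> tangent_space M p"
  shows "v = (\<Sum>k<DIM('e). g p v (E k p) \<cdot> E k p)"
proof (rule orthonormal_expand[OF carrier_U[OF _ p] _ _ _ _ v])
  show "mopen M U" using E by (simp add: orthonormal_frame_def)
  show "E k p \<in> tangent_space M p" if "k \<in> {..<DIM('e)}" for k
    using E that vector_field_tangent[OF _ p] by (auto simp: orthonormal_frame_def)
qed (use E p in \<open>auto simp: orthonormal_frame_def\<close>)

section \<open>Consequences of the vanishing trace\<close>

theorem trace_cov_deriv_vanishes:
  assumes tr: "trace_vanishes M g \<gamma>\<^sub>s" and X: "vector_field M (carrier_of M) X"
  shows "trace_vanishes M g (cov_deriv D X \<gamma>\<^sub>s)"
  unfolding trace_vanishes_def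
proof (intro allI impI ballI)
  fix U' E p assume E': "orthonormal_frame M g U' E" and p': "p \<in> U'"
  have U': "mopen M U'" using E' by (simp add: orthonormal_frame_def)
  obtain i where i: "i \<in> charts_at M p"
    using carrier_chart[OF carrier_U[OF U' p']] by blast
  \<comment> \<open>Restriction to a chart domain, where \<open>tensorial_lincomb\<close> lets
    \<open>D X (E k)\<close> be replaced by its frame expansion at \<open>p\<close>.\<close>
  define U where "U = U' \<inter> cdom M i"
  have U: "mopen M U" "U \<subseteq> cdom M i" "U \<subseteq> U'" "p \<in> U" "i \<in> idx M"
    using U' i p' by (auto simp: U_def charts_at_iff intro: mopen_Int mopen_cdom)
  have E: "orthonormal_frame M g U E"
    by (rule orthonormal_frame_subset[OF E' U(1,3)])
  have XU: "vector_field M U X"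
    by (rule vector_field_subset[OF X mopen_carrier[OF U(1)]])
  have vE: "vector_field M U (E k)" if "k < DIM('e)" for k
    using E that by (simp add: orthonormal_frame_def)
  have vD: "vector_field M U (D X (E k))" if "k < DIM('e)" for k
    by (rule D.T.connection_vector_field[OF U(1) XU vE[OF that]])
  define a where "a k l = g p (D X (E k) p) (E l p)" for k l
  have anti: "a k l = - a l k" if "k < DIM('e)" "l < DIM('e)" for k l
    unfolding a_def
    by (rule metric_connection_antisym[where B = D, OF E U(4) XU vD _ that])
      (use levi_civita U XU vE in \<open>unfold levi_civita_def, blast+\<close>)
  have D_eq: "D X (E k) p = (\<Sum>l<DIM('e). a k l \<cdot> E l p)" if "k < DIM('e)" for k
    unfolding a_def by (rule frame_expand[OF E U(4) vector_field_tangent[OF vD[OF that] U(4)]])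
  have "frame_trace E (cov_deriv D X \<gamma>\<^sub>s) p j = 0" for j
  proof -
    have left: "\<gamma>\<^sub>s (D X (E k)) (E k) p j = (\<Sum>l<DIM('e). a k l *\<^sub>R \<gamma>\<^sub>s (E l) (E k) p j)"
      if "k < DIM('e)" for k
      by (rule tensorial_lincomb[OF \<gamma>\<^sub>s_tensorial_left[OF U(1,4) vE[OF that]] U(1,2,5) vD[OF that]
          vE D_eq[OF that]])
        simp
    have right: "\<gamma>\<^sub>s (E k) (D X (E k)) p j = (\<Sum>l<DIM('e). a k l *\<^sub>R \<gamma>\<^sub>s (E k) (E l) p j)"
      if "k < DIM('e)" for k
      by (rule tensorial_lincomb[OF \<gamma>\<^sub>s_tensorial_right[OF U(1,4) vE[OF that]] U(1,2,5) vD[OF that]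
          vE D_eq[OF that]])
        simp
    \<comment> \<open>The trace vanishes on the whole neighbourhood, so the field being
      differentiated is zero there and not merely at \<open>p\<close>.\<close>
    have "(\<Sum>k<DIM('e). D X (\<gamma>\<^sub>s (E k) (E k)) p) = D X (\<Sum>k<DIM('e). \<gamma>\<^sub>s (E k) (E k)) p"
      using vE by (intro D.T.connection_sum_right[OF U(1) XU U(4), symmetric] vector_field_\<gamma>\<^sub>s[OF
          U(1)]) auto
    also have "\<dots> = D X 0 p"
    proof (rule D.T.connection_cong[OF U(1) XU XU _ vector_field_zero[OF U(1)] refl _ U(4)])
      show "vector_field M U (\<Sum>k<DIM('e). \<gamma>\<^sub>s (E k) (E k))"
        using vE by (intro vector_field_sum[OF U(1)] vector_field_\<gamma>\<^sub>s[OF U(1)]) auto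
      show "(\<Sum>k<DIM('e). \<gamma>\<^sub>s (E k) (E k)) q = 0 q" if "q \<in> U" for q
        using tr E that by (auto simp: trace_vanishes_def frame_trace_def)
    qed
    also have "\<dots> = 0" by (rule D.T.connection_zero_right[OF U(1) XU U(4)])
    finally have zero: "(\<Sum>k<DIM('e). D X (\<gamma>\<^sub>s (E k) (E k)) p j) = 0"
      by (metis sum_fun_apply zero_fun_apply)
    have "frame_trace E (cov_deriv D X \<gamma>\<^sub>s) p j
        = (\<Sum>k<DIM('e). D X (\<gamma>\<^sub>s (E k) (E k)) p j)
          - (\<Sum>k<DIM('e). \<gamma>\<^sub>s (D X (E k)) (E k) p j + \<gamma>\<^sub>s (E k) (D X (E k)) p j)"
      by (simp add: frame_trace_def cov_deriv_def sum_subtractf[symmetric] algebra_simps)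
    \<comment> \<open>Adding the two corrections gives a coefficient symmetric in \<open>k\<close>
      and \<open>l\<close>, which the antisymmetric \<open>a k l\<close> annihilates.\<close>
    also have "(\<Sum>k<DIM('e). \<gamma>\<^sub>s (D X (E k)) (E k) p j + \<gamma>\<^sub>s (E k) (D X (E k)) p j)
        = (\<Sum>k<DIM('e). \<Sum>l<DIM('e). a k l *\<^sub>R (\<gamma>\<^sub>s (E l) (E k) p j + \<gamma>\<^sub>s (E k) (E l) p j))"
      by (intro sum.cong) (auto simp: left right scaleR_add_right sum.distrib)
    also have "\<dots> = 0"
      by (rule sum_antisym_sym_eq_0, rule anti) (simp_all add: add.commute)
    finally show ?thesis using zero by simp
  qed
  then show "frame_trace E (cov_deriv D X \<gamma>\<^sub>s) p = 0" by (simp add: fun_eq_iff)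
qed

text \<open>Both terms of \<open>metric_S\<close> agree on a frame vector, and symmetry of
  \<open>\<gamma>\<close> turns \<open>\<gamma> X (E k)\<close> into
  \<open>\<gamma> (E k) X\<close>, where the adjoint moves the operator to
  \<open>\<gamma>\<^sub>s (E k) (E k)\<close>.\<close>

lemma trace_S:
  assumes tr: "trace_vanishes M g \<gamma>\<^sub>s" and E: "orthonormal_frame M g U E" and p: "p \<in> U"
    and X: "vector_field M U X"
  shows "(\<Sum>k<DIM('e). g p (S X (E k) p) (E k p)) = 0"
proof -
  have U: "mopen M U" and vE: "\<And>k. k < DIM('e) \<Longrightarrow> vector_field M U (E k)"
    using E by (auto simp: orthonormal_frame_def)
  note t = vector_field_tangent[OF _ p] and c = carrier_U[OF U p]
  have "g p (S X (E k) p) (E k p) = 2 * g p (\<gamma>\<^sub>s (E k) (E k) p) (X p)" if "k < DIM('e)" for k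
  proof -
    note e = vE[OF that]
    have "g p (\<gamma> X (E k) p) (E k p) = g p (E k p) (\<gamma> X (E k) p)"
      by (intro metric_sym[OF c] t vector_field_\<gamma>[OF U] X e)
    then show ?thesis
      using metric_S[OF U X e e p] adjoint_eq[OF U e e X p] \<gamma>_commute[OF U X e p] by simp
  qed
  then have "(\<Sum>k<DIM('e). g p (S X (E k) p) (E k p))
      = 2 * (\<Sum>k<DIM('e). g p (\<gamma>\<^sub>s (E k) (E k) p) (X p))"
    by (simp add: sum_distrib_left)
  also have "(\<Sum>k<DIM('e). g p (\<gamma>\<^sub>s (E k) (E k) p) (X p)) = g p (\<Sum>k<DIM('e). \<gamma>\<^sub>s (E k) (E k) p) (X p)"
    using vE by (intro metric_sum_left[OF c, symmetric] t vector_field_\<gamma>\<^sub>s[OF U] X) auto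
  also have "(\<Sum>k<DIM('e). \<gamma>\<^sub>s (E k) (E k) p) = 0"
    using tr E p by (auto simp: trace_vanishes_def frame_trace_def fun_eq_iff)
  finally show ?thesis
    unfolding metric_zero_left[OF c t[OF X]] by simp
qed

text \<open>The trace of \<open>S Y\<close> vanishes on all of \<open>U\<close>, hence so does its
  derivative along \<open>X\<close>. Since \<open>A\<close> is metric, this derivative is the trace
  of the commutator up to a frame rotation term, an antisymmetric matrix paired with a symmetric
  one. The \<open>S W\<close> part vanishes by \<open>trace_S\<close>.\<close>

lemma trace_commutator:
  assumes tr: "trace_vanishes M g \<gamma>\<^sub>s" and E: "orthonormal_frame M g U E" and p: "p \<in> U"
    and X: "vector_field M U X" and Y: "vector_field M U Y" and W: "vector_field M U W"
  shows "(\<Sum>k<DIM('e). g p (S W (E k) p - A X (S Y (E k)) p + S Y (A X (E k)) p) (E k p)) = 0"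
proof -
  have U: "mopen M U" and vE: "\<And>k. k < DIM('e) \<Longrightarrow> vector_field M U (E k)"
    using E by (auto simp: orthonormal_frame_def)
  note t = vector_field_tangent[OF _ p] and c = carrier_U[OF U p]
  define w where "w k l = g p (A X (E k) p) (E l p)" for k l
  have vA: "vector_field M U (A X (E k))" if "k < DIM('e)" for k
    by (rule vector_field_A[OF U X vE[OF that]])
  have anti: "w k l = - w l k" if "k < DIM('e)" "l < DIM('e)" for k l
    unfolding w_def
    by (rule metric_connection_antisym[where B
        = A, OF E p X vA _ that]) (use A_metric[OF U X] vE p in auto)
  have A_eq: "A X (E k) p = (\<Sum>l<DIM('e). w k l \<cdot> E l p)" if "k < DIM('e)" for k
    unfolding w_def by (rule frame_expand[OF E p t[OF vA[OF that]]])
  have sm: "smooth_fun M U (\<lambda>q. g q (S Y (E k) q) (E k q))" if "k < DIM('e)" for k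
    by (intro metric_smooth[OF U] vector_field_S[OF U] Y vE that)
  have "(\<Sum>k<DIM('e). dir_deriv M X (\<lambda>q. g q (S Y (E k) q) (E k q)) p)
      = dir_deriv M X (\<lambda>q. \<Sum>k<DIM('e). g q (S Y (E k) q) (E k q)) p"
    by (rule dir_deriv_sum[OF U p, symmetric]) (use sm t[OF X] in auto)
  also have "\<dots> = dir_deriv M X (\<lambda>q. 0) p"
    by (rule dir_deriv_cong[OF U p]) (use trace_S[OF tr E _ Y] in auto)
  also have "\<dots> = 0" by (rule dir_deriv_const[OF U p])
  finally have zero: "(\<Sum>k<DIM('e). dir_deriv M X (\<lambda>q. g q (S Y (E k) q) (E k q)) p) = 0" .
  \<comment> \<open>The factor \<open>2\<close> collects one copy of the product of
    \<open>S Y (E k)\<close> with \<open>A X (E k)\<close> from moving the symmetric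
    \<open>S Y\<close> across the metric, and one from the Leibniz rule of \<open>A\<close>.\<close>
  have "g p (S W (E k) p - A X (S Y (E k)) p + S Y (A X (E k)) p) (E k p)
      = g p (S W (E k) p) (E k p) - dir_deriv M X (\<lambda>q. g q (S Y (E k) q) (E k q)) p
        + 2 * (\<Sum>l<DIM('e). w k l * g p (S Y (E k) p) (E l p))" if "k < DIM('e)" for k
  proof -
    note e = vE[OF that] and vf = vector_field_S[OF U] vector_field_A[OF U]
    have "g p (S W (E k) p - A X (S Y (E k)) p + S Y (A X (E k)) p) (E k p)
        = g p (S W (E k) p) (E k p) - g p (A X (S Y (E k)) p) (E k p) + g p (S Y (A X (E k)) p)
            (E k p)"
      using t[OF vf(1)[OF W e]] t[OF vf(2)[OF X vf(1)[OF Y e]]] t[OF vf(1)[OF Y vf(2)[OF X e]]]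
          t[OF e]
      by (simp add: metric_add_left[OF c] metric_diff_left[OF c])
    moreover have "g p (S Y (A X (E k)) p) (E k p) = g p (S Y (E k) p) (A X (E k) p)"
      using S_symmetric[OF U Y vf(2)[OF X e] e p]
        metric_sym[OF c t[OF vf(2)[OF X e]] t[OF vf(1)[OF Y e]]] by simp
    moreover have "g p (S Y (E k) p) (A X (E k) p)
        = (\<Sum>l<DIM('e). w k l * g p (S Y (E k) p) (E l p))"
    proof -
      have "g p (S Y (E k) p) (\<Sum>l<DIM('e). w k l \<cdot> E l p)
          = (\<Sum>l<DIM('e). g p (S Y (E k) p) (w k l \<cdot> E l p))"
        using vE by (intro metric_sum_right[OF c] t[OF vf(1)[OF Y e]] tangent_scale t) auto
      also have "\<dots> = (\<Sum>l<DIM('e). w k l * g p (S Y (E k) p) (E l p))"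
        using vE by (intro sum.cong refl metric_scale_right[OF c] t[OF vf(1)[OF Y e]] t) auto
      finally show ?thesis using A_eq[OF that] by simp
    qed
    moreover have "dir_deriv M X (\<lambda>q. g q (S Y (E k) q) (E k q)) p
        = g p (A X (S Y (E k)) p) (E k p) + g p (S Y (E k) p) (A X (E k) p)"
      by (rule A_metric[OF U X vf(1)[OF Y e] e p])
    ultimately show ?thesis by simp
  qed
  then have "(\<Sum>k<DIM('e). g p (S W (E k) p - A X (S Y (E k)) p + S Y (A X (E k)) p) (E k p))
      = (\<Sum>k<DIM('e). g p (S W (E k) p) (E k p))
        - (\<Sum>k<DIM('e). dir_deriv M X (\<lambda>q. g q (S Y (E k) q) (E k q)) p)
        + 2 * (\<Sum>k<DIM('e). \<Sum>l<DIM('e). w k l * g p (S Y (E k) p) (E l p))"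
    by (simp add: sum.distrib sum_subtractf sum_distrib_left)
  moreover have "(\<Sum>k<DIM('e). \<Sum>l<DIM('e). w k l *\<^sub>R g p (S Y (E k) p) (E l p)) = 0"
  proof (rule sum_antisym_sym_eq_0, rule anti)
    fix k l assume "k \<in> {..<DIM('e)}" "l \<in> {..<DIM('e)}"
    then show "g p (S Y (E k) p) (E l p) = g p (S Y (E l) p) (E k p)"
      using S_symmetric[OF U Y vE vE p, of k l] vector_field_S[OF U Y vE, of l] vE[of k]
        metric_sym[OF c t t, of "E k" "S Y (E l)"] by simp
  qed auto
  ultimately show ?thesis
    using trace_S[OF tr E p W] zero by simp
qed

end

section \<open>The tangent bundle\<close>

text \<open>The preimage of \<open>U\<close> under the projection; for a chart domain it is the
  domain of the bundle chart.\<close>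

definition bundle_over :: "('i, 'm, 'e::euclidean_space) atlas \<Rightarrow> 'm set \<Rightarrow> ('m \<times>
    ('i \<Rightarrow> 'e)) set" where
  "bundle_over M U = {(p, v). p \<in> U \<and> v \<in> tangent_space M p}"

lemma bundle_over_iff [simp]: "(p, v) \<in> bundle_over M U \<longleftrightarrow> p \<in> U \<and> v \<in> tangent_space M p"
  by (simp add: bundle_over_def)

lemma tangent_bundle_simps [simp]:
  "idx (tangent_bundle M) = idx M"
  "cdom (tangent_bundle M) i = bundle_over M (cdom M i)"
  "chart (tangent_bundle M) i (p, v) = (chart M i p, v i)"
  by (simp_all add: tangent_bundle_def bundle_over_def)

lemma charts_at_bundle [simp]:
  "v \<in> tangent_space M p \<Longrightarrow> charts_at (tangent_bundle M) (p, v) = charts_at M p"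
  by (simp add: charts_at_def)

lemma carrier_bundle: "carrier_of (tangent_bundle M) = bundle_over M (carrier_of M)"
  by (auto simp: carrier_of_def bundle_over_def)

context smooth_atlas
begin

text \<open>Every fibre coordinate \<open>y\<close> is attained, by the value of
  \<open>const_field M i y\<close>.\<close>

lemma chart_bundle_image:
  assumes "i \<in> idx M"
  shows "chart (tangent_bundle M) i ` (bundle_over M U \<inter> cdom (tangent_bundle M) i)
    = chart M i ` (U \<inter> cdom M i) \<times> UNIV"
proof (intro equalityI subsetI)
  fix z assume "z \<in> chart (tangent_bundle M) i ` (bundle_over M U \<inter> cdom (tangent_bundle M) i)"
  then obtain \<xi> where "\<xi> \<in> bundle_over M U" "\<xi> \<in> bundle_over M (cdom M i)" "z
      = chart (tangent_bundle M) i \<xi>"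
    by auto
  then show "z \<in> chart M i ` (U \<inter> cdom M i) \<times> UNIV"
    by (cases \<xi>) auto
next
  fix z assume "z \<in> chart M i ` (U \<inter> cdom M i) \<times> (UNIV :: 'e set)"
  then obtain p y where p: "p \<in> U" "p \<in> cdom M i" and z: "z = (chart M i p, y)"
    by auto
  have "z = chart (tangent_bundle M) i (p, const_field M i y p)"
    using z p assms by (simp add: const_field_apply charts_at_iff)
  moreover have "(p, const_field M i y p) \<in> bundle_over M U \<inter> cdom (tangent_bundle M) i"
    using p by simp
  ultimately show "z \<in> chart (tangent_bundle M) i ` (bundle_over M U \<inter> cdom (tangent_bundle M) i)"
    by blast
qed

lemma inj_chart_bundle:
  assumes "i \<in> idx M"
  shows "inj_on (chart (tangent_bundle M) i) (cdom (tangent_bundle M) i)"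
proof (rule inj_onI)
  fix \<xi> \<eta> assume *: "\<xi> \<in> cdom (tangent_bundle M) i" "\<eta> \<in> cdom (tangent_bundle M) i"
    "chart (tangent_bundle M) i \<xi> = chart (tangent_bundle M) i \<eta>"
  obtain p v q w where [simp]: "\<xi> = (p, v)" "\<eta> = (q, w)" by (cases \<xi>, cases \<eta>)
  have "p = q" using * inj_chart[OF assms] by (auto dest: inj_onD)
  then show "\<xi> = \<eta>" using * tangent_eqI[of v p w i] assms by (auto simp: charts_at_iff)
qed

lemma param_bundle:
  assumes "i \<in> idx M" "p \<in> cdom M i"
  shows "param (tangent_bundle M) i (chart M i p, y) = (p, const_field M i y p)"
proof -
  have "chart (tangent_bundle M) i (p, const_field M i y p) = (chart M i p, y)"
    using assms by (simp add: const_field_apply charts_at_iff)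
  moreover have "(p, const_field M i y p) \<in> cdom (tangent_bundle M) i"
    using assms by simp
  ultimately show ?thesis
    unfolding param_def using inv_into_f_f[OF inj_chart_bundle[OF assms(1)]] by metis
qed

lemma transition_bundle:
  assumes "i \<in> idx M" "j \<in> idx M" "x \<in> chart M i ` (cdom M i \<inter> cdom M j)"
  shows "transition (tangent_bundle M) i j (x, y)
    = (transition M i j x, frechet_derivative (transition M i j) (at x) y)"
proof -
  obtain p where p: "p \<in> cdom M i" "p \<in> cdom M j" "x = chart M i p"
    using assms by blast
  then show ?thesis
    using assms param_bundle[OF assms(1) p(1)]
    by (simp add: transition_def[of "tangent_bundle M"] const_field_def charts_at_iff dtrans_def)
qed

lemma cdom_bundle_Int:
  "cdom (tangent_bundle M) i \<inter> cdom (tangent_bundle M) j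
    = bundle_over M (cdom M i \<inter> cdom M j) \<inter> cdom (tangent_bundle M) i"
  by auto

lemma overlap_bundle:
  assumes "i \<in> idx M"
  shows "chart (tangent_bundle M) i ` (cdom (tangent_bundle M) i \<inter> cdom (tangent_bundle M) j)
    = chart M i ` (cdom M i \<inter> cdom M j) \<times> UNIV"
  unfolding cdom_bundle_Int chart_bundle_image[OF assms] by (simp add: Int_ac)

text \<open>In the bundle charts the second component of a transition is the derivative of
  \<open>\<tau> \<circ> fst\<close> in the direction \<open>(y, 0)\<close>, which reduces it to calculus on the product space.\<close>

lemma transition_bundle_calculus:
  fixes f :: "'e \<Rightarrow> 'e"
  assumes S: "open S" and f: "smooth_on S f"
  shows "smooth_on (S \<times> (UNIV :: 'e set)) (\<lambda>z. frechet_derivative f (at (fst z)) (snd z))"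
      (is ?smooth)
    and "x \<in> S \<Longrightarrow> frechet_derivative (\<lambda>z. frechet_derivative f (at (fst z)) (snd z)) (at (x, y)) w
      = frechet_derivative f (at x) (snd w)
        + frechet_derivative (\<lambda>x. frechet_derivative f (at x) y) (at x) (fst w)"
proof -
  let ?T = "S \<times> (UNIV :: 'e set)"
  let ?f = "\<lambda>z :: 'e \<times> 'e. f (fst z)" and ?h = "\<lambda>z :: 'e \<times> 'e. (snd z, 0 :: 'e)"
  have T: "open ?T" using S by (simp add: open_Times)
  have sf: "smooth_on ?T ?f" by (rule smooth_on_fst_compose[OF S f])
  have sh: "smooth_on ?T ?h" by (intro smooth_on_Pair T smooth_on_snd smooth_on_const)
  have Df: "frechet_derivative ?f (at z) w = frechet_derivative f (at (fst z)) (fst w)"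
      if "z \<in> ?T" for z w
    using that by (intro frechet_derivative_fst smooth_on_differentiable[OF S f]) auto
  show ?smooth
    by (rule smooth_on_cong[OF T smooth_on_frechet_apply[OF T sf sh]]) (simp add: Df)
  assume x: "x \<in> S"
  then have z: "(x, y) \<in> ?T" by simp
  have "frechet_derivative (\<lambda>z. frechet_derivative f (at (fst z)) (snd z)) (at (x, y)) w
      = frechet_derivative (\<lambda>z. frechet_derivative ?f (at z) (?h z)) (at (x, y)) w"
    by (subst frechet_derivative_cong_open[OF T z, of _ "\<lambda>z. frechet_derivative ?f (at z) (?h z)"])
      (simp_all add: Df)
  also have "\<dots> = frechet_derivative ?f (at (x, y)) (frechet_derivative ?h (at (x, y)) w)
      + frechet_derivative (\<lambda>z. frechet_derivative ?f (at z) (?h (x, y))) (at (x, y)) w"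
    by (rule frechet_derivative_apply_deriv[OF T z sf sh])
  also have "frechet_derivative ?h (at (x, y)) w = (snd w, 0)"
  proof -
    have "(?h has_derivative (\<lambda>w. (snd w, 0))) (at (x, y))"
      by (intro has_derivative_Pair has_derivative_snd has_derivative_ident has_derivative_const)
    then show ?thesis by (metis frechet_derivative_at)
  qed
  also have "frechet_derivative (\<lambda>z. frechet_derivative ?f (at z) (?h (x, y))) (at (x, y)) w
      = frechet_derivative (\<lambda>z :: 'e \<times> 'e. frechet_derivative f (at (fst z)) y) (at (x, y)) w"
    by (subst frechet_derivative_cong_open[OF T z, of _ "\<lambda>z. frechet_derivative f (at (fst z)) y"])
      (simp_all add: Df)
  also have "\<dots> = frechet_derivative (\<lambda>x. frechet_derivative f (at x) y) (at x) (fst w)"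
    using frechet_derivative_fst[of "\<lambda>x. frechet_derivative f (at x) y" "(x, y)" w]
      smooth_on_differentiable[OF S smooth_on_frechet[OF f] x] by simp
  finally show "frechet_derivative (\<lambda>z. frechet_derivative f (at (fst z)) (snd z)) (at (x, y)) w
      = frechet_derivative f (at x) (snd w)
        + frechet_derivative (\<lambda>x. frechet_derivative f (at x) y) (at x) (fst w)"
    by (simp add: Df[OF z])
qed

lemma smooth_atlas_bundle: "smooth_atlas (tangent_bundle M)"
proof
  show "inj_on (chart (tangent_bundle M) i) (cdom (tangent_bundle M) i)"
      if "i \<in> idx (tangent_bundle M)" for i
    using inj_chart_bundle that by simp
  fix i j assume "i \<in> idx (tangent_bundle M)" "j \<in> idx (tangent_bundle M)"
  then have ij: "i \<in> idx M" "j \<in> idx M" by simp_all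
  let ?S = "chart M i ` (cdom M i \<inter> cdom M j)"
  have S: "open ?S" by (rule open_overlap[OF ij])
  show "open (chart (tangent_bundle M) i ` (cdom (tangent_bundle M) i \<inter> cdom (tangent_bundle M) j))"
    unfolding overlap_bundle[OF ij(1)] using S by (simp add: open_Times)
  have "smooth_on (?S \<times> UNIV) (\<lambda>z. (transition M i j (fst z),
      frechet_derivative (transition M i j) (at (fst z)) (snd z)))"
    by (intro smooth_on_Pair smooth_on_fst_compose transition_bundle_calculus S smooth_transition
        ij open_Times open_UNIV)
  then show "smooth_on (chart (tangent_bundle M) i ` (cdom (tangent_bundle M) i \<inter> cdom
      (tangent_bundle M) j))
      (transition (tangent_bundle M) i j)"
    unfolding overlap_bundle[OF ij(1)]
    by (rule smooth_on_cong[rotated]) (use S transition_bundle[OF ij] in \<open>auto simp: open_Times\<close>)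
qed

text \<open>The fibre coordinate transforms by the first derivative of the transition, so
  differentiating the bundle transition brings in the second. This is the inhomogeneous term that
  the Christoffel symbols must cancel.\<close>

lemma dtrans_bundle:
  assumes "i \<in> charts_at M p" "j \<in> charts_at M p" "v \<in> tangent_space M p"
  shows "dtrans (tangent_bundle M) i j (p, v) (a, b) = (dtrans M i j p a,
    frechet_derivative (\<lambda>x. frechet_derivative (transition M i j) (at x) (v i)) (at (chart M i p)) a
    + dtrans M i j p b)"
proof -
  have ij: "i \<in> idx M" "j \<in> idx M" using assms by (auto simp: charts_at_iff)
  let ?S = "chart M i ` (cdom M i \<inter> cdom M j)" and ?f = "transition M i j"
  let ?x = "chart M i p" and ?y = "v i"
  have S: "open ?S" "open (?S \<times> (UNIV :: 'e set))" "?x \<in> ?S" "(?x, ?y) \<in> ?S \<times> UNIV"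
    using open_overlap[OF ij] assms by (auto simp: open_Times charts_at_iff)
  note f = smooth_transition[OF ij]
  let ?F = "\<lambda>z. (?f (fst z), frechet_derivative ?f (at (fst z)) (snd z))"
  have "dtrans (tangent_bundle M) i j (p, v) = frechet_derivative ?F (at (?x, ?y))"
    unfolding dtrans_def
    using frechet_derivative_cong_open[OF S(2,4), of "transition (tangent_bundle M) i j" ?F]
      transition_bundle[OF ij] by auto
  also have "(?F has_derivative (\<lambda>w. (frechet_derivative (\<lambda>z. ?f (fst z)) (at (?x, ?y)) w,
      frechet_derivative (\<lambda>z. frechet_derivative ?f (at (fst z)) (snd z)) (at (?x, ?y)) w))) (at
          (?x, ?y))"
    by (intro has_derivative_Pair smooth_on_has_derivative[OF S(2) _ S(4)]
        transition_bundle_calculus(1)[OF S(1)] smooth_on_fst_compose[OF S(1)] f)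
  then have "frechet_derivative ?F (at (?x, ?y))
      = (\<lambda>w. (frechet_derivative (\<lambda>z. ?f (fst z)) (at (?x, ?y)) w,
      frechet_derivative (\<lambda>z. frechet_derivative ?f (at (fst z)) (snd z)) (at (?x, ?y)) w))"
    by (rule frechet_derivative_at[symmetric])
  finally show ?thesis
    using frechet_derivative_fst[of ?f "(?x, ?y)"] smooth_on_differentiable[OF S(1) f S(3)]
      transition_bundle_calculus(2)[OF S(1) f S(3)]
    by (simp add: dtrans_def add.commute)
qed

lemma mopen_bundle_over:
  assumes "mopen M U"
  shows "mopen (tangent_bundle M) (bundle_over M U)"
  unfolding mopen_def
proof (intro conjI ballI)
  show "bundle_over M U \<subseteq> carrier_of (tangent_bundle M)"
    using mopen_carrier[OF assms] by (auto simp: carrier_bundle)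
  fix i assume "i \<in> idx (tangent_bundle M)"
  then show "open (chart (tangent_bundle M) i ` (bundle_over M U \<inter> cdom (tangent_bundle M) i))"
    using mopen_imp_open[OF assms] by (subst chart_bundle_image) (auto simp: open_Times)
qed

lemma smooth_fun_bundle:
  assumes U: "mopen M U" and f: "smooth_fun M U f"
  shows "smooth_fun (tangent_bundle M) (bundle_over M U) (\<lambda>\<xi>. f (fst \<xi>))"
  unfolding smooth_fun_def
proof
  fix i assume "i \<in> idx (tangent_bundle M)"
  then have i: "i \<in> idx M" by simp
  show "smooth_on (chart (tangent_bundle M) i ` (bundle_over M U \<inter> cdom (tangent_bundle M) i))
      ((\<lambda>\<xi>. f (fst \<xi>)) \<circ> param (tangent_bundle M) i)"
    unfolding chart_bundle_image[OF i]
    by (rule smooth_on_cong[OF _ smooth_on_fst_compose[OF mopen_imp_open[OF U i] smooth_funD[OF f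
        i]]])
      (use mopen_imp_open[OF U i] i in \<open>auto simp: open_Times param_bundle\<close>)
qed

end

section \<open>Horizontal and vertical lifts\<close>

lemma hlift_apply:
  "i \<in> charts_at M p \<Longrightarrow> hlift M nab X (p, v) i = (X p i, - christoffel M nab i p (X p i) (v i))"
  "i \<notin> charts_at M p \<Longrightarrow> hlift M nab X (p, v) i = 0"
  by (simp_all add: hlift_def)

lemma vlift_apply:
  "i \<in> charts_at M p \<Longrightarrow> vlift M X (p, v) i = (0, X p i)"
  "i \<notin> charts_at M p \<Longrightarrow> vlift M X (p, v) i = 0"
  by (simp_all add: vlift_def)

lemma hlift_cong: "X (fst \<xi>) = Y (fst \<xi>) \<Longrightarrow> hlift M nab X \<xi> = hlift M nab Y \<xi>"
  by (cases \<xi>) (simp add: hlift_def cong: if_cong)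

lemma vlift_cong: "X (fst \<xi>) = Y (fst \<xi>) \<Longrightarrow> vlift M X \<xi> = vlift M Y \<xi>"
  by (cases \<xi>) (simp add: vlift_def cong: if_cong)

lemma vlift_add: "Z (fst \<xi>) = X (fst \<xi>) + Y (fst \<xi>) \<Longrightarrow> vlift M Z \<xi> = vlift M X \<xi> + vlift M Y \<xi>"
  by (cases \<xi>) (auto simp: vlift_def fun_eq_iff)

lemma vlift_scale: "Z (fst \<xi>) = a \<cdot> X (fst \<xi>) \<Longrightarrow> vlift M Z \<xi> = a \<cdot> vlift M X \<xi>"
  by (cases \<xi>) (auto simp: vlift_def fun_eq_iff)

lemma vlift_zero: "X (fst \<xi>) = 0 \<Longrightarrow> vlift M X \<xi> = 0"
  by (cases \<xi>) (auto simp: vlift_def fun_eq_iff zero_prod_def)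

lemma vlift_sum: "X (fst \<xi>) = (\<Sum>k\<in>K. Y k (fst \<xi>)) \<Longrightarrow> vlift M X \<xi> = (\<Sum>k\<in>K. vlift M (Y k) \<xi>)"
proof (induction K arbitrary: X rule: infinite_finite_induct)
  case (insert k K)
  have "vlift M X \<xi> = vlift M (Y k) \<xi> + vlift M (\<lambda>q. \<Sum>k\<in>K. Y k q) \<xi>"
    by (rule vlift_add) (simp add: insert del: sum_fun_apply plus_fun_apply)
  then show ?case
    using insert by (simp del: sum_fun_apply plus_fun_apply)
qed (auto intro!: vlift_zero)

locale flat_atlas = torsion_free_atlas M nab
  for M :: "('i, 'm, 'e::euclidean_space) atlas" and nab +
  assumes flat: "flat M nab"
begin

sublocale TB: smooth_atlas "tangent_bundle M"
  by (rule smooth_atlas_bundle)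

abbreviation TM where "TM \<equiv> tangent_bundle M"

lemma hlift_add:
  assumes "Z (fst \<xi>) = X (fst \<xi>) + Y (fst \<xi>)"
  shows "hlift M nab Z \<xi> = hlift M nab X \<xi> + hlift M nab Y \<xi>"
  using assms by (cases \<xi>) (auto simp: hlift_def fun_eq_iff T.christoffel_add_left charts_at_iff)

lemma hlift_scale:
  assumes "Z (fst \<xi>) = a \<cdot> X (fst \<xi>)"
  shows "hlift M nab Z \<xi> = a \<cdot> hlift M nab X \<xi>"
  using assms by (cases \<xi>) (auto simp: hlift_def fun_eq_iff T.christoffel_scale_left charts_at_iff)

lemma hlift_zero: "X (fst \<xi>) = 0 \<Longrightarrow> hlift M nab X \<xi> = 0"
  using hlift_scale[of X \<xi> 0 X] by simp

lemma hlift_sum: "X (fst \<xi>) = (\<Sum>k\<in>K. Y k (fst \<xi>)) \<Longrightarrow> hlift M nab X \<xi> = (\<Sum>k\<in>K. hlift M nab (Y k) \<xi>)"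
proof (induction K arbitrary: X rule: infinite_finite_induct)
  case (insert k K)
  have "hlift M nab X \<xi> = hlift M nab (Y k) \<xi> + hlift M nab (\<lambda>q. \<Sum>k\<in>K. Y k q) \<xi>"
    by (rule hlift_add) (simp add: insert del: sum_fun_apply plus_fun_apply)
  then show ?case
    using insert by (simp del: sum_fun_apply plus_fun_apply)
qed (auto intro!: hlift_zero)

text \<open>The coordinate fields of chart \<open>i\<close> are differentiated in chart
  \<open>j\<close>, where their components are derivatives of the transition; differentiating these
  yields the inhomogeneous term.\<close>

lemma christoffel_transform:
  assumes i: "i \<in> charts_at M p" and j: "j \<in> charts_at M p"
  shows "dtrans M i j p (christoffel M nab i p a y)
    = frechet_derivative (\<lambda>x. frechet_derivative (transition M i j) (at x) y) (at (chart M i p)) a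
      + christoffel M nab j p (dtrans M i j p a) (dtrans M i j p y)"
proof -
  have ij: "i \<in> idx M" "p \<in> cdom M i" "j \<in> idx M" "p \<in> cdom M j"
    using i j by (auto simp: charts_at_iff)
  let ?U = "cdom M i" and ?S = "chart M i ` (cdom M i \<inter> cdom M j)"
  have U: "mopen M ?U" by (rule mopen_cdom[OF ij(1)])
  note c = T.const_field_on_cdom[OF ij(1)]
  let ?F = "\<lambda>x. frechet_derivative (transition M i j) (at x) y"
  have F: "(?F has_derivative frechet_derivative ?F (at (chart M i p))) (at (transition M j i
      (chart M j p)))"
    using smooth_on_has_derivative[OF open_overlap[OF ij(1,3)] smooth_on_frechet[OF
        smooth_transition[OF ij(1,3)]]] ij
    by simp
  have "((\<lambda>x. const_field M i y (param M j x) j) has_derivative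
      frechet_derivative ?F (at (chart M i p)) \<circ> dtrans M j i p) (at (chart M j p))"
    by (rule has_derivative_transform_within_open[OF diff_chain_at[OF has_derivative_transition[OF
        j i] F]
          open_overlap[OF ij(3,1)]])
      (use ij in \<open>auto simp: const_field_def charts_at_iff dtrans_def\<close>)
  then have "frechet_derivative (\<lambda>x. const_field M i y (param M j x) j) (at (chart M j p))
      = frechet_derivative ?F (at (chart M i p)) \<circ> dtrans M j i p"
    by (rule frechet_derivative_at[symmetric])
  moreover have "const_field M i a p j = dtrans M i j p a" for a
    using i j by (simp add: const_field_def)
  ultimately have "nab (const_field M i a) (const_field M i y) p j
      = frechet_derivative ?F (at (chart M i p)) a + christoffel M nab j p (dtrans M i j p a)
          (dtrans M i j p y)"
    using T.connection_in_chart[OF U ij(2) j c[OF ij(2)] c[OF ij(2)], of a y] i j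
    by (simp add: dtrans_comp dtrans_self)
  moreover have "dtrans M i j p (christoffel M nab i p a y)
      = nab (const_field M i a) (const_field M i y) p j"
    unfolding christoffel_def
    by (rule tangent_transform[OF vector_field_tangent[OF T.connection_vector_field[OF U c[OF
        ij(2)] c[OF ij(2)]] ij(2)] i j])
  ultimately show ?thesis by simp
qed

text \<open>The second derivative in \<open>dtrans_bundle\<close> cancels the one in
  \<open>christoffel_transform\<close>, because the fibre component of the lift carries a minus
  sign.\<close>

lemma hlift_tangent:
  assumes "X p \<in> tangent_space M p" "v \<in> tangent_space M p"
  shows "hlift M nab X (p, v) \<in> tangent_space TM (p, v)"
proof (rule TB.tangentI)
  fix i j assume "i \<in> charts_at TM (p, v)" "j \<in> charts_at TM (p, v)"
  then have ij: "i \<in> charts_at M p" "j \<in> charts_at M p" using assms by simp_all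
  show "dtrans TM i j (p, v) (hlift M nab X (p, v) i) = hlift M nab X (p, v) j"
    using christoffel_transform[OF ij, of "X p i" "v i"] tangent_transform[OF assms(1) ij]
      tangent_transform[OF assms(2) ij]
    by (simp add: hlift_apply ij dtrans_bundle[OF ij assms(2)] linear_neg[OF linear_dtrans[OF ij]])
qed (use assms in \<open>simp add: hlift_apply\<close>)

lemma vlift_tangent:
  assumes "X p \<in> tangent_space M p" "v \<in> tangent_space M p"
  shows "vlift M X (p, v) \<in> tangent_space TM (p, v)"
proof (rule TB.tangentI)
  fix i j assume "i \<in> charts_at TM (p, v)" "j \<in> charts_at TM (p, v)"
  then have ij: "i \<in> charts_at M p" "j \<in> charts_at M p" using assms by simp_all
  have "frechet_derivative (\<lambda>x. frechet_derivative (transition M i j) (at x) (v i)) (at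
      (chart M i p)) 0 = 0"
    using smooth_on_differentiable[OF open_overlap smooth_on_frechet[OF smooth_transition], of i j
        _ "v i"] ij
    by (intro linear_0 linear_frechet_derivative) (auto simp: charts_at_iff)
  then show "dtrans TM i j (p, v) (vlift M X (p, v) i) = vlift M X (p, v) j"
    using tangent_transform[OF assms(1) ij]
    by (simp add: vlift_apply ij dtrans_bundle[OF ij assms(2)] linear_0[OF linear_dtrans[OF ij]])
qed (use assms in \<open>simp add: vlift_apply\<close>)

lemma smooth_on_christoffel:
  assumes "i \<in> idx M"
  shows "smooth_on (chart M i ` cdom M i) (\<lambda>x. christoffel M nab i (param M i x) a b)"
proof -
  note U = mopen_cdom[OF assms]
  have c: "vector_field M (cdom M i) (const_field M i a)" for a
    by (rule vector_field_const_field[OF U order_refl assms])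
  show ?thesis
    using vector_field_smooth[OF T.connection_vector_field[OF U c[of a] c[of b]] assms]
    by (simp add: christoffel_def)
qed

lemma vector_field_hlift:
  assumes U: "mopen M U" and X: "vector_field M U X"
  shows "vector_field TM (bundle_over M U) (hlift M nab X)"
proof (rule TB.vector_fieldI)
  fix \<xi> assume "\<xi> \<in> bundle_over M U"
  then show "hlift M nab X \<xi> \<in> tangent_space TM \<xi>"
    using vector_field_tangent[OF X] by (cases \<xi>) (auto intro: hlift_tangent)
next
  fix i assume "i \<in> idx TM"
  then have i: "i \<in> idx M" by simp
  let ?S = "chart M i ` (U \<inter> cdom M i)" and ?X = "\<lambda>x. X (param M i x) i"
  let ?\<Gamma> = "\<lambda>x. christoffel M nab i (param M i x)"
  have S: "open ?S" "open (?S \<times> (UNIV :: 'e set))"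
    using mopen_imp_open[OF U i] by (auto simp: open_Times)
  note sX = vector_field_smooth[OF X i]
  have s\<Gamma>: "smooth_on ?S (\<lambda>x. ?\<Gamma> x a b)" for a b
    by (rule smooth_on_subset[OF smooth_on_christoffel[OF i]]) auto
  \<comment> \<open>Smoothness of the Christoffel symbol is known for fixed arguments, hence the
    bilinear expansion over \<open>Basis\<close> in both.\<close>
  have "smooth_on (?S \<times> UNIV) (\<lambda>z. (?X (fst z), - (\<Sum>c\<in>Basis. \<Sum>d\<in>Basis.
      ((?X (fst z) \<bullet> c) * (snd z \<bullet> d)) *\<^sub>R ?\<Gamma> (fst z) c d)))"
    by (intro smooth_on_Pair smooth_on_uminus smooth_on_sum smooth_on_scaleR smooth_on_mult
        smooth_on_inner_left smooth_on_fst_compose smooth_on_snd S sX s\<Gamma>)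
  then show "smooth_on (chart TM i ` (bundle_over M U \<inter> cdom TM i)) (\<lambda>x. hlift M nab X
      (param TM i x) i)"
    unfolding chart_bundle_image[OF i]
  proof (rule smooth_on_cong[OF S(2)])
    fix z assume "z \<in> ?S \<times> (UNIV :: 'e set)"
    then obtain p y where p: "p \<in> U" "p \<in> cdom M i" and z: "z = (chart M i p, y)" by auto
    have ch: "i \<in> charts_at M p" using p i by (simp add: charts_at_iff)
    show "(?X (fst z), - (\<Sum>c\<in>Basis. \<Sum>d\<in>Basis. ((?X (fst z) \<bullet> c) * (snd z \<bullet> d)) *\<^sub>R ?\<Gamma> (fst z) c d))
        = hlift M nab X (param TM i z) i"
      using T.christoffel_expand[OF i p(2), of "X p i" y]
      by (simp add: z param_bundle i p hlift_apply ch const_field_apply)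
  qed
qed

lemma vector_field_vlift:
  assumes U: "mopen M U" and X: "vector_field M U X"
  shows "vector_field TM (bundle_over M U) (vlift M X)"
proof (rule TB.vector_fieldI)
  fix \<xi> assume "\<xi> \<in> bundle_over M U"
  then show "vlift M X \<xi> \<in> tangent_space TM \<xi>"
    using vector_field_tangent[OF X] by (cases \<xi>) (auto intro: vlift_tangent)
next
  fix i assume "i \<in> idx TM"
  then have i: "i \<in> idx M" by simp
  let ?S = "chart M i ` (U \<inter> cdom M i)"
  have S: "open ?S" "open (?S \<times> (UNIV :: 'e set))"
    using mopen_imp_open[OF U i] by (auto simp: open_Times)
  have "smooth_on (?S \<times> UNIV) (\<lambda>z :: 'e \<times> 'e. (0 :: 'e, X (param M i (fst z)) i))"
    by (intro smooth_on_Pair smooth_on_const smooth_on_fst_compose S vector_field_smooth[OF X i])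
  then show "smooth_on (chart TM i ` (bundle_over M U \<inter> cdom TM i)) (\<lambda>x. vlift M X
      (param TM i x) i)"
    unfolding chart_bundle_image[OF i]
    by (rule smooth_on_cong[OF S(2)])
      (use i in \<open>auto simp: param_bundle vlift_apply charts_at_iff\<close>)
qed

text \<open>The lifts project to \<open>X\<close> and to \<open>0\<close>, so a function pulled back
  from the base is differentiated along these.\<close>

lemma dir_deriv_lift:
  assumes U: "mopen M U" "p \<in> U" and v: "v \<in> tangent_space M p" and X: "X p \<in> tangent_space M p"
    and f: "smooth_fun M U f"
  shows "dir_deriv TM (hlift M nab X) (\<lambda>\<xi>. f (fst \<xi>)) (p, v) = dir_deriv M X f p"
    and "dir_deriv TM (vlift M X) (\<lambda>\<xi>. f (fst \<xi>)) (p, v) = 0"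
proof -
  obtain i where i: "i \<in> charts_at M p"
    using carrier_chart mopen_carrier U by blast
  have i': "i \<in> idx M" "i \<in> charts_at TM (p, v)" using i v by (auto simp: charts_at_iff)
  have \<xi>: "mopen TM (bundle_over M U)" "(p, v) \<in> bundle_over M U"
    using U v by (auto intro: mopen_bundle_over)
  note sf = smooth_fun_bundle[OF U(1) f]
  let ?F = "\<lambda>x. f (param M i x)" and ?S = "chart M i ` (U \<inter> cdom M i)"
  have S: "open (?S \<times> (UNIV :: 'e set))" "(chart M i p, v i) \<in> ?S \<times> UNIV"
    using mopen_imp_open[OF U(1) i'(1)] U i by (auto simp: open_Times charts_at_iff)
  have "frechet_derivative (\<lambda>z. f (fst (param TM i z))) (at (chart TM i (p, v))) w
      = frechet_derivative (\<lambda>z :: 'e \<times> 'e. ?F (fst z)) (at (chart M i p, v i)) w" for w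
  proof -
    have "f (fst (param TM i z)) = ?F (fst z)" if "z \<in> ?S \<times> (UNIV :: 'e set)" for z
      using that i' by (auto simp: param_bundle)
    then show ?thesis
      using frechet_derivative_cong_open[OF S, of "\<lambda>z. f (fst (param TM i z))" "\<lambda>z. ?F
          (fst z)"] by simp
  qed
  also have "\<dots> w = frechet_derivative ?F (at (chart M i p)) (fst w)" for w
    using frechet_derivative_fst[of ?F "(chart M i p, v i)" w]
      differentiableI[OF smooth_fun_has_derivative[OF U f i]] by simp
  finally have D: "frechet_derivative (\<lambda>z. f (fst (param TM i z))) (at (chart TM i (p, v))) w
      = frechet_derivative ?F (at (chart M i p)) (fst w)" for w .
  show "dir_deriv TM (hlift M nab X) (\<lambda>\<xi>. f (fst \<xi>)) (p, v) = dir_deriv M X f p"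
    using TB.dir_deriv_chart[where X = "hlift M nab X", OF \<xi> sf hlift_tangent[of X p v, OF X v]
        i'(2)] dir_deriv_chart[where X = X, OF U f X i] D i
    by (simp add: hlift_apply)
  show "dir_deriv TM (vlift M X) (\<lambda>\<xi>. f (fst \<xi>)) (p, v) = 0"
    using TB.dir_deriv_chart[where X = "vlift M X", OF \<xi> sf vlift_tangent[of X p v, OF X v] i'(2)]
        D i
      linear_0[OF has_derivative_linear[OF smooth_fun_has_derivative[OF U f i]]]
    by (simp add: vlift_apply)
qed

lemma lift_decompose:
  assumes w: "w \<in> tangent_space TM (p, v)" and v: "v \<in> tangent_space M p" and i: "i \<in> charts_at M p"
  shows "\<exists>a b. w = hlift M nab (const_field M i a) (p, v) + vlift M (const_field M i b) (p, v)"
proof (intro exI)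
  \<comment> \<open>The horizontal lift with base component \<open>?a\<close> has minus the
    Christoffel symbol as fibre component, so the vertical part has to add it back.\<close>
  let ?a = "fst (w i)" let ?b = "snd (w i) + christoffel M nab i p ?a (v i)"
  show "w = hlift M nab (const_field M i ?a) (p, v) + vlift M (const_field M i ?b) (p, v)"
    by (rule TB.tangent_eqI[OF w, where i = i])
      (use v i in \<open>auto intro!: TB.tangent_add hlift_tangent vlift_tangent
        simp: hlift_apply vlift_apply const_field_apply prod_eq_iff\<close>)
qed

section \<open>Brackets of lifted coordinate fields\<close>

context
  fixes i p v
  assumes i: "i \<in> idx M" "p \<in> cdom M i" and v: "v \<in> tangent_space M p"
begin

private lemma i_chart: "i \<in> charts_at M p"
  using i by (simp add: charts_at_iff)

private lemma S_open: "open (chart M i ` cdom M i)" "open (chart M i ` cdom M i \<times> (UNIV :: 'e set))"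
    "(chart M i p, v i) \<in> chart M i ` cdom M i \<times> UNIV" "chart M i p \<in> chart M i ` cdom M i"
  using open_overlap[OF i(1) i(1)] i by (auto simp: open_Times)

text \<open>The fibre component is linear in the fibre coordinate: its fibre derivative is the
  Christoffel symbol again, and only the base direction differentiates the coefficients.\<close>

lemma has_derivative_hlift_const:
  "((\<lambda>z. hlift M nab (const_field M i a) (param TM i z) i) has_derivative
     (\<lambda>w. (0, - (frechet_derivative (\<lambda>x. christoffel M nab i (param M i x) a (v i)) (at
         (chart M i p)) (fst w)
        + christoffel M nab i p a (snd w))))) (at (chart M i p, v i))"
proof -
  let ?\<Gamma> = "\<lambda>x. christoffel M nab i (param M i x)" and ?x = "chart M i p"
  have expand: "?\<Gamma> x a y = (\<Sum>d\<in>Basis. (y \<bullet> d) *\<^sub>R ?\<Gamma> x a d)" if "x \<in> chart M i ` cdom M i" for x y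
  proof -
    from that obtain q where q: "q \<in> cdom M i" "x = chart M i q" by blast
    have "christoffel M nab i q a y = christoffel M nab i q a (\<Sum>d\<in>Basis. (y \<bullet> d) *\<^sub>R d)"
      by (simp add: euclidean_representation)
    also have "\<dots> = (\<Sum>d\<in>Basis. (y \<bullet> d) *\<^sub>R christoffel M nab i q a d)"
      using i q by (simp add: linear_sum[OF T.linear_christoffel_right] T.christoffel_scale_right)
    finally show ?thesis using q i by simp
  qed
  note D = smooth_on_has_derivative[OF S_open(1) smooth_on_christoffel[OF i(1)] S_open(4)]
  have D1: "((\<lambda>z :: 'e \<times> 'e. ?\<Gamma> (fst z) a d) has_derivative
      (\<lambda>w. frechet_derivative (\<lambda>x. ?\<Gamma> x a d) (at ?x) (fst w))) (at (?x, v i))" for d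
    using diff_chain_at[OF has_derivative_fst[OF has_derivative_ident[of "at (?x, v i)"]], of
        "\<lambda>x. ?\<Gamma> x a d"]
      D[of a d] by (simp add: o_def)
  have "((\<lambda>z. \<Sum>d\<in>Basis. (snd z \<bullet> d) *\<^sub>R ?\<Gamma> (fst z) a d) has_derivative
      (\<lambda>w. \<Sum>d\<in>Basis. (snd (?x, v i) \<bullet> d) *\<^sub>R frechet_derivative (\<lambda>x. ?\<Gamma> x a d) (at ?x) (fst w)
        + (snd w \<bullet> d) *\<^sub>R ?\<Gamma> (fst (?x, v i)) a d)) (at (?x, v i))"
    by (intro has_derivative_sum has_derivative_scaleR has_derivative_inner_left has_derivative_snd
        has_derivative_ident D1)
  moreover have "(\<Sum>d\<in>Basis. (snd (?x, v i) \<bullet> d) *\<^sub>R frechet_derivative (\<lambda>x. ?\<Gamma> x a d) (at ?x) (fst w)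
        + (snd w \<bullet> d) *\<^sub>R ?\<Gamma> (fst (?x, v i)) a d)
      = frechet_derivative (\<lambda>x. ?\<Gamma> x a (v i)) (at ?x) (fst w) + christoffel M nab i p a
          (snd w)" for w
  proof -
    have "((\<lambda>x. \<Sum>d\<in>Basis. (v i \<bullet> d) *\<^sub>R ?\<Gamma> x a d) has_derivative
        (\<lambda>u. \<Sum>d\<in>Basis. (v i \<bullet> d) *\<^sub>R frechet_derivative (\<lambda>x. ?\<Gamma> x a d) (at ?x) u)) (at ?x)"
      by (intro has_derivative_sum has_derivative_scaleR_right D)
    then have "((\<lambda>x. ?\<Gamma> x a (v i)) has_derivative
        (\<lambda>u. \<Sum>d\<in>Basis. (v i \<bullet> d) *\<^sub>R frechet_derivative (\<lambda>x. ?\<Gamma> x a d) (at ?x) u)) (at ?x)"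
      by (rule has_derivative_transform_within_open[OF _ S_open(1,4)]) (simp add: expand[symmetric])
    then have "frechet_derivative (\<lambda>x. ?\<Gamma> x a (v i)) (at ?x)
        = (\<lambda>u. \<Sum>d\<in>Basis. (v i \<bullet> d) *\<^sub>R frechet_derivative (\<lambda>x. ?\<Gamma> x a d) (at ?x) u)"
      by (rule frechet_derivative_at[symmetric])
    then show ?thesis
      using expand[OF S_open(4), of "snd w"] i by (simp add: sum.distrib)
  qed
  ultimately have "((\<lambda>z. \<Sum>d\<in>Basis. (snd z \<bullet> d) *\<^sub>R ?\<Gamma> (fst z) a d) has_derivative
      (\<lambda>w. frechet_derivative (\<lambda>x. ?\<Gamma> x a (v i)) (at ?x) (fst w) + christoffel M nab i p a (snd w)))
      (at (?x, v i))"
    by simp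
  then have "((\<lambda>z. (a, - (\<Sum>d\<in>Basis. (snd z \<bullet> d) *\<^sub>R ?\<Gamma> (fst z) a d))) has_derivative
     (\<lambda>w. (0, - (frechet_derivative (\<lambda>x. ?\<Gamma> x a (v i)) (at ?x) (fst w) + christoffel M nab i p a
         (snd w)))))
     (at (?x, v i))"
    by (intro has_derivative_Pair has_derivative_const has_derivative_minus)
  then have "((\<lambda>z. hlift M nab (const_field M i a) (param TM i z) i) has_derivative
     (\<lambda>w. (0, - (frechet_derivative (\<lambda>x. ?\<Gamma> x a (v i)) (at ?x) (fst w) + christoffel M nab i p a
         (snd w)))))
     (at (?x, v i))"
  proof (rule has_derivative_transform_within_open[OF _ S_open(2,3)])
    fix z assume "z \<in> chart M i ` cdom M i \<times> (UNIV :: 'e set)"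
    then obtain q y where q: "q \<in> cdom M i" "z = (chart M i q, y)" by auto
    then show "(a, - (\<Sum>d\<in>Basis. (snd z \<bullet> d) *\<^sub>R ?\<Gamma> (fst z) a d))
        = hlift M nab (const_field M i a) (param TM i z) i"
      using i expand[of "chart M i q" y]
      by (simp add: param_bundle hlift_apply charts_at_iff const_field_apply)
  qed
  then show ?thesis by simp
qed

lemma has_derivative_vlift_const:
  "((\<lambda>z. vlift M (const_field M i a) (param TM i z) i) has_derivative (\<lambda>w. 0)) (at
      (chart M i p, v i))"
proof -
  have "((\<lambda>z. vlift M (const_field M i a) (param TM i z) i) has_derivative (\<lambda>w. 0)) (at
      (chart M i p, v i))"
    by (rule has_derivative_transform_within_open[OF has_derivative_const[of "(0, a)"] S_open(2,3)])
      (use i in \<open>auto simp: param_bundle vlift_apply charts_at_iff const_field_apply\<close>)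
  then show ?thesis by simp
qed

private lemma bundle_chart: "i \<in> charts_at TM (p, v)"
  using i_chart v by simp

lemma lie_bracket_const: "q \<in> cdom M i \<Longrightarrow> lie_bracket M (const_field M i a) (const_field M i b) q
    = 0"
proof -
  assume q: "q \<in> cdom M i"
  note U = mopen_cdom[OF i(1)] and c = T.const_field_on_cdom[OF i]
  have ch: "i \<in> charts_at M q" using q i by (simp add: charts_at_iff)
  have D: "frechet_derivative (\<lambda>x. const_field M i a (param M i x) i) (at (chart M i q))
      = (\<lambda>w. 0)" for a
  proof -
    have "((\<lambda>x. const_field M i a (param M i x) i) has_derivative (\<lambda>w. 0)) (at (chart M i q))"
      by (rule has_derivative_transform_within_open[OF has_derivative_const[of a] S_open(1)])
        (use i q in \<open>auto simp: charts_at_iff const_field_apply\<close>)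
    then show ?thesis by (rule frechet_derivative_at[symmetric])
  qed
  show ?thesis
    by (rule tangent_eqI[OF vector_field_tangent[OF vector_field_lie_bracket[OF U c c] q]
        tangent_zero ch])
      (simp add: lie_bracket_apply[OF ch] D)
qed

text \<open>Vanishing of the curvature on coordinate fields, whose brackets are zero, written in
  components.\<close>

lemma christoffel_flat:
  "frechet_derivative (\<lambda>x. christoffel M nab i (param M i x) b y) (at (chart M i p)) a
    + christoffel M nab i p a (christoffel M nab i p b y)
   = frechet_derivative (\<lambda>x. christoffel M nab i (param M i x) a y) (at (chart M i p)) b
    + christoffel M nab i p b (christoffel M nab i p a y)"
proof -
  note U = mopen_cdom[OF i(1)] and c = T.const_field_on_cdom[OF i]
  let ?c = "const_field M i"
  have second: "nab (?c a) (nab (?c b) (?c y)) p i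
      = frechet_derivative (\<lambda>x. christoffel M nab i (param M i x) b y) (at (chart M i p)) a
        + christoffel M nab i p a (christoffel M nab i p b y)" for a b
    using T.connection_in_chart[OF U i(2) i_chart c T.connection_vector_field[OF U c c]]
    by (simp add: christoffel_def const_field_apply[OF i_chart])
  have "nab (lie_bracket M (?c a) (?c b)) (?c y) p = nab 0 (?c y) p"
    using lie_bracket_const i
    by (intro T.connection_cong[OF U] vector_field_lie_bracket[OF U] c vector_field_zero[OF U]) auto
  also have "\<dots> = 0" by (rule T.connection_zero_left[OF U c i(2)])
  finally have "nab (lie_bracket M (?c a) (?c b)) (?c y) p i = 0" by simp
  moreover have "curvature M nab (?c a) (?c b) (?c y) p i = 0"
    using flat U c i unfolding flat_def by (metis zero_fun_apply)
  ultimately have "nab (?c a) (nab (?c b) (?c y)) p i = nab (?c b) (nab (?c a) (?c y)) p i"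
    by (simp add: curvature_def algebra_simps)
  then show ?thesis
    by (simp add: second)
qed

text \<open>The bracket of two horizontal lifts has the curvature of \<open>nab\<close> as fibre
  component, which is where flatness enters. Vertical lifts have constant components, so only the
  fibre derivative of the horizontal lift survives in the mixed bracket.\<close>

lemma lie_bracket_lifts:
  "lie_bracket TM (hlift M nab (const_field M i a)) (hlift M nab (const_field M i b)) (p, v) i = 0"
  "lie_bracket TM (vlift M (const_field M i a)) (vlift M (const_field M i b)) (p, v) i = 0"
  "lie_bracket TM (hlift M nab (const_field M i a)) (vlift M (const_field M i b)) (p, v) i
    = (0, christoffel M nab i p a b)"
proof -
  note D = frechet_derivative_at[OF has_derivative_hlift_const, symmetric]
    frechet_derivative_at[OF has_derivative_vlift_const, symmetric]
  have neg: "christoffel M nab i p c (- d) = - christoffel M nab i p c d" for c d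
    by (rule linear_neg[OF T.linear_christoffel_right[OF i]])
  have zero: "linear (frechet_derivative (\<lambda>x. christoffel M nab i (param M i x) a (v i)) (at
      (chart M i p)))" for a
    using has_derivative_linear[OF smooth_on_has_derivative[OF S_open(1) smooth_on_christoffel[OF
        i(1)] S_open(4)]] .
  note simps = TB.lie_bracket_apply[OF bundle_chart] D hlift_apply(1)[OF i_chart] vlift_apply(1)[OF
      i_chart]
    const_field_apply[OF i_chart] neg linear_0[OF zero]
  show "lie_bracket TM (hlift M nab (const_field M i a)) (hlift M nab (const_field M i b))
      (p, v) i = 0"
    using christoffel_flat[of b "v i" a] by (simp add: simps zero_prod_def algebra_simps)
  show "lie_bracket TM (vlift M (const_field M i a)) (vlift M (const_field M i b)) (p, v) i = 0"
    by (simp add: simps)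
  show "lie_bracket TM (hlift M nab (const_field M i a)) (vlift M (const_field M i b)) (p, v) i
    = (0, christoffel M nab i p a b)"
    by (simp add: simps)
qed

end

text \<open>Lift of a single tangent vector. A lift reads its field only at the base point, so a
  constant function can stand in for the field, and lifts become linear expressions in
  vectors.\<close>

definition hor :: "'m \<times> ('i \<Rightarrow> 'e) \<Rightarrow> ('i \<Rightarrow> 'e) \<Rightarrow> 'i \<Rightarrow> 'e \<times> 'e" where
  "hor \<xi> u = hlift M nab (\<lambda>_. u) \<xi>"

definition ver :: "'m \<times> ('i \<Rightarrow> 'e) \<Rightarrow> ('i \<Rightarrow> 'e) \<Rightarrow> 'i \<Rightarrow> 'e \<times> 'e" where
  "ver \<xi> u = vlift M (\<lambda>_. u) \<xi>"

lemma hlift_eq_hor: "hlift M nab X \<xi> = hor \<xi> (X (fst \<xi>))"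
  and vlift_eq_ver: "vlift M X \<xi> = ver \<xi> (X (fst \<xi>))"
  unfolding hor_def ver_def by (rule hlift_cong, simp, rule vlift_cong, simp)

lemma hor_add: "hor \<xi> (u + w) = hor \<xi> u + hor \<xi> w" and ver_add: "ver \<xi> (u + w) = ver \<xi> u + ver \<xi> w"
  unfolding hor_def ver_def by (rule hlift_add, simp, rule vlift_add, simp)

lemma hor_scale: "hor \<xi> (a \<cdot> u) = a \<cdot> hor \<xi> u" and ver_scale: "ver \<xi> (a \<cdot> u) = a \<cdot> ver \<xi> u"
  unfolding hor_def ver_def by (rule hlift_scale, rule refl, rule vlift_scale, rule refl)

lemma hor_zero: "hor \<xi> 0 = 0" and ver_zero: "ver \<xi> 0 = 0"
  unfolding hor_def ver_def by (rule hlift_zero, rule refl, rule vlift_zero, rule refl)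

lemma hor_sum: "hor \<xi> (\<Sum>k\<in>K. u k) = (\<Sum>k\<in>K. hor \<xi> (u k))"
  and ver_sum: "ver \<xi> (\<Sum>k\<in>K. u k) = (\<Sum>k\<in>K. ver \<xi> (u k))"
  unfolding hor_def ver_def by (rule hlift_sum, rule refl, rule vlift_sum, rule refl)

lemma hor_uminus: "hor \<xi> (- u) = - hor \<xi> u" and ver_uminus: "ver \<xi> (- u) = - ver \<xi> u"
  using hor_scale[of \<xi> "- 1" u] ver_scale[of \<xi> "- 1" u] by simp_all

lemma hor_diff: "hor \<xi> (u - w) = hor \<xi> u - hor \<xi> w" and ver_diff: "ver \<xi> (u - w)
    = ver \<xi> u - ver \<xi> w"
  using hor_add[of \<xi> u "- w"] ver_add[of \<xi> u "- w"] by (simp_all add: hor_uminus ver_uminus)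

lemma hor_tangent: "u \<in> tangent_space M p \<Longrightarrow> v \<in> tangent_space M p \<Longrightarrow>
    hor (p, v) u \<in> tangent_space TM (p, v)"
  and ver_tangent: "u \<in> tangent_space M p \<Longrightarrow> v \<in> tangent_space M p \<Longrightarrow>
      ver (p, v) u \<in> tangent_space TM (p, v)"
  unfolding hor_def ver_def by (rule hlift_tangent, assumption+, rule vlift_tangent, assumption+)

end

section \<open>The Chern connection of the canonical Hermitian structure\<close>

text \<open>\<open>LC\<close> is the Levi-Civita connection whose existence is part of
  \<open>chern_connection\<close>, fixed here so that the Koszul formula can be applied to
  it.\<close>

locale chern_bundle = affine_riemann_adjoint M nab D \<gamma>\<^sub>s g
  for M :: "('i, 'm, 'e::euclidean_space) atlas" and nab D \<gamma>\<^sub>s g +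
  fixes J\<^sub>1 :: "'m \<times> ('i \<Rightarrow> 'e) \<Rightarrow> ('i \<Rightarrow> 'e \<times> 'e) \<Rightarrow> 'i \<Rightarrow> 'e \<times> 'e"
    and g\<^sub>1 :: "'m \<times> ('i \<Rightarrow> 'e) \<Rightarrow> ('i \<Rightarrow> 'e \<times> 'e) \<Rightarrow> ('i \<Rightarrow> 'e \<times> 'e) \<Rightarrow> real"
    and C LC :: "('m \<times> ('i \<Rightarrow> 'e) \<Rightarrow> 'i \<Rightarrow> 'e \<times> 'e) \<Rightarrow> ('m \<times> ('i \<Rightarrow> 'e) \<Rightarrow> 'i \<Rightarrow> 'e \<times> 'e) \<Rightarrow>
      'm \<times> ('i \<Rightarrow> 'e) \<Rightarrow> 'i \<Rightarrow> 'e \<times> 'e"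
  assumes hermitian: "canonical_hermitian M nab g J\<^sub>1 g\<^sub>1"
    and C_connection: "connection (tangent_bundle M) C"
    and LC: "levi_civita (tangent_bundle M) g\<^sub>1 LC"
    and chern: "\<And>U X Y Z p. mopen (tangent_bundle M) U \<Longrightarrow> vector_field (tangent_bundle M) U X \<Longrightarrow>
      vector_field (tangent_bundle M) U Y \<Longrightarrow> vector_field (tangent_bundle M) U Z \<Longrightarrow> p \<in> U \<Longrightarrow>
      g\<^sub>1 p (C X Y p) (Z p) = g\<^sub>1 p (LC X Y p) (Z p)
        - 1 / 2 * ext_deriv (tangent_bundle M) (fundamental_form J\<^sub>1 g\<^sub>1) (\<lambda>q. J\<^sub>1 q (X q)) Y Z p"
begin

abbreviation TM where "TM \<equiv> tangent_bundle M"

sublocale F: flat_atlas M nab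
  by standard (use affine_riemann in \<open>simp add: affine_riemann_def\<close>)

sublocale G: metric_atlas TM g\<^sub>1
proof
  fix \<xi> u v w and a b :: real
  assume "\<xi> \<in> carrier_of TM" "u \<in> tangent_space TM \<xi>" "v \<in> tangent_space TM \<xi>"
      "w \<in> tangent_space TM \<xi>"
  then show "g\<^sub>1 \<xi> (a \<cdot> u + b \<cdot> v) w = a * g\<^sub>1 \<xi> u w + b * g\<^sub>1 \<xi> v w"
    using hermitian unfolding canonical_hermitian_def by blast
next
  fix \<xi> u v assume "\<xi> \<in> carrier_of TM" "u \<in> tangent_space TM \<xi>" "v \<in> tangent_space TM \<xi>"
  then show "g\<^sub>1 \<xi> u v = g\<^sub>1 \<xi> v u"
    using hermitian unfolding canonical_hermitian_def by blast
qed

sublocale K: curvature_atlas TM LC C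
  by standard (use LC C_connection in \<open>simp_all add: levi_civita_def\<close>)

lemma J_linear:
  "\<xi> \<in> carrier_of TM \<Longrightarrow> u \<in> tangent_space TM \<xi> \<Longrightarrow> v \<in> tangent_space TM \<xi> \<Longrightarrow>
   J\<^sub>1 \<xi> (a \<cdot> u + b \<cdot> v) = a \<cdot> J\<^sub>1 \<xi> u + b \<cdot> J\<^sub>1 \<xi> v"
  using hermitian unfolding canonical_hermitian_def by blast

lemma J_sum:
  assumes \<xi>: "\<xi> \<in> carrier_of TM" and u: "\<And>k. k \<in> K \<Longrightarrow> u k \<in> tangent_space TM \<xi>"
  shows "J\<^sub>1 \<xi> (\<Sum>k\<in>K. c k \<cdot> u k) = (\<Sum>k\<in>K. c k \<cdot> J\<^sub>1 \<xi> (u k))"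
  using u
proof (induction K rule: infinite_finite_induct)
  case (insert k K)
  have "J\<^sub>1 \<xi> (c k \<cdot> u k + 1 \<cdot> (\<Sum>k\<in>K. c k \<cdot> u k)) = c k \<cdot> J\<^sub>1 \<xi> (u k) + 1 \<cdot> J\<^sub>1 \<xi> (\<Sum>k\<in>K. c k \<cdot> u k)"
    using insert by (intro J_linear \<xi> F.TB.tangent_sum F.TB.tangent_scale) auto
  then show ?case
    using insert by (simp del: sum_fun_apply plus_fun_apply vscale_apply)
next
  case empty
  have "J\<^sub>1 \<xi> (0 \<cdot> 0 + 0 \<cdot> 0) = 0 \<cdot> J\<^sub>1 \<xi> 0 + 0 \<cdot> J\<^sub>1 \<xi> 0"
    by (intro J_linear \<xi> F.TB.tangent_zero)
  then show ?case by (simp del: sum_fun_apply zero_fun_apply)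
next
  case (infinite K)
  have "J\<^sub>1 \<xi> (0 \<cdot> 0 + 0 \<cdot> 0) = 0 \<cdot> J\<^sub>1 \<xi> 0 + 0 \<cdot> J\<^sub>1 \<xi> 0"
    by (intro J_linear \<xi> F.TB.tangent_zero)
  then show ?case using infinite by (simp del: sum_fun_apply zero_fun_apply)
qed

context
  fixes p v
  assumes p: "p \<in> carrier_of M" and v: "v \<in> tangent_space M p"
begin

lemma bundle_carrier: "(p, v) \<in> carrier_of TM"
  using p v by (simp add: carrier_bundle)

text \<open>The structure is prescribed on lifts of vector fields; any two tangent vectors at
  \<open>p\<close> are values of coordinate fields, which makes the prescription pointwise.\<close>

lemma lift_structure:
  assumes u: "u \<in> tangent_space M p" and w: "w \<in> tangent_space M p"
  shows "J\<^sub>1 (p, v) (F.hor (p, v) u) = F.ver (p, v) u"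
    and "J\<^sub>1 (p, v) (F.ver (p, v) u) = - F.hor (p, v) u"
    and "g\<^sub>1 (p, v) (F.hor (p, v) u) (F.hor (p, v) w) = g p u w"
    and "g\<^sub>1 (p, v) (F.ver (p, v) u) (F.ver (p, v) w) = g p u w"
    and "g\<^sub>1 (p, v) (F.hor (p, v) u) (F.ver (p, v) w) = 0"
    and "g\<^sub>1 (p, v) (F.ver (p, v) u) (F.hor (p, v) w) = 0"
proof -
  obtain i where i: "i \<in> charts_at M p" using carrier_chart[OF p] by blast
  then have i': "i \<in> idx M" "p \<in> cdom M i" by (auto simp: charts_at_iff)
  let ?X = "const_field M i (u i)" and ?Y = "const_field M i (w i)"
  have eq: "?X p = u" "?Y p = w"
    using tangent_eq_const_field[OF u i] tangent_eq_const_field[OF w i] by simp_all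
  have vf: "vector_field M (cdom M i) ?X" "vector_field M (cdom M i) ?Y"
    by (rule N.T.const_field_on_cdom[OF i'])+
  note * = hermitian[unfolded canonical_hermitian_def, THEN conjunct2, rule_format,
      of "cdom M i" ?X ?Y "(p, v)", OF _ bundle_carrier]
  have st: "J\<^sub>1 (p, v) (hlift M nab ?X (p, v)) = vlift M ?X (p, v) \<and>
     J\<^sub>1 (p, v) (vlift M ?X (p, v)) = - hlift M nab ?X (p, v) \<and>
     g\<^sub>1 (p, v) (hlift M nab ?X (p, v)) (hlift M nab ?Y (p, v)) = g p (?X p) (?Y p) \<and>
     g\<^sub>1 (p, v) (vlift M ?X (p, v)) (vlift M ?Y (p, v)) = g p (?X p) (?Y p) \<and>
     g\<^sub>1 (p, v) (hlift M nab ?X (p, v)) (vlift M ?Y (p, v)) = 0"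
    using * mopen_cdom[OF i'(1)] vf i' by simp
  then show 1: "J\<^sub>1 (p, v) (F.hor (p, v) u) = F.ver (p, v) u"
    "J\<^sub>1 (p, v) (F.ver (p, v) u) = - F.hor (p, v) u"
    "g\<^sub>1 (p, v) (F.hor (p, v) u) (F.hor (p, v) w) = g p u w"
    "g\<^sub>1 (p, v) (F.ver (p, v) u) (F.ver (p, v) w) = g p u w"
    "g\<^sub>1 (p, v) (F.hor (p, v) u) (F.ver (p, v) w) = 0"
    by (simp_all only: F.hlift_eq_hor F.vlift_eq_ver fst_conv eq)
  have "g\<^sub>1 (p, v) (hlift M nab ?Y (p, v)) (vlift M ?X (p, v)) = 0"
    using hermitian[unfolded canonical_hermitian_def, THEN conjunct2, rule_format,
      of "cdom M i" ?Y ?X "(p, v)", OF _ bundle_carrier] mopen_cdom[OF i'(1)] vf i' by simp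
  then have "g\<^sub>1 (p, v) (F.hor (p, v) w) (F.ver (p, v) u) = 0"
    by (simp only: F.hlift_eq_hor F.vlift_eq_ver fst_conv eq)
  then show "g\<^sub>1 (p, v) (F.ver (p, v) u) (F.hor (p, v) w) = 0"
    using G.metric_sym[OF bundle_carrier F.ver_tangent[OF u v] F.hor_tangent[OF w v]] by simp
qed

lemma lift_form:
  assumes u: "u \<in> tangent_space M p" and w: "w \<in> tangent_space M p"
  shows "fundamental_form J\<^sub>1 g\<^sub>1 (p, v) (F.hor (p, v) u) (F.hor (p, v) w) = 0"
    and "fundamental_form J\<^sub>1 g\<^sub>1 (p, v) (F.ver (p, v) u) (F.ver (p, v) w) = 0"
    and "fundamental_form J\<^sub>1 g\<^sub>1 (p, v) (F.hor (p, v) u) (F.ver (p, v) w) = g p u w"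
    and "fundamental_form J\<^sub>1 g\<^sub>1 (p, v) (F.ver (p, v) u) (F.hor (p, v) w) = - g p u w"
  using F.hor_tangent[OF u v] F.hor_tangent[OF w v] F.ver_tangent[OF w v]
  by (simp_all add: fundamental_form_def lift_structure[OF u w] G.metric_uminus_left[OF
      bundle_carrier])

text \<open>The difference splits into a horizontal and a vertical lift, these are orthogonal, and
  each is tested against itself, where positivity of \<open>g\<close> applies. The test vectors are
  lifts of coordinate vectors, as the Koszul formula provides.\<close>

lemma bundle_nondegenerate:
  assumes i: "i \<in> charts_at M p" and w: "w \<in> tangent_space TM (p, v)" "w' \<in> tangent_space TM (p, v)"
    and h: "\<And>d. g\<^sub>1 (p, v) w (F.hor (p, v) (const_field M i d p))
        = g\<^sub>1 (p, v) w' (F.hor (p, v) (const_field M i d p))"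
    and ve: "\<And>d. g\<^sub>1 (p, v) w (F.ver (p, v) (const_field M i d p))
        = g\<^sub>1 (p, v) w' (F.ver (p, v) (const_field M i d p))"
  shows "w = w'"
proof -
  let ?c = "\<lambda>a. const_field M i a p"
  have "w - w' \<in> tangent_space TM (p, v)" using w by simp
  from F.lift_decompose[OF this v i] obtain a b where
    eq: "w - w' = F.hor (p, v) (?c a) + F.ver (p, v) (?c b)"
    by (auto simp only: F.hlift_eq_hor F.vlift_eq_ver fst_conv)
  note t = F.hor_tangent[OF const_field_tangent v] F.ver_tangent[OF const_field_tangent v]
  have "g\<^sub>1 (p, v) (w - w') (F.hor (p, v) (?c a)) = 0"
    using h[of a] w t by (simp add: G.metric_diff_left[OF bundle_carrier] del: minus_apply
        fun_diff_def)
  then have "g p (?c a) (?c a) = 0"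
    unfolding eq using t by (simp add: G.metric_add_left[OF bundle_carrier] lift_structure del:
        plus_fun_apply)
  then have a: "?c a = 0" using metric_pos[OF p const_field_tangent] by force
  have "g\<^sub>1 (p, v) (w - w') (F.ver (p, v) (?c b)) = 0"
    using ve[of b] w t by (simp add: G.metric_diff_left[OF bundle_carrier] del: minus_apply
        fun_diff_def)
  then have "g p (?c b) (?c b) = 0"
    unfolding eq using t by (simp add: G.metric_add_left[OF bundle_carrier] lift_structure del:
        plus_fun_apply)
  then have b: "?c b = 0" using metric_pos[OF p const_field_tangent] by force
  show ?thesis using eq unfolding a b by (simp add: F.hor_zero F.ver_zero)
qed

end

text \<open>Allows the field \<open>\<lambda>q. J\<^sub>1 q (X q)\<close> inside the Chern formula
  to be exchanged for a known smooth field with the same values on \<open>U\<close>.\<close>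

lemma ext_deriv_cong:
  assumes U: "mopen TM U" "\<xi> \<in> U" and X: "vector_field TM U X'" and eq: "\<And>q. q \<in> U \<Longrightarrow> X q = X' q"
    and Y: "vector_field TM U Y" and Z: "vector_field TM U Z"
  shows "ext_deriv TM \<omega> X Y Z \<xi> = ext_deriv TM \<omega> X' Y Z \<xi>"
proof -
  have X0: "vector_field TM U X"
    using eq by (intro F.TB.vector_field_cong[OF U(1) X]) simp
  have "dir_deriv TM X (\<lambda>q. \<omega> q (Y q) (Z q)) \<xi> = dir_deriv TM X' (\<lambda>q. \<omega> q (Y q) (Z q)) \<xi>"
    "dir_deriv TM Y (\<lambda>q. \<omega> q (Z q) (X q)) \<xi> = dir_deriv TM Y (\<lambda>q. \<omega> q (Z q) (X' q)) \<xi>"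
    "dir_deriv TM Z (\<lambda>q. \<omega> q (X q) (Y q)) \<xi> = dir_deriv TM Z (\<lambda>q. \<omega> q (X' q) (Y q)) \<xi>"
    by (intro F.TB.dir_deriv_cong[OF U]; simp add: eq U(2))+
  moreover have "lie_bracket TM X Y \<xi> = lie_bracket TM X' Y \<xi>" "lie_bracket TM Z X \<xi>
      = lie_bracket TM Z X' \<xi>"
    by (intro K.lie_bracket_cong[OF U(1)] X0 X Y Z U(2) eq refl; assumption)+
  ultimately show ?thesis
    using eq[OF U(2)] by (simp add: ext_deriv_def)
qed

section \<open>The Koszul formula on lifted coordinate fields\<close>

context
  fixes i
  assumes i: "i \<in> idx M"
begin

private abbreviation c where "c \<equiv> const_field M i"
private abbreviation V where "V \<equiv> cdom M i"
private abbreviation W where "W \<equiv> bundle_over M (cdom M i)"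
private abbreviation hc where "hc a \<equiv> hlift M nab (c a)"
private abbreviation vc where "vc a \<equiv> vlift M (c a)"

lemma V_open: "mopen M V" by (rule mopen_cdom[OF i])
lemma W_open: "mopen TM W" by (rule mopen_bundle_over[OF V_open])
lemma c_field: "vector_field M V (c a)" by (rule vector_field_const_field[OF V_open order_refl i])
lemma hc_field: "vector_field TM W (hc a)" by (rule F.vector_field_hlift[OF V_open c_field])
lemma vc_field: "vector_field TM W (vc a)" by (rule F.vector_field_vlift[OF V_open c_field])

context
  fixes p v
  assumes p: "p \<in> cdom M i" and v: "v \<in> tangent_space M p"
begin

private lemma p_carrier: "p \<in> carrier_of M" using p i by (auto simp: carrier_of_def)
private lemma xi_W: "(p, v) \<in> W" using p v by simp
private lemma i_at: "i \<in> charts_at M p" using p i by (simp add: charts_at_iff)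

lemma nab_const_tangent: "nab (c a) (c b) p \<in> tangent_space M p"
  by (rule vector_field_tangent[OF N.T.connection_vector_field[OF V_open c_field c_field] p])

lemma nab_const_commute: "nab (c a) (c b) p = nab (c b) (c a) p"
  using N.lie_bracket_eq[OF V_open c_field c_field p] F.lie_bracket_const[OF i p v p, of a b] by
      simp

lemma bracket_lifts:
  "lie_bracket TM (hc a) (hc b) (p, v) = 0"
  "lie_bracket TM (vc a) (vc b) (p, v) = 0"
  "lie_bracket TM (hc a) (vc b) (p, v) = F.ver (p, v) (nab (c a) (c b) p)"
  "lie_bracket TM (vc a) (hc b) (p, v) = - F.ver (p, v) (nab (c b) (c a) p)"
proof -
  have ch: "i \<in> charts_at TM (p, v)" using i_at v by simp
  note t = F.TB.vector_field_tangent[OF K.vector_field_lie_bracket[OF W_open] xi_W]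
  note br = F.lie_bracket_lifts[OF i p v]
  show "lie_bracket TM (hc a) (hc b) (p, v) = 0"
    by (rule F.TB.tangent_eqI[OF t[OF hc_field hc_field] F.TB.tangent_zero ch]) (simp add: br)
  show "lie_bracket TM (vc a) (vc b) (p, v) = 0"
    by (rule F.TB.tangent_eqI[OF t[OF vc_field vc_field] F.TB.tangent_zero ch]) (simp add: br)
  show hv: "lie_bracket TM (hc a) (vc b) (p, v) = F.ver (p, v) (nab (c a) (c b) p)" for a b
    by (rule F.TB.tangent_eqI[OF t[OF hc_field vc_field] F.ver_tangent[OF nab_const_tangent v] ch])
      (simp add: br F.ver_def vlift_apply(1)[OF i_at] christoffel_def)
  show "lie_bracket TM (vc a) (hc b) (p, v) = - F.ver (p, v) (nab (c b) (c a) p)"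
    using fun_cong[OF F.TB.lie_bracket_swap[of "vc a" "hc b"], of "(p, v)"] hv[of b a]
    by simp
qed

text \<open>The first derivatives of the metric coefficients. Together with
  \<open>nabla_gram\<close>, the Christoffel symbols with lowered index, they express every term of
  the Koszul formula on coordinate lifts, which thereby becomes linear arithmetic.\<close>

definition "gram_deriv a b d = dir_deriv M (c a) (\<lambda>q. g q (c b q) (c d q)) p"
definition "nabla_gram a b d = g p (nab (c a) (c b) p) (c d p)"

private lemma c_uminus: "c (- a) = - c a"
  using const_field_scale[of i "- 1" a] by (simp add: fun_Compl_def)

private lemma c_uminus_apply: "c (- a) q = - c a q"
  by (simp add: c_uminus)

private lemma metric_const_smooth: "smooth_fun M V (\<lambda>q. g q (c b q) (c d q))"
  by (rule metric_smooth[OF V_open c_field c_field])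

private lemma metric_const_carrier: "q \<in> V \<Longrightarrow> q \<in> carrier_of M"
  using mopen_carrier[OF V_open] by blast

lemma dir_deriv_const_uminus:
  assumes "smooth_fun M V f" "\<And>q. q \<in> V \<Longrightarrow> h q = - f q"
  shows "dir_deriv M (c a) h p = - dir_deriv M (c a) f p"
proof -
  have "dir_deriv M (c a) h p = dir_deriv M (c a) (\<lambda>q. - 1 * f q) p"
    by (rule dir_deriv_cong[OF V_open p]) (simp_all add: assms(2))
  also have "\<dots> = - 1 * dir_deriv M (c a) f p + dir_deriv M (c a) (\<lambda>q. - 1) p * f p"
    by (rule dir_deriv_mult[OF V_open p smooth_fun_const[OF V_open] assms(1)]) simp
  finally show ?thesis by (simp add: dir_deriv_const[OF V_open p])
qed

text \<open>Signs enter because \<open>J\<^sub>1\<close> sends the vertical lift of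
  \<open>c a\<close> to the horizontal lift of \<open>c (- a)\<close>.\<close>

lemma gram_deriv_simps:
  "gram_deriv (- a) b d = - gram_deriv a b d" "gram_deriv a (- b) d
      = - gram_deriv a b d" "gram_deriv a b (- d) = - gram_deriv a b d"
proof -
  show "gram_deriv (- a) b d = - gram_deriv a b d"
    unfolding gram_deriv_def
    using dir_deriv_linear_field[OF V_open p metric_const_smooth, of "c a" "c a" "c (- a)" "- 1" 0]
    by (simp add: c_uminus)
  show "gram_deriv a (- b) d = - gram_deriv a b d"
    unfolding gram_deriv_def
    by (rule dir_deriv_const_uminus[OF metric_const_smooth])
      (simp add: c_uminus metric_uminus_left[OF metric_const_carrier])
  show "gram_deriv a b (- d) = - gram_deriv a b d"
    unfolding gram_deriv_def
    by (rule dir_deriv_const_uminus[OF metric_const_smooth])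
      (simp add: c_uminus metric_uminus_right[OF metric_const_carrier])
qed

lemma gram_deriv_commute: "gram_deriv a b d = gram_deriv a d b"
  unfolding gram_deriv_def
  by (rule dir_deriv_cong[OF V_open p]) (simp_all add: metric_sym[OF metric_const_carrier])

lemma nabla_gram_simps:
  "nabla_gram (- a) b d = - nabla_gram a b d" "nabla_gram a (- b) d
      = - nabla_gram a b d" "nabla_gram a b (- d) = - nabla_gram a b d"
  unfolding nabla_gram_def c_uminus
  using N.T.connection_uminus_left[OF V_open c_field c_field p] N.T.connection_uminus_right[OF
      V_open c_field c_field p]
    nab_const_tangent
  by (simp_all add: metric_uminus_left[OF p_carrier] metric_uminus_right[OF p_carrier])

lemma nabla_gram_commute: "nabla_gram a b d = nabla_gram b a d"
  unfolding nabla_gram_def using nab_const_commute by simp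

text \<open>A function on the bundle that agrees with a pullback over \<open>V\<close> is constant
  along fibres there, so its vertical derivatives vanish.\<close>

lemma dir_deriv_const_lift:
  assumes "smooth_fun M V f" "\<And>q w. q \<in> V \<Longrightarrow> w \<in> tangent_space M q \<Longrightarrow> f' (q, w) = f q"
  shows "dir_deriv TM (hc a) f' (p, v) = dir_deriv M (c a) f p"
    and "dir_deriv TM (vc a) f' (p, v) = 0"
proof -
  have "dir_deriv TM X f' (p, v) = dir_deriv TM X (\<lambda>\<xi>. f (fst \<xi>)) (p, v)" for X
    by (rule F.TB.dir_deriv_cong[OF W_open xi_W]) (use assms(2) in auto)
  then show "dir_deriv TM (hc a) f' (p, v) = dir_deriv M (c a) f p"
    "dir_deriv TM (vc a) f' (p, v) = 0"
    using F.dir_deriv_lift[OF V_open p v _ assms(1), of "c a"] by simp_all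
qed

lemma dir_deriv_const_lift_zero:
  assumes "\<And>q w. q \<in> V \<Longrightarrow> w \<in> tangent_space M q \<Longrightarrow> f' (q, w) = 0"
  shows "dir_deriv TM (hc a) f' (p, v) = 0" and "dir_deriv TM (vc a) f' (p, v) = 0"
  using dir_deriv_const_lift[of "\<lambda>_. 0" f' a] assms smooth_fun_const[OF V_open]
  by (simp_all add: dir_deriv_const[OF V_open p])

lemma dir_deriv_metric_lifts:
  "dir_deriv TM (hc a) (\<lambda>q. g\<^sub>1 q (hc b q) (hc d q)) (p, v) = gram_deriv a b d"
  "dir_deriv TM (hc a) (\<lambda>q. g\<^sub>1 q (vc b q) (vc d q)) (p, v) = gram_deriv a b d"
  "dir_deriv TM (hc a) (\<lambda>q. g\<^sub>1 q (hc b q) (vc d q)) (p, v) = 0"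
  "dir_deriv TM (hc a) (\<lambda>q. g\<^sub>1 q (vc b q) (hc d q)) (p, v) = 0"
  "dir_deriv TM (vc a) (\<lambda>q. g\<^sub>1 q (hc b q) (hc d q)) (p, v) = 0"
  "dir_deriv TM (vc a) (\<lambda>q. g\<^sub>1 q (vc b q) (vc d q)) (p, v) = 0"
  "dir_deriv TM (vc a) (\<lambda>q. g\<^sub>1 q (hc b q) (vc d q)) (p, v) = 0"
  "dir_deriv TM (vc a) (\<lambda>q. g\<^sub>1 q (vc b q) (hc d q)) (p, v) = 0"
proof -
  note s = lift_structure(3-6)[OF metric_const_carrier _ const_field_tangent const_field_tangent]
  have hh: "g\<^sub>1 (q, w) (hc b (q, w)) (hc d (q, w)) = g q (c b q) (c d q)"
    and vv: "g\<^sub>1 (q, w) (vc b (q, w)) (vc d (q, w)) = g q (c b q) (c d q)"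
    and hv: "g\<^sub>1 (q, w) (hc b (q, w)) (vc d (q, w)) = 0"
    and vh: "g\<^sub>1 (q, w) (vc b (q, w)) (hc d (q, w)) = 0"
    if "q \<in> V" "w \<in> tangent_space M q" for q w
    unfolding F.hlift_eq_hor F.vlift_eq_ver fst_conv by (rule s[OF that])+
  show "dir_deriv TM (hc a) (\<lambda>q. g\<^sub>1 q (hc b q) (hc d q)) (p, v) = gram_deriv a b d"
    unfolding gram_deriv_def by (rule dir_deriv_const_lift(1)[OF metric_const_smooth], rule hh)
  show "dir_deriv TM (hc a) (\<lambda>q. g\<^sub>1 q (vc b q) (vc d q)) (p, v) = gram_deriv a b d"
    unfolding gram_deriv_def by (rule dir_deriv_const_lift(1)[OF metric_const_smooth], rule vv)
  show "dir_deriv TM (hc a) (\<lambda>q. g\<^sub>1 q (hc b q) (vc d q)) (p, v) = 0"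
    by (rule dir_deriv_const_lift_zero(1), rule hv)
  show "dir_deriv TM (hc a) (\<lambda>q. g\<^sub>1 q (vc b q) (hc d q)) (p, v) = 0"
    by (rule dir_deriv_const_lift_zero(1), rule vh)
  show "dir_deriv TM (vc a) (\<lambda>q. g\<^sub>1 q (hc b q) (hc d q)) (p, v) = 0"
    by (rule dir_deriv_const_lift(2)[OF metric_const_smooth], rule hh)
  show "dir_deriv TM (vc a) (\<lambda>q. g\<^sub>1 q (vc b q) (vc d q)) (p, v) = 0"
    by (rule dir_deriv_const_lift(2)[OF metric_const_smooth], rule vv)
  show "dir_deriv TM (vc a) (\<lambda>q. g\<^sub>1 q (hc b q) (vc d q)) (p, v) = 0"
    by (rule dir_deriv_const_lift_zero(2), rule hv)
  show "dir_deriv TM (vc a) (\<lambda>q. g\<^sub>1 q (vc b q) (hc d q)) (p, v) = 0"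
    by (rule dir_deriv_const_lift_zero(2), rule vh)
qed

private abbreviation \<omega> where "\<omega> \<equiv> fundamental_form J\<^sub>1 g\<^sub>1"

lemma dir_deriv_form_lifts:
  "dir_deriv TM (hc a) (\<lambda>q. \<omega> q (hc b q) (hc d q)) (p, v) = 0"
  "dir_deriv TM (hc a) (\<lambda>q. \<omega> q (vc b q) (vc d q)) (p, v) = 0"
  "dir_deriv TM (hc a) (\<lambda>q. \<omega> q (hc b q) (vc d q)) (p, v) = gram_deriv a b d"
  "dir_deriv TM (hc a) (\<lambda>q. \<omega> q (vc b q) (hc d q)) (p, v) = - gram_deriv a b d"
  "dir_deriv TM (vc a) (\<lambda>q. \<omega> q (hc b q) (hc d q)) (p, v) = 0"
  "dir_deriv TM (vc a) (\<lambda>q. \<omega> q (vc b q) (vc d q)) (p, v) = 0"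
  "dir_deriv TM (vc a) (\<lambda>q. \<omega> q (hc b q) (vc d q)) (p, v) = 0"
  "dir_deriv TM (vc a) (\<lambda>q. \<omega> q (vc b q) (hc d q)) (p, v) = 0"
proof -
  note s = lift_form[OF metric_const_carrier _ const_field_tangent const_field_tangent]
  have hh: "\<omega> (q, w) (hc b (q, w)) (hc d (q, w)) = 0"
    and vv: "\<omega> (q, w) (vc b (q, w)) (vc d (q, w)) = 0"
    and hv: "\<omega> (q, w) (hc b (q, w)) (vc d (q, w)) = g q (c b q) (c d q)"
    and vh: "\<omega> (q, w) (vc b (q, w)) (hc d (q, w)) = - g q (c b q) (c d q)"
    if "q \<in> V" "w \<in> tangent_space M q" for q w
    unfolding F.hlift_eq_hor F.vlift_eq_ver fst_conv by (rule s[OF that])+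
  have neg: "dir_deriv M (c a) (\<lambda>q. - g q (c b q) (c d q)) p = - gram_deriv a b d"
    unfolding gram_deriv_def by (rule dir_deriv_const_uminus[OF metric_const_smooth refl])
  show "dir_deriv TM (hc a) (\<lambda>q. \<omega> q (hc b q) (hc d q)) (p, v) = 0"
    by (rule dir_deriv_const_lift_zero(1), rule hh)
  show "dir_deriv TM (hc a) (\<lambda>q. \<omega> q (vc b q) (vc d q)) (p, v) = 0"
    by (rule dir_deriv_const_lift_zero(1), rule vv)
  show "dir_deriv TM (hc a) (\<lambda>q. \<omega> q (hc b q) (vc d q)) (p, v) = gram_deriv a b d"
    unfolding gram_deriv_def by (rule dir_deriv_const_lift(1)[OF metric_const_smooth], rule hv)
  show "dir_deriv TM (hc a) (\<lambda>q. \<omega> q (vc b q) (hc d q)) (p, v) = - gram_deriv a b d"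
    unfolding neg[symmetric] by (rule dir_deriv_const_lift(1)[OF smooth_fun_uminus[OF V_open
        metric_const_smooth]], rule vh)
  show "dir_deriv TM (vc a) (\<lambda>q. \<omega> q (hc b q) (hc d q)) (p, v) = 0"
    by (rule dir_deriv_const_lift_zero(2), rule hh)
  show "dir_deriv TM (vc a) (\<lambda>q. \<omega> q (vc b q) (vc d q)) (p, v) = 0"
    by (rule dir_deriv_const_lift_zero(2), rule vv)
  show "dir_deriv TM (vc a) (\<lambda>q. \<omega> q (hc b q) (vc d q)) (p, v) = 0"
    by (rule dir_deriv_const_lift(2)[OF metric_const_smooth], rule hv)
  show "dir_deriv TM (vc a) (\<lambda>q. \<omega> q (vc b q) (hc d q)) (p, v) = 0"
    by (rule dir_deriv_const_lift(2)[OF smooth_fun_uminus[OF V_open metric_const_smooth]], rule vh)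
qed

text \<open>\<open>JX\<close> is a smooth field representing \<open>J\<^sub>1\<close> applied to
  \<open>X\<close>; doubling clears the halves of both formulas.\<close>

lemma chern_koszul:
  assumes X: "vector_field TM W X" and Y: "vector_field TM W Y" and Z: "vector_field TM W Z"
    and JX: "vector_field TM W JX" "\<And>q. q \<in> W \<Longrightarrow> J\<^sub>1 q (X q) = JX q"
  shows "2 * g\<^sub>1 (p, v) (C X Y (p, v)) (Z (p, v)) =
    dir_deriv TM X (\<lambda>q. g\<^sub>1 q (Y q) (Z q)) (p, v) + dir_deriv TM Y (\<lambda>q. g\<^sub>1 q (X q) (Z q)) (p, v)
    - dir_deriv TM Z (\<lambda>q. g\<^sub>1 q (X q) (Y q)) (p, v)
    + g\<^sub>1 (p, v) (lie_bracket TM X Y (p, v)) (Z (p, v)) - g\<^sub>1 (p, v) (lie_bracket TM X Z (p, v)) (Y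
        (p, v))
    - g\<^sub>1 (p, v) (lie_bracket TM Y Z (p, v)) (X (p, v))
    - ext_deriv TM \<omega> JX Y Z (p, v)"
  using G.koszul[OF LC W_open xi_W X Y Z] chern[OF W_open X Y Z xi_W]
    ext_deriv_cong[OF W_open xi_W JX Y Z, of \<omega>] by simp

text \<open>Coordinate lifts are closed under \<open>J\<^sub>1\<close>, up to the sign of the
  coefficient vector, so the first argument of the exterior derivative is again a coordinate lift
  with known brackets.\<close>

lemma J_hlift: "q \<in> W \<Longrightarrow> J\<^sub>1 q (hc a q) = vc a q"
  and J_vlift: "q \<in> W \<Longrightarrow> J\<^sub>1 q (vc a q) = hc (- a) q"
proof -
  assume "q \<in> W"
  then obtain r w where q: "q = (r, w)" "r \<in> V" "w \<in> tangent_space M r" by (cases q) auto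
  note s = lift_structure(1,2)[OF metric_const_carrier[OF q(2)] q(3) const_field_tangent
      const_field_tangent]
  show "J\<^sub>1 q (hc a q) = vc a q"
    unfolding q(1) F.hlift_eq_hor F.vlift_eq_ver fst_conv by (rule s)
  show "J\<^sub>1 q (vc a q) = hc (- a) q"
    unfolding q(1) F.hlift_eq_hor F.vlift_eq_ver fst_conv
    by (rule trans[OF s(2)]) (simp only: c_uminus_apply F.hor_uminus)
qed

text \<open>Each of the eight components is the Koszul formula minus \<open>d\<omega>(JX, Y, Z)\<close>, evaluated with
  the brackets of the lifted coordinate fields.\<close>

lemma chern_components:
  "2 * g\<^sub>1 (p, v) (C (hc a) (hc b) (p, v)) (F.hor (p, v) (c d p))
    = gram_deriv a b d + nabla_gram a b d - nabla_gram a d b"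
  "g\<^sub>1 (p, v) (C (hc a) (hc b) (p, v)) (F.ver (p, v) (c d p)) = 0"
  "2 * g\<^sub>1 (p, v) (C (hc a) (vc b) (p, v)) (F.ver (p, v) (c d p))
    = gram_deriv a b d + nabla_gram a b d - nabla_gram a d b"
  "g\<^sub>1 (p, v) (C (hc a) (vc b) (p, v)) (F.hor (p, v) (c d p)) = 0"
  "g\<^sub>1 (p, v) (C (vc a) (hc b) (p, v)) (F.hor (p, v) (c d p)) = 0"
  "2 * g\<^sub>1 (p, v) (C (vc a) (hc b) (p, v)) (F.ver (p, v) (c d p))
    = gram_deriv a b d - nabla_gram a b d - nabla_gram a d b"
  "2 * g\<^sub>1 (p, v) (C (vc a) (vc b) (p, v)) (F.hor (p, v) (c d p))
    = - (gram_deriv a b d - nabla_gram a b d - nabla_gram a d b)"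
  "g\<^sub>1 (p, v) (C (vc a) (vc b) (p, v)) (F.ver (p, v) (c d p)) = 0"
proof -
  have at: "hc a (p, v) = F.hor (p, v) (c a p)" "vc a (p, v) = F.ver (p, v) (c a p)" for a
    by (simp_all only: F.hlift_eq_hor F.vlift_eq_ver fst_conv)
  note t = F.hor_tangent[OF _ v] F.ver_tangent[OF _ v] nab_const_tangent const_field_tangent
  note cp = bundle_carrier[OF p_carrier v]
  have form_minus: "\<omega> (p, v) (- u) w = - \<omega> (p, v) u w"
    if "u = F.ver (p, v) u'" "u' \<in> tangent_space M p" "w \<in> tangent_space TM (p, v)" for u u' w
  proof -
    have "\<omega> (p, v) (- u) w = \<omega> (p, v) (F.ver (p, v) (- u')) w"
      by (simp only: that(1) F.ver_uminus)
    also have "\<dots> = - \<omega> (p, v) u w"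
      using that t by (simp add: fundamental_form_def lift_structure[OF p_carrier v] F.hor_uminus
          G.metric_uminus_left[OF cp])
    finally show ?thesis .
  qed
  have zero: "\<omega> (p, v) 0 w = 0" if "w \<in> tangent_space TM (p, v)" for w
    using form_minus[of "F.ver (p, v) 0" 0 w] that by (simp add: F.ver_zero)
  have pair: "g\<^sub>1 (p, v) (F.ver (p, v) (nab (c a) (c b) p)) (F.ver (p, v) (c d p))
      = nabla_gram a b d"
    "g\<^sub>1 (p, v) (F.ver (p, v) (nab (c a) (c b) p)) (F.hor (p, v) (c d p)) = 0"
    "\<omega> (p, v) (F.ver (p, v) (nab (c a) (c b) p)) (F.ver (p, v) (c d p)) = 0"
    "\<omega> (p, v) (F.ver (p, v) (nab (c a) (c b) p)) (F.hor (p, v) (c d p)) = - nabla_gram a b d"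
        for a b d
    unfolding nabla_gram_def by (simp_all add: lift_structure[OF p_carrier v] lift_form[OF
        p_carrier v] t)
  have pair_neg: "g\<^sub>1 (p, v) (- F.ver (p, v) (nab (c a) (c b) p)) (F.ver (p, v) (c d p))
      = - nabla_gram a b d"
    "g\<^sub>1 (p, v) (- F.ver (p, v) (nab (c a) (c b) p)) (F.hor (p, v) (c d p)) = 0"
    "\<omega> (p, v) (- F.ver (p, v) (nab (c a) (c b) p)) (F.ver (p, v) (c d p)) = 0"
    "\<omega> (p, v) (- F.ver (p, v) (nab (c a) (c b) p)) (F.hor (p, v) (c d p)) = nabla_gram a b d"
        for a b d
    by (simp_all add: G.metric_uminus_left[OF cp] form_minus[OF refl] pair t)
  have pair_zero: "g\<^sub>1 (p, v) 0 (F.ver (p, v) (c d p)) = 0" "g\<^sub>1 (p, v) 0 (F.hor (p, v) (c d p)) = 0"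
    "\<omega> (p, v) 0 (F.ver (p, v) (c d p)) = 0" "\<omega> (p, v) 0 (F.hor (p, v) (c d p)) = 0" for d
    by (simp_all add: G.metric_zero_left[OF cp] zero t)
  note K = chern_koszul[OF _ _ _ vc_field J_hlift] chern_koszul[OF _ _ _ hc_field J_vlift]
  note simps = ext_deriv_def dir_deriv_metric_lifts dir_deriv_form_lifts bracket_lifts at pair
      pair_neg pair_zero
    gram_deriv_simps nabla_gram_simps add_0_left add_0_right diff_0_right diff_0 minus_zero
        minus_minus
  \<comment> \<open>The Koszul formula permutes the arguments; these instances bring its terms to
    the order used in the claims.\<close>
  note sym = gram_deriv_commute[of b a d] gram_deriv_commute[of b d a] nabla_gram_commute[of a b d]
      nabla_gram_commute[of d a b] nabla_gram_commute[of d b a]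
    gram_deriv_commute[of d a b] gram_deriv_commute[of a b d] nabla_gram_commute[of b a d]
  show "2 * g\<^sub>1 (p, v) (C (hc a) (hc b) (p, v)) (F.hor (p, v) (c d p))
    = gram_deriv a b d + nabla_gram a b d - nabla_gram a d b"
    using K(1)[OF hc_field hc_field hc_field, of a b d] sym unfolding simps by linarith
  show "g\<^sub>1 (p, v) (C (hc a) (hc b) (p, v)) (F.ver (p, v) (c d p)) = 0"
    using K(1)[OF hc_field hc_field vc_field, of a b d] sym unfolding simps by linarith
  show "2 * g\<^sub>1 (p, v) (C (hc a) (vc b) (p, v)) (F.ver (p, v) (c d p))
    = gram_deriv a b d + nabla_gram a b d - nabla_gram a d b"
    using K(1)[OF hc_field vc_field vc_field, of a b d] sym unfolding simps by linarith
  show "g\<^sub>1 (p, v) (C (hc a) (vc b) (p, v)) (F.hor (p, v) (c d p)) = 0"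
    using K(1)[OF hc_field vc_field hc_field, of a b d] sym unfolding simps by linarith
  show "g\<^sub>1 (p, v) (C (vc a) (hc b) (p, v)) (F.hor (p, v) (c d p)) = 0"
    using K(2)[OF vc_field hc_field hc_field, of a b d] sym unfolding simps by linarith
  show "2 * g\<^sub>1 (p, v) (C (vc a) (hc b) (p, v)) (F.ver (p, v) (c d p))
    = gram_deriv a b d - nabla_gram a b d - nabla_gram a d b"
    using K(2)[OF vc_field hc_field vc_field, of a b d] sym unfolding simps by linarith
  show "2 * g\<^sub>1 (p, v) (C (vc a) (vc b) (p, v)) (F.hor (p, v) (c d p))
    = - (gram_deriv a b d - nabla_gram a b d - nabla_gram a d b)"
    using K(2)[OF vc_field vc_field hc_field, of a b d] sym unfolding simps by linarith
  show "g\<^sub>1 (p, v) (C (vc a) (vc b) (p, v)) (F.ver (p, v) (c d p)) = 0"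
    using K(2)[OF vc_field vc_field vc_field, of a b d] sym unfolding simps by linarith
qed

lemma S_const: "g p (S (c a) (c b) p) (c d p)
    = gram_deriv a b d - nabla_gram a b d - nabla_gram a d b"
proof -
  have "g p (c b p) (nab (c a) (c d) p) = nabla_gram a d b"
    unfolding nabla_gram_def by (rule metric_sym[OF p_carrier const_field_tangent
        nab_const_tangent])
  then show ?thesis
    using metric_S_eq[OF V_open c_field c_field c_field p, of a b d]
        by (simp add: gram_deriv_def nabla_gram_def)
qed

lemma S_const_tangent: "S (c a) (c b) p \<in> tangent_space M p"
  by (rule vector_field_tangent[OF vector_field_S[OF V_open c_field c_field] p])

lemma A_const_tangent: "A (c a) (c b) p \<in> tangent_space M p"
  by (rule vector_field_tangent[OF vector_field_A[OF V_open c_field c_field] p])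

lemma A_const: "2 * g p (A (c a) (c b) p) (c d p)
    = gram_deriv a b d + nabla_gram a b d - nabla_gram a d b"
proof -
  have "g p (A (c a) (c b) p) (c d p) = nabla_gram a b d + 1 / 2 * g p (S (c a) (c b) p) (c d p)"
    unfolding nabla_gram_def A_def using S_const_tangent nab_const_tangent
    by (simp add: metric_add_left[OF p_carrier] metric_scale_left[OF p_carrier])
  then show ?thesis by (simp add: S_const field_simps)
qed

text \<open>The products computed in \<open>chern_components\<close> are those of
  \<open>A_const\<close> and \<open>S_const\<close>, and nondegeneracy turns them into equalities of
  vectors.\<close>

lemma chern_const:
  "C (hc a) (hc b) (p, v) = F.hor (p, v) (A (c a) (c b) p)"
  "C (hc a) (vc b) (p, v) = F.ver (p, v) (A (c a) (c b) p)"
  "C (vc a) (hc b) (p, v) = F.ver (p, v) ((1 / 2) \<cdot> S (c a) (c b) p)"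
  "C (vc a) (vc b) (p, v) = F.hor (p, v) ((- 1 / 2) \<cdot> S (c a) (c b) p)"
proof -
  note t = F.TB.vector_field_tangent[OF K.connection_vector_field[OF W_open] xi_W]
  note st = lift_structure[OF p_carrier v]
  note nondeg = bundle_nondegenerate[OF p_carrier v i_at]
  have A2: "g p (A (c a) (c b) p) (c d p)
      = (gram_deriv a b d + nabla_gram a b d - nabla_gram a d b) / 2" for d
    using A_const[of a b d] by simp
  have comp: "x = y / 2" if "2 * x = y" for x y :: real using that by simp
  note cc = chern_components(2,4,5,8) chern_components(1,3,6,7)[THEN comp]
  show "C (hc a) (hc b) (p, v) = F.hor (p, v) (A (c a) (c b) p)"
    by (rule nondeg) (simp_all add: t hc_field vc_field F.hor_tangent F.ver_tangent v
        A_const_tangent cc st A2)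
  show "C (hc a) (vc b) (p, v) = F.ver (p, v) (A (c a) (c b) p)"
    by (rule nondeg) (simp_all add: t hc_field vc_field F.hor_tangent F.ver_tangent v
        A_const_tangent cc st A2)
  have S2: "g p (r \<cdot> S (c a) (c b) p) (c d p)
      = r * (gram_deriv a b d - nabla_gram a b d - nabla_gram a d b)" for r d
    using S_const[of a b d] by (simp add: metric_scale_left[OF p_carrier] S_const_tangent)
  show "C (vc a) (hc b) (p, v) = F.ver (p, v) ((1 / 2) \<cdot> S (c a) (c b) p)"
    by (rule nondeg) (simp_all add: t hc_field vc_field F.hor_tangent F.ver_tangent v
        S_const_tangent cc st S2
        del: vscale_apply)
  show "C (vc a) (vc b) (p, v) = F.hor (p, v) ((- 1 / 2) \<cdot> S (c a) (c b) p)"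
    by (rule nondeg) (simp_all add: t hc_field vc_field F.hor_tangent F.ver_tangent v
        S_const_tangent cc st S2 field_simps
        del: vscale_apply)
qed

end

end

section \<open>The Chern connection on lifts of arbitrary fields\<close>

context
  fixes i
  assumes i: "i \<in> idx M"
begin

private abbreviation "cf \<equiv> const_field M i"
private abbreviation "V0 \<equiv> cdom M i"
private abbreviation "W0 \<equiv> bundle_over M (cdom M i)"

private lemmas V0 = V_open[OF i] and W0 = W_open[OF i] and cf = c_field[OF i]
  and hcf = hc_field[OF i] and vcf = vc_field[OF i]

text \<open>The first argument is tensorial, so its pointwise expansion in coordinate fields
  suffices.\<close>

lemma chern_lift_left:
  assumes X: "vector_field M V0 X" and p: "p \<in> V0" and v: "v \<in> tangent_space M p"
  shows "C (hlift M nab X) (hlift M nab (cf b)) (p, v) = F.hor (p, v) (A X (cf b) p)"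
    and "C (hlift M nab X) (vlift M (cf b)) (p, v) = F.ver (p, v) (A X (cf b) p)"
    and "C (vlift M X) (hlift M nab (cf b)) (p, v) = F.ver (p, v) ((1 / 2) \<cdot> S X (cf b) p)"
    and "C (vlift M X) (vlift M (cf b)) (p, v) = F.hor (p, v) ((- 1 / 2) \<cdot> S X (cf b) p)"
proof -
  let ?\<xi> = "(p, v)"
  have \<xi>: "?\<xi> \<in> W0" using p v by simp
  have W': "W0 \<subseteq> cdom TM i" "i \<in> idx TM" using i by simp_all
  have Xp: "X p = (\<Sum>a\<in>Basis. (X p i \<bullet> a) \<cdot> cf a p)"
    by (rule vector_field_expand[OF p order_refl i X])
  have h: "hlift M nab X ?\<xi> = (\<Sum>a\<in>Basis. (X p i \<bullet> a) \<cdot> hlift M nab (cf a) ?\<xi>)"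
    unfolding F.hlift_eq_hor fst_conv by (subst Xp) (simp only: F.hor_sum F.hor_scale)
  have ve: "vlift M X ?\<xi> = (\<Sum>a\<in>Basis. (X p i \<bullet> a) \<cdot> vlift M (cf a) ?\<xi>)"
    unfolding F.vlift_eq_ver fst_conv by (subst Xp) (simp only: F.ver_sum F.ver_scale)
  have Ax: "A X (cf b) p = (\<Sum>a\<in>Basis. (X p i \<bullet> a) \<cdot> A (cf a) (cf b) p)"
    by (rule A.connection_lincomb[OF V0 p order_refl i X cf cf Xp])
  have Sx: "S X (cf b) p = (\<Sum>a\<in>Basis. (X p i \<bullet> a) \<cdot> S (cf a) (cf b) p)"
  proof
    fix j show "S X (cf b) p j = (\<Sum>a\<in>Basis. (X p i \<bullet> a) \<cdot> S (cf a) (cf b) p) j"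
      using tensorial_lincomb[OF S_tensorial_left[OF V0 p cf] V0 order_refl i X cf Xp] by simp
  qed
  note hX = F.vector_field_hlift[OF V0 X] and vX = F.vector_field_vlift[OF V0 X]
  note con = chern_const[OF i p v]
  note lin = F.hor_sum F.ver_sum F.hor_scale F.ver_scale vscale_sum_right vscale_simps(4)
      mult.commute
  show "C (hlift M nab X) (hlift M nab (cf b)) ?\<xi> = F.hor ?\<xi> (A X (cf b) p)"
    using K.connection_lincomb[OF W0 \<xi> W' hX hcf hcf h] by (simp only: con Ax lin)
  show "C (hlift M nab X) (vlift M (cf b)) ?\<xi> = F.ver ?\<xi> (A X (cf b) p)"
    using K.connection_lincomb[OF W0 \<xi> W' hX vcf hcf h] by (simp only: con Ax lin)
  show "C (vlift M X) (hlift M nab (cf b)) ?\<xi> = F.ver ?\<xi> ((1 / 2) \<cdot> S X (cf b) p)"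
    using K.connection_lincomb[OF W0 \<xi> W' vX hcf vcf ve] by (simp only: con Sx lin)
  show "C (vlift M X) (vlift M (cf b)) ?\<xi> = F.hor ?\<xi> ((- 1 / 2) \<cdot> S X (cf b) p)"
    using K.connection_lincomb[OF W0 \<xi> W' vX vcf vcf ve] by (simp only: con Sx lin)
qed

text \<open>Leibniz expansion of the second argument. A coefficient \<open>f\<close> pulled back
  from the base has derivative \<open>dir_deriv M X f\<close> along a horizontal lift, matching the
  connection \<open>A\<close>, and \<open>0\<close> along a vertical lift, matching the tensor
  \<open>S\<close>.\<close>

proposition chern_lifts:
  assumes X: "vector_field M V0 X" and Y: "vector_field M V0 Y" and \<xi>: "\<xi> \<in> W0"
  shows "C (hlift M nab X) (hlift M nab Y) \<xi> = hlift M nab (A X Y) \<xi>"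
    and "C (hlift M nab X) (vlift M Y) \<xi> = vlift M (A X Y) \<xi>"
    and "C (vlift M X) (hlift M nab Y) \<xi> = vlift M (\<lambda>q. (1 / 2) \<cdot> S X Y q) \<xi>"
    and "C (vlift M X) (vlift M Y) \<xi> = hlift M nab (\<lambda>q. (- 1 / 2) \<cdot> S X Y q) \<xi>"
proof -
  obtain p v where pv: "\<xi> = (p, v)" and p: "p \<in> V0" and v: "v \<in> tangent_space M p"
    using \<xi> by (cases \<xi>) auto
  let ?y = "\<lambda>b q. Y q i \<bullet> b"
  have y: "smooth_fun M V0 (?y b)" for b
    by (rule smooth_fun_component[OF V0 order_refl i Y])
  have y': "smooth_fun TM W0 (\<lambda>\<zeta>. ?y b (fst \<zeta>))" for b
    by (rule smooth_fun_bundle[OF V0 y])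
  have Yq: "Y q = (\<Sum>b\<in>Basis. ?y b q \<cdot> cf b q)" if "q \<in> V0" for q
    by (rule vector_field_expand[OF that order_refl i Y])
  have h: "hlift M nab Y \<zeta> = (\<Sum>b\<in>Basis. ?y b (fst \<zeta>) \<cdot> hlift M nab (cf b) \<zeta>)" if "\<zeta> \<in> W0" for \<zeta>
  proof -
    have "fst \<zeta> \<in> V0" using that by (cases \<zeta>) auto
    from Yq[OF this] have "F.hor \<zeta> (Y (fst \<zeta>)) = F.hor \<zeta> (\<Sum>b\<in>Basis. ?y b (fst \<zeta>) \<cdot> cf b (fst \<zeta>))"
      by (rule arg_cong)
    then show ?thesis unfolding F.hlift_eq_hor by (simp only: F.hor_sum F.hor_scale)
  qed
  have ve: "vlift M Y \<zeta> = (\<Sum>b\<in>Basis. ?y b (fst \<zeta>) \<cdot> vlift M (cf b) \<zeta>)" if "\<zeta> \<in> W0" for \<zeta>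
  proof -
    have "fst \<zeta> \<in> V0" using that by (cases \<zeta>) auto
    from Yq[OF this] have "F.ver \<zeta> (Y (fst \<zeta>)) = F.ver \<zeta> (\<Sum>b\<in>Basis. ?y b (fst \<zeta>) \<cdot> cf b (fst \<zeta>))"
      by (rule arg_cong)
    then show ?thesis unfolding F.vlift_eq_ver by (simp only: F.ver_sum F.ver_scale)
  qed
  have AXY: "A X Y p = (\<Sum>b\<in>Basis. dir_deriv M X (?y b) p \<cdot> cf b p + ?y b p \<cdot> A X (cf b) p)"
    by (rule A.connection_expand_right[OF V0 p X Y cf y Yq])
  have SXY: "S X Y p = (\<Sum>b\<in>Basis. ?y b p \<cdot> S X (cf b) p)"
  proof
    fix j show "S X Y p j = (\<Sum>b\<in>Basis. ?y b p \<cdot> S X (cf b) p) j"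
      using tensorial_lincomb[OF S_tensorial_right[OF V0 p X] V0 order_refl i Y cf Yq[OF p]] by simp
  qed
  note hX = F.vector_field_hlift[OF V0 X] and vX = F.vector_field_vlift[OF V0 X]
  note hY = F.vector_field_hlift[OF V0 Y] and vY = F.vector_field_vlift[OF V0 Y]
  have dir: "dir_deriv TM (hlift M nab X) (\<lambda>\<zeta>. ?y b (fst \<zeta>)) (p, v) = dir_deriv M X (?y b) p"
    "dir_deriv TM (vlift M X) (\<lambda>\<zeta>. ?y b (fst \<zeta>)) (p, v) = 0" for b
    by (rule F.dir_deriv_lift[where X = X, OF V0 p v vector_field_tangent[OF X p] y])+
  note left = chern_lift_left[OF X p v]
  have \<xi>': "(p, v) \<in> W0" using \<xi> pv by simp
  note lin = F.hor_sum F.ver_sum F.hor_scale F.ver_scale F.hor_add F.ver_add vscale_sum_right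
      vscale_simps(2,4)
    mult.commute add_0_left F.hlift_eq_hor F.vlift_eq_ver fst_conv
  show "C (hlift M nab X) (hlift M nab Y) \<xi> = hlift M nab (A X Y) \<xi>"
    unfolding pv using K.connection_expand_right[OF W0 \<xi>' hX hY hcf y' h]
    by (simp only: dir left) (simp only: AXY lin)
  show "C (hlift M nab X) (vlift M Y) \<xi> = vlift M (A X Y) \<xi>"
    unfolding pv using K.connection_expand_right[OF W0 \<xi>' hX vY vcf y' ve]
    by (simp only: dir left) (simp only: AXY lin)
  show "C (vlift M X) (hlift M nab Y) \<xi> = vlift M (\<lambda>q. (1 / 2) \<cdot> S X Y q) \<xi>"
    unfolding pv using K.connection_expand_right[OF W0 \<xi>' vX hY hcf y' h]
    by (simp only: dir left) (simp only: SXY lin)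
  show "C (vlift M X) (vlift M Y) \<xi> = hlift M nab (\<lambda>q. (- 1 / 2) \<cdot> S X Y q) \<xi>"
    unfolding pv using K.connection_expand_right[OF W0 \<xi>' vX vY vcf y' ve]
    by (simp only: dir left) (simp only: SXY lin)
qed

end

text \<open>\<open>Q\<close> is the operator whose trace decides the Ricci form. In the unmixed
  cases all that matters is that the type, horizontal or vertical, is preserved; in the mixed case
  the type changes and \<open>Q\<close> appears with factors \<open>1 / 2\<close> and
  \<open>- 1 / 2\<close>.\<close>

lemma curvature_lifts:
  assumes i: "i \<in> idx M" and Z: "vector_field M (cdom M i) Z" and p: "p \<in> cdom M i"
      and v: "v \<in> tangent_space M p"
  defines "Q \<equiv> \<lambda>a b. S (nab (const_field M i a) (const_field M i b)) Z p
      - A (const_field M i a) (S (const_field M i b) Z) p + S (const_field M i b) (A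
          (const_field M i a) Z) p"
  shows "\<exists>u\<in>tangent_space M p. curvature TM C (hlift M nab (const_field M i a)) (hlift M nab
      (const_field M i b))
      (hlift M nab Z) (p, v) = F.hor (p, v) u"
    and "\<exists>u\<in>tangent_space M p. curvature TM C (hlift M nab (const_field M i a)) (hlift M nab
        (const_field M i b))
      (vlift M Z) (p, v) = F.ver (p, v) u"
    and "\<exists>u\<in>tangent_space M p. curvature TM C (vlift M (const_field M i a)) (vlift M
        (const_field M i b))
      (hlift M nab Z) (p, v) = F.hor (p, v) u"
    and "\<exists>u\<in>tangent_space M p. curvature TM C (vlift M (const_field M i a)) (vlift M
        (const_field M i b))
      (vlift M Z) (p, v) = F.ver (p, v) u"
    and "curvature TM C (hlift M nab (const_field M i a)) (vlift M (const_field M i b))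
      (hlift M nab Z) (p, v) = F.ver (p, v) ((1 / 2) \<cdot> Q a b)"
    and "curvature TM C (hlift M nab (const_field M i a)) (vlift M (const_field M i b))
      (vlift M Z) (p, v) = F.hor (p, v) ((- 1 / 2) \<cdot> Q a b)"
proof -
  let ?c = "const_field M i" and ?V = "cdom M i" and ?W = "bundle_over M (cdom M i)" and ?\<xi>
      = "(p, v)"
  note V = V_open[OF i] and W = W_open[OF i] and c = c_field[OF i]
  have \<xi>: "?\<xi> \<in> ?W" using p v by simp
  note H = F.vector_field_hlift[OF V] and Ve = F.vector_field_vlift[OF V]
  note vS = vector_field_S[OF V] and vA = vector_field_A[OF V]
  have vs: "vector_field M ?V (\<lambda>q. r \<cdot> S X Y q)" if "vector_field M ?V X" "vector_field M ?V Y"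
      for r X Y
    by (rule vector_field_scale[OF V smooth_fun_const[OF V] vS[OF that]])
  note vn = N.T.connection_vector_field[OF V c c]
  note t = vector_field_tangent[OF _ p]
  note ch = chern_lifts[OF i]
  have at: "C (hlift M nab X) (hlift M nab Y) ?\<xi> = F.hor ?\<xi> (A X Y p)"
    "C (hlift M nab X) (vlift M Y) ?\<xi> = F.ver ?\<xi> (A X Y p)"
    "C (vlift M X) (hlift M nab Y) ?\<xi> = F.ver ?\<xi> ((1 / 2) \<cdot> S X Y p)"
    "C (vlift M X) (vlift M Y) ?\<xi> = F.hor ?\<xi> ((- 1 / 2) \<cdot> S X Y p)"
    if "vector_field M ?V X" "vector_field M ?V Y" for X Y
    unfolding ch[OF that \<xi>] F.hlift_eq_hor F.vlift_eq_ver fst_conv by (rule refl)+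
  \<comment> \<open>The inner derivative is differentiated again, so it is replaced by a lift on all
    of \<open>?W\<close>, not only at the point.\<close>
  have nest: "C X' (C Y' Z') ?\<xi> = C X' R ?\<xi>"
    if "vector_field TM ?W X'" "vector_field TM ?W Y'" "vector_field TM ?W Z'"
        "vector_field TM ?W R"
      "\<And>q. q \<in> ?W \<Longrightarrow> C Y' Z' q = R q" for X' Y' Z' R
    by (rule K.connection_cong[OF W that(1,1) K.connection_vector_field[OF W that(2,3)] that(4)
        refl that(5) \<xi>])
  have zero: "C (lie_bracket TM X' Y') Z' ?\<xi> = 0"
    if "vector_field TM ?W X'" "vector_field TM ?W Y'" "vector_field TM ?W Z'"
      "\<And>q w. q \<in> ?V \<Longrightarrow> w \<in> tangent_space M q \<Longrightarrow> lie_bracket TM X' Y' (q, w) = 0" for X' Y' Z'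
  proof -
    have "C (lie_bracket TM X' Y') Z' ?\<xi> = C 0 Z' ?\<xi>"
      by (rule K.connection_cong[OF W K.vector_field_lie_bracket[OF W that(1,2)]
            F.TB.vector_field_zero[OF W] that(3,3) _ refl \<xi>])
        (use that(4) in \<open>force simp: bundle_over_def\<close>)
    also have "\<dots> = 0" by (rule K.connection_zero_left[OF W that(3) \<xi>])
    finally show ?thesis .
  qed
  \<comment> \<open>The mixed bracket is the vertical lift of \<open>nab (?c a) (?c b)\<close>, the
    source of the first term of \<open>Q\<close>.\<close>
  have bracket: "C (lie_bracket TM (hlift M nab (?c a)) (vlift M (?c b))) Z' ?\<xi>
      = C (vlift M (nab (?c a) (?c b))) Z' ?\<xi>" if "vector_field TM ?W Z'" for Z'
    by (rule K.connection_cong[OF W K.vector_field_lie_bracket[OF W H[OF c] Ve[OF c]] Ve[OF vn]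
        that that _ refl \<xi>])
      (auto simp only: bundle_over_iff split_paired_all bracket_lifts(3)[OF i] F.vlift_eq_ver
          fst_conv)
  have sum: "0 - x + y = y - x" for x y :: "'i \<Rightarrow> 'e \<times> 'e" by simp
  have hh_h: "C (hlift M nab (?c a)) (C (hlift M nab (?c b)) (hlift M nab Z)) ?\<xi>
      = F.hor ?\<xi> (A (?c a) (A (?c b) Z) p)" for a b
    by (rule trans[OF nest[OF H[OF c] H[OF c] H[OF Z] H[OF vA[OF c Z]] ch(1)[OF c Z]] at(1)[OF c
        vA[OF c Z]]])
  have hh_v: "C (hlift M nab (?c a)) (C (hlift M nab (?c b)) (vlift M Z)) ?\<xi>
      = F.ver ?\<xi> (A (?c a) (A (?c b) Z) p)" for a b
    by (rule trans[OF nest[OF H[OF c] H[OF c] Ve[OF Z] Ve[OF vA[OF c Z]] ch(2)[OF c Z]] at(2)[OF c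
        vA[OF c Z]]])
  have vv_h: "C (vlift M (?c a)) (C (vlift M (?c b)) (hlift M nab Z)) ?\<xi>
      = F.hor ?\<xi> ((- 1 / 2) \<cdot> S (?c a) (\<lambda>q. (1 / 2) \<cdot> S (?c b) Z q) p)" for a b
    by (rule trans[OF nest[OF Ve[OF c] Ve[OF c] H[OF Z] Ve[OF vs[OF c Z]] ch(3)[OF c Z]] at(4)[OF c
        vs[OF c Z]]])
  have vv_v: "C (vlift M (?c a)) (C (vlift M (?c b)) (vlift M Z)) ?\<xi>
      = F.ver ?\<xi> ((1 / 2) \<cdot> S (?c a) (\<lambda>q. (- 1 / 2) \<cdot> S (?c b) Z q) p)" for a b
    by (rule trans[OF nest[OF Ve[OF c] Ve[OF c] Ve[OF Z] H[OF vs[OF c Z]] ch(4)[OF c Z]] at(3)[OF c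
        vs[OF c Z]]])
  have hv_h: "C (hlift M nab (?c a)) (C (vlift M (?c b)) (hlift M nab Z)) ?\<xi>
      = F.ver ?\<xi> (A (?c a) (\<lambda>q. (1 / 2) \<cdot> S (?c b) Z q) p)" for a b
    by (rule trans[OF nest[OF H[OF c] Ve[OF c] H[OF Z] Ve[OF vs[OF c Z]] ch(3)[OF c Z]] at(2)[OF c
        vs[OF c Z]]])
  have hv_v: "C (hlift M nab (?c a)) (C (vlift M (?c b)) (vlift M Z)) ?\<xi>
      = F.hor ?\<xi> (A (?c a) (\<lambda>q. (- 1 / 2) \<cdot> S (?c b) Z q) p)" for a b
    by (rule trans[OF nest[OF H[OF c] Ve[OF c] Ve[OF Z] H[OF vs[OF c Z]] ch(4)[OF c Z]] at(1)[OF c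
        vs[OF c Z]]])
  have vh_h: "C (vlift M (?c b)) (C (hlift M nab (?c a)) (hlift M nab Z)) ?\<xi>
      = F.ver ?\<xi> ((1 / 2) \<cdot> S (?c b) (A (?c a) Z) p)" for a b
    by (rule trans[OF nest[OF Ve[OF c] H[OF c] H[OF Z] H[OF vA[OF c Z]] ch(1)[OF c Z]] at(3)[OF c
        vA[OF c Z]]])
  have vh_v: "C (vlift M (?c b)) (C (hlift M nab (?c a)) (vlift M Z)) ?\<xi>
      = F.hor ?\<xi> ((- 1 / 2) \<cdot> S (?c b) (A (?c a) Z) p)" for a b
    by (rule trans[OF nest[OF Ve[OF c] H[OF c] Ve[OF Z] Ve[OF vA[OF c Z]] ch(2)[OF c Z]] at(4)[OF c
        vA[OF c Z]]])
  have R: "curvature TM C X' Y' Z' ?\<xi>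
      = C (lie_bracket TM X' Y') Z' ?\<xi> - C X' (C Y' Z') ?\<xi> + C Y' (C X' Z') ?\<xi>" for X' Y' Z'
    by (simp add: curvature_def)
  show "\<exists>u\<in>tangent_space M p. curvature TM C (hlift M nab (?c a)) (hlift M nab (?c b))
      (hlift M nab Z) ?\<xi> = F.hor ?\<xi> u"
  proof
    show "curvature TM C (hlift M nab (?c a)) (hlift M nab (?c b)) (hlift M nab Z) ?\<xi>
        = F.hor ?\<xi> (A (?c b) (A (?c a) Z) p - A (?c a) (A (?c b) Z) p)"
      by (simp only: R zero[OF H[OF c] H[OF c] H[OF Z] bracket_lifts(1)[OF i]] hh_h sum F.hor_diff)
  qed (intro tangent_diff t vA c Z)
  show "\<exists>u\<in>tangent_space M p. curvature TM C (hlift M nab (?c a)) (hlift M nab (?c b))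
      (vlift M Z) ?\<xi> = F.ver ?\<xi> u"
  proof
    show "curvature TM C (hlift M nab (?c a)) (hlift M nab (?c b)) (vlift M Z) ?\<xi>
        = F.ver ?\<xi> (A (?c b) (A (?c a) Z) p - A (?c a) (A (?c b) Z) p)"
      by (simp only: R zero[OF H[OF c] H[OF c] Ve[OF Z] bracket_lifts(1)[OF i]] hh_v sum F.ver_diff)
  qed (intro tangent_diff t vA c Z)
  show "\<exists>u\<in>tangent_space M p. curvature TM C (vlift M (?c a)) (vlift M (?c b)) (hlift M nab Z) ?\<xi>
      = F.hor ?\<xi> u"
  proof
    show "curvature TM C (vlift M (?c a)) (vlift M (?c b)) (hlift M nab Z) ?\<xi>
        = F.hor ?\<xi> ((- 1 / 2) \<cdot> S (?c b) (\<lambda>q. (1 / 2) \<cdot> S (?c a) Z q) p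
          - (- 1 / 2) \<cdot> S (?c a) (\<lambda>q. (1 / 2) \<cdot> S (?c b) Z q) p)"
      by (simp only: R zero[OF Ve[OF c] Ve[OF c] H[OF Z] bracket_lifts(2)[OF i]] vv_h sum
          F.hor_diff)
  qed (intro tangent_diff tangent_scale t vS vs c Z)
  show "\<exists>u\<in>tangent_space M p. curvature TM C (vlift M (?c a)) (vlift M (?c b)) (vlift M Z) ?\<xi>
      = F.ver ?\<xi> u"
  proof
    show "curvature TM C (vlift M (?c a)) (vlift M (?c b)) (vlift M Z) ?\<xi>
        = F.ver ?\<xi> ((1 / 2) \<cdot> S (?c b) (\<lambda>q. (- 1 / 2) \<cdot> S (?c a) Z q) p
          - (1 / 2) \<cdot> S (?c a) (\<lambda>q. (- 1 / 2) \<cdot> S (?c b) Z q) p)"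
      by (simp only: R zero[OF Ve[OF c] Ve[OF c] Ve[OF Z] bracket_lifts(2)[OF i]] vv_v sum
          F.ver_diff)
  qed (intro tangent_diff tangent_scale t vS vs c Z)
  have half: "A (?c a) (\<lambda>q. r \<cdot> S (?c b) Z q) p = r \<cdot> A (?c a) (S (?c b) Z) p" for r a b
    by (rule A.connection_scale_const_right[OF V c vS[OF c Z] p])
  have b_h: "C (vlift M (nab (?c a) (?c b))) (hlift M nab Z) ?\<xi>
      = F.ver ?\<xi> ((1 / 2) \<cdot> S (nab (?c a) (?c b)) Z p)"
    and b_v: "C (vlift M (nab (?c a) (?c b))) (vlift M Z) ?\<xi>
        = F.hor ?\<xi> ((- 1 / 2) \<cdot> S (nab (?c a) (?c b)) Z p)"
    by (rule at[OF vn Z])+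
  show "curvature TM C (hlift M nab (?c a)) (vlift M (?c b)) (hlift M nab Z) ?\<xi>
      = F.ver ?\<xi> ((1 / 2) \<cdot> Q a b)"
    by (simp only: R bracket[OF H[OF Z]] b_h hv_h vh_h half Q_def vscale_add_right vscale_diff_right
        F.ver_add F.ver_diff)
  show "curvature TM C (hlift M nab (?c a)) (vlift M (?c b)) (vlift M Z) ?\<xi>
      = F.hor ?\<xi> ((- 1 / 2) \<cdot> Q a b)"
    by (simp only: R bracket[OF Ve[OF Z]] b_v hv_v vh_v half Q_def vscale_add_right
        vscale_diff_right
        F.hor_add F.hor_diff)
qed

text \<open>Turns an orthonormal frame of the base into one of the bundle; the flag distinguishes
  horizontal (\<open>True\<close>) from vertical lifts. Pairs as indices avoid enumerating the
  doubled frame by numbers.\<close>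

definition lifted_frame :: "(nat \<Rightarrow> 'm \<Rightarrow> 'i \<Rightarrow> 'e) \<Rightarrow> nat \<times> bool \<Rightarrow> 'm \<times> ('i \<Rightarrow> 'e) \<Rightarrow> 'i \<Rightarrow> 'e \<times> 'e" where
  "lifted_frame E = (\<lambda>(k, b). if b then hlift M nab (E k) else vlift M (E k))"

lemma sum_frame_index: "(\<Sum>f\<in>{..<DIM('e)} \<times> UNIV. h f) = (\<Sum>k<DIM('e). h (k, True) + h (k, False))"
  by (simp add: sum.cartesian_product' UNIV_bool add.commute)

section \<open>The Ricci trace in a frame of lifts\<close>

context
  fixes i p v E
  assumes i: "i \<in> idx M" and p: "p \<in> cdom M i" and v: "v \<in> tangent_space M p"
    and E: "orthonormal_frame M g (cdom M i) E"
begin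

private lemma pc: "p \<in> carrier_of M" using p i by (auto simp: carrier_of_def)

private lemma E_field: "k < DIM('e) \<Longrightarrow> vector_field M (cdom M i) (E k)"
  using E by (simp add: orthonormal_frame_def)

private lemma E_tangent: "k < DIM('e) \<Longrightarrow> E k p \<in> tangent_space M p"
  using vector_field_tangent[OF E_field p] .

lemma lifted_frame_field: "f \<in> {..<DIM('e)} \<times> UNIV \<Longrightarrow>
    vector_field TM (bundle_over M (cdom M i)) (lifted_frame E f)"
  using F.vector_field_hlift[OF V_open[OF i] E_field] F.vector_field_vlift[OF V_open[OF i] E_field]
  by (auto simp: lifted_frame_def)

lemma lifted_frame_at:
  "lifted_frame E (k, True) (p, v) = F.hor (p, v) (E k p)" "lifted_frame E (k, False) (p, v)
      = F.ver (p, v) (E k p)"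
  by (simp_all add: lifted_frame_def F.hlift_eq_hor F.vlift_eq_ver)

lemma lifted_frame_orthonormal:
  assumes "f \<in> {..<DIM('e)} \<times> UNIV" "f' \<in> {..<DIM('e)} \<times> UNIV"
  shows "g\<^sub>1 (p, v) (lifted_frame E f (p, v)) (lifted_frame E f' (p, v)) = (if f = f' then 1 else 0)"
proof -
  obtain k b l b' where [simp]: "f = (k, b)" "f' = (l, b')" by (cases f, cases f')
  have kl: "k < DIM('e)" "l < DIM('e)" using assms by auto
  have "g p (E k p) (E l p) = (if k = l then 1 else 0)"
    using E p kl by (simp add: orthonormal_frame_def)
  then show ?thesis
    using lift_structure[OF pc v E_tangent[OF kl(1)] E_tangent[OF kl(2)]]
    by (cases b; cases b') (simp_all add: lifted_frame_at)
qed

text \<open>Twice the Ricci form, computed at one point in the frame of lifts.\<close>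

private definition tr where
  "tr X Y = (\<Sum>f\<in>{..<DIM('e)} \<times> UNIV. g\<^sub>1 (p, v) (curvature TM C X Y (lifted_frame E f) (p, v)) (J\<^sub>1
      (p, v) (lifted_frame E f (p, v))))"

text \<open>The minus sign is that of \<open>J\<^sub>1\<close> on vertical lifts, pulled out of the
  metric.\<close>

private lemma tr_eq:
  "tr X Y = (\<Sum>k<DIM('e). g\<^sub>1 (p, v) (curvature TM C X Y (hlift M nab (E k)) (p, v)) (F.ver (p, v)
      (E k p))
    - g\<^sub>1 (p, v) (curvature TM C X Y (vlift M (E k)) (p, v)) (F.hor (p, v) (E k p)))"
  if X: "vector_field TM (bundle_over M (cdom M i)) X"
      and Y: "vector_field TM (bundle_over M (cdom M i)) Y"
  unfolding tr_def sum_frame_index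
proof (rule sum.cong[OF refl])
  fix k assume "k \<in> {..<DIM('e)}"
  then have k: "k < DIM('e)" by simp
  have "curvature TM C X Y (vlift M (E k)) (p, v) \<in> tangent_space TM (p, v)"
    by (rule F.TB.vector_field_tangent[OF K.vector_field_curvature[OF W_open[OF i] X Y
            F.vector_field_vlift[OF V_open[OF i] E_field[OF k]]]]) (use p v in simp)
  then show "g\<^sub>1 (p, v) (curvature TM C X Y (lifted_frame E (k, True)) (p, v)) (J\<^sub>1 (p, v)
      (lifted_frame E (k, True) (p, v)))
     + g\<^sub>1 (p, v) (curvature TM C X Y (lifted_frame E (k, False)) (p, v)) (J\<^sub>1 (p, v)
         (lifted_frame E (k, False) (p, v)))
     = g\<^sub>1 (p, v) (curvature TM C X Y (hlift M nab (E k)) (p, v)) (F.ver (p, v) (E k p))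
     - g\<^sub>1 (p, v) (curvature TM C X Y (vlift M (E k)) (p, v)) (F.hor (p, v) (E k p))"
    using lift_structure(1,2)[OF pc v E_tangent[OF k] E_tangent[OF k]]
      G.metric_uminus_right[OF bundle_carrier[OF pc v] F.hor_tangent[OF E_tangent[OF k] v]]
    by (simp add: lifted_frame_at) (simp add: lifted_frame_def)
qed

text \<open>For unmixed pairs the curvature preserves the type, and horizontal is orthogonal to
  vertical, so each summand is zero. For the mixed pair the factors \<open>1 / 2\<close> and
  \<open>- (- 1 / 2)\<close> add up to the trace in \<open>trace_commutator\<close>, with
  \<open>W\<close> the covariant derivative of one coordinate field along the other.\<close>

private lemma tr_lifts:
  assumes tr: "trace_vanishes M g \<gamma>\<^sub>s"
  shows "tr (hlift M nab (const_field M i a)) (hlift M nab (const_field M i b)) = 0"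
    and "tr (vlift M (const_field M i a)) (vlift M (const_field M i b)) = 0"
    and "tr (hlift M nab (const_field M i a)) (vlift M (const_field M i b)) = 0"
proof -
  let ?c = "const_field M i"
  note vf = hc_field[OF i] vc_field[OF i] and st = lift_structure[OF pc v]
  show "tr (hlift M nab (?c a)) (hlift M nab (?c b)) = 0"
    unfolding tr_eq[OF vf(1,1)]
  proof (rule sum.neutral, rule)
    fix k assume "k \<in> {..<DIM('e)}"
    then have k: "k < DIM('e)" by simp
    then show "g\<^sub>1 (p, v) (curvature TM C (hlift M nab (?c a)) (hlift M nab (?c b)) (hlift M nab
        (E k)) (p, v)) (F.ver (p, v) (E k p))
       - g\<^sub>1 (p, v) (curvature TM C (hlift M nab (?c a)) (hlift M nab (?c b)) (vlift M (E k))
           (p, v)) (F.hor (p, v) (E k p)) = 0"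
      using curvature_lifts(1)[OF i E_field[OF k] p v, of a b] curvature_lifts(2)[OF i E_field[OF
          k] p v, of a b]
        st(5,6)[OF _ E_tangent[OF k]] by auto
  qed
  show "tr (vlift M (?c a)) (vlift M (?c b)) = 0"
    unfolding tr_eq[OF vf(2,2)]
  proof (rule sum.neutral, rule)
    fix k assume "k \<in> {..<DIM('e)}"
    then have k: "k < DIM('e)" by simp
    then show "g\<^sub>1 (p, v) (curvature TM C (vlift M (?c a)) (vlift M (?c b)) (hlift M nab (E k))
        (p, v)) (F.ver (p, v) (E k p))
       - g\<^sub>1 (p, v) (curvature TM C (vlift M (?c a)) (vlift M (?c b)) (vlift M (E k)) (p, v))
           (F.hor (p, v) (E k p)) = 0"
      using curvature_lifts(3)[OF i E_field[OF k] p v, of a b] curvature_lifts(4)[OF i E_field[OF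
          k] p v, of a b]
        st(5,6)[OF _ E_tangent[OF k]] by auto
  qed
  define Q where "Q k = S (nab (?c a) (?c b)) (E k) p - A (?c a) (S (?c b) (E k)) p + S (?c b) (A
      (?c a) (E k)) p" for k
  note V = V_open[OF i] and c = c_field[OF i]
  have Q: "Q k \<in> tangent_space M p" if "k < DIM('e)" for k
    unfolding Q_def
    by (intro tangent_add tangent_diff vector_field_tangent[OF _ p] vector_field_S[OF V]
        vector_field_A[OF V] c
        E_field[OF that] N.T.connection_vector_field[OF V])
  have "tr (hlift M nab (?c a)) (vlift M (?c b)) = (\<Sum>k<DIM('e). g p (Q k) (E k p))"
    unfolding tr_eq[OF vf(1,2)]
  proof (rule sum.cong[OF refl])
    fix k assume "k \<in> {..<DIM('e)}"
    then have k: "k < DIM('e)" by simp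
    have sc: "g p (r \<cdot> Q k) (E k p) = r * g p (Q k) (E k p)" for r
      by (rule metric_scale_left[OF pc Q[OF k] E_tangent[OF k]])
    show "g\<^sub>1 (p, v) (curvature TM C (hlift M nab (?c a)) (vlift M (?c b)) (hlift M nab (E k))
        (p, v)) (F.ver (p, v) (E k p))
       - g\<^sub>1 (p, v) (curvature TM C (hlift M nab (?c a)) (vlift M (?c b)) (vlift M (E k)) (p, v))
           (F.hor (p, v) (E k p))
       = g p (Q k) (E k p)"
      unfolding curvature_lifts(5,6)[OF i E_field[OF k] p v, of a b, folded Q_def]
        st(3,4)[OF tangent_scale[OF Q[OF k]] E_tangent[OF k]] sc by simp
  qed
  also have "\<dots> = 0"
    unfolding Q_def by (rule trace_commutator[OF tr E p c c N.T.connection_vector_field[OF V c c]])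
  finally show "tr (hlift M nab (?c a)) (vlift M (?c b)) = 0" .
qed

text \<open>The curvature is tensorial in \<open>X\<close> and \<open>Y\<close>, so both may be
  split at the one point into lifts of coordinate fields. The vertical-horizontal pair reduces to
  the horizontal-vertical one by antisymmetry.\<close>

lemma frame_trace_curvature:
  assumes trace: "trace_vanishes M g \<gamma>\<^sub>s"
      and U: "mopen TM U" "(p, v) \<in> U" "U \<subseteq> bundle_over M (cdom M i)"
    and X: "vector_field TM U X" and Y: "vector_field TM U Y"
  shows "(\<Sum>f\<in>{..<DIM('e)} \<times> UNIV. g\<^sub>1 (p, v) (curvature TM C X Y (lifted_frame E f) (p, v))
    (J\<^sub>1 (p, v) (lifted_frame E f (p, v)))) = 0"
proof -
  let ?c = "const_field M i" and ?\<xi> = "(p, v)"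
  have ch: "i \<in> charts_at M p" using i p by (simp add: charts_at_iff)
  have Ui: "U \<subseteq> cdom TM i" "i \<in> idx TM" using U i by simp_all
  have vf: "vector_field TM U (hlift M nab (?c a))" "vector_field TM U (vlift M (?c a))" for a
    using F.TB.vector_field_subset[OF _ U(3)] hc_field[OF i] vc_field[OF i] by blast+
  have frame: "vector_field TM U (lifted_frame E f)" if "f \<in> {..<DIM('e)} \<times> UNIV" for f
    using F.TB.vector_field_subset[OF lifted_frame_field[OF that] U(3)] .
  obtain a b where ab: "X ?\<xi> = hlift M nab (?c a) ?\<xi> + vlift M (?c b) ?\<xi>"
    using F.lift_decompose[OF F.TB.vector_field_tangent[OF X U(2)] v ch] by blast
  obtain a' b' where ab': "Y ?\<xi> = hlift M nab (?c a') ?\<xi> + vlift M (?c b') ?\<xi>"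
    using F.lift_decompose[OF F.TB.vector_field_tangent[OF Y U(2)] v ch] by blast
  have split1: "curvature TM C X Y Z ?\<xi>
      = curvature TM C (hlift M nab (?c a)) Y Z ?\<xi> + curvature TM C (vlift M (?c b)) Y Z ?\<xi>"
    if "vector_field TM U Z" for Z
    using F.TB.tensorial_split[OF K.curvature_tensorial_1[OF U(1,2) Y that] U(1) Ui X vf ab]
    by (simp add: fun_eq_iff)
  have split2: "curvature TM C X' Y Z ?\<xi>
      = curvature TM C X' (hlift M nab (?c a')) Z ?\<xi> + curvature TM C X' (vlift M (?c b')) Z ?\<xi>"
    if "vector_field TM U X'" "vector_field TM U Z" for X' Z
    using F.TB.tensorial_split[OF K.curvature_tensorial_2[OF U(1,2) that] U(1) Ui Y vf ab']
    by (simp add: fun_eq_iff)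
  have t: "curvature TM C X' Y' (lifted_frame E f) ?\<xi> \<in> tangent_space TM ?\<xi>"
    if "vector_field TM U X'" "vector_field TM U Y'" "f \<in> {..<DIM('e)} \<times> UNIV" for X' Y' f
    using F.TB.vector_field_tangent[OF K.vector_field_curvature[OF U(1) that(1,2) frame[OF
        that(3)]] U(2)] .
  have tJ: "J\<^sub>1 ?\<xi> (lifted_frame E f ?\<xi>) \<in> tangent_space TM ?\<xi>" if f: "f \<in> {..<DIM('e)} \<times> UNIV" for f
  proof -
    obtain k b where kb: "f = (k, b)" "k < DIM('e)" using f by (cases f) auto
    show ?thesis
      using lift_structure(1,2)[OF pc v E_tangent[OF kb(2)] E_tangent[OF kb(2)]] E_tangent[OF
          kb(2)] v
      by (cases b) (simp_all add: kb lifted_frame_at F.hor_tangent F.ver_tangent)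
  qed
  note cp = bundle_carrier[OF pc v]
  have add: "g\<^sub>1 ?\<xi> (u + w) z = g\<^sub>1 ?\<xi> u z + g\<^sub>1 ?\<xi> w z"
    if "u \<in> tangent_space TM ?\<xi>" "w \<in> tangent_space TM ?\<xi>" "z \<in> tangent_space TM ?\<xi>" for u w z
    by (rule G.metric_add_left[OF cp that])
  have "g\<^sub>1 ?\<xi> (curvature TM C X Y (lifted_frame E f) ?\<xi>) (J\<^sub>1 ?\<xi> (lifted_frame E f ?\<xi>))
     = g\<^sub>1 ?\<xi> (curvature TM C (hlift M nab (?c a)) (hlift M nab (?c a')) (lifted_frame E f) ?\<xi>)
         (J\<^sub>1 ?\<xi> (lifted_frame E f ?\<xi>))
     + g\<^sub>1 ?\<xi> (curvature TM C (hlift M nab (?c a)) (vlift M (?c b')) (lifted_frame E f) ?\<xi>) (J\<^sub>1 ?\<xi>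
         (lifted_frame E f ?\<xi>))
     - g\<^sub>1 ?\<xi> (curvature TM C (hlift M nab (?c a')) (vlift M (?c b)) (lifted_frame E f) ?\<xi>) (J\<^sub>1 ?\<xi>
         (lifted_frame E f ?\<xi>))
     + g\<^sub>1 ?\<xi> (curvature TM C (vlift M (?c b)) (vlift M (?c b')) (lifted_frame E f) ?\<xi>) (J\<^sub>1 ?\<xi>
         (lifted_frame E f ?\<xi>))"
    if f: "f \<in> {..<DIM('e)} \<times> UNIV" for f
  proof -
    note fr = frame[OF f]
    have eq: "curvature TM C X Y (lifted_frame E f) ?\<xi>
      = (curvature TM C (hlift M nab (?c a)) (hlift M nab (?c a')) (lifted_frame E f) ?\<xi>
        + curvature TM C (hlift M nab (?c a)) (vlift M (?c b')) (lifted_frame E f) ?\<xi>)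
        + (- curvature TM C (hlift M nab (?c a')) (vlift M (?c b)) (lifted_frame E f) ?\<xi>
        + curvature TM C (vlift M (?c b)) (vlift M (?c b')) (lifted_frame E f) ?\<xi>)"
      by (simp only: split1[OF fr] split2[OF vf(1) fr] split2[OF vf(2) fr]
          K.curvature_swap[OF U(1,2) vf(1) vf(2) fr])
    show ?thesis
      unfolding eq
      by (simp add: add F.TB.tangent_add F.TB.tangent_uminus G.metric_uminus_left[OF cp]
          G.metric_diff_left[OF cp] t[OF _ _ f] vf tJ[OF f]
          del: plus_fun_apply uminus_apply)
  qed
  then have "(\<Sum>f\<in>{..<DIM('e)} \<times> UNIV. g\<^sub>1 ?\<xi> (curvature TM C X Y (lifted_frame E f) ?\<xi>) (J\<^sub>1 ?\<xi>
      (lifted_frame E f ?\<xi>)))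
     = tr (hlift M nab (?c a)) (hlift M nab (?c a')) + tr (hlift M nab (?c a)) (vlift M (?c b'))
      - tr (hlift M nab (?c a')) (vlift M (?c b)) + tr (vlift M (?c b)) (vlift M (?c b'))"
    unfolding tr_def by (simp add: sum.distrib sum_subtractf)
  then show ?thesis by (simp add: tr_lifts[OF trace])
qed

end

text \<open>The Ricci form is taken in an arbitrary orthonormal frame \<open>H\<close>, in general
  not made of lifts. Its summand is bilinear in the frame vector, so an orthogonal change of frame
  leaves the sum unchanged and the frame of lifts can be used.\<close>

theorem ricci_vanishes:
  assumes trace: "trace_vanishes M g \<gamma>\<^sub>s"
  shows "ricci_form_vanishes TM J\<^sub>1 g\<^sub>1 C"
  unfolding ricci_form_vanishes_def
proof (intro allI impI ballI, elim conjE)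
  fix U' H X Y \<xi>
  assume H': "orthonormal_frame TM g\<^sub>1 U' H" and X': "vector_field TM U' X"
      and Y': "vector_field TM U' Y"
    and \<xi>: "\<xi> \<in> U'"
  have U': "mopen TM U'" using H' by (simp add: orthonormal_frame_def)
  have \<xi>c: "\<xi> \<in> carrier_of TM" using F.TB.mopen_carrier[OF U'] \<xi> by blast
  obtain p v where pv: "\<xi> = (p, v)" and pc: "p \<in> carrier_of M" and v: "v \<in> tangent_space M p"
    using \<xi>c by (cases \<xi>) (auto simp: carrier_bundle)
  obtain i where i: "i \<in> idx M" and p: "p \<in> cdom M i"
    using carrier_chart[OF pc] by (auto simp: charts_at_iff)
  obtain E where E: "orthonormal_frame M g (cdom M i) E"
    using exists_orthonormal_frame[OF i] by blast
  define U where "U = U' \<inter> bundle_over M (cdom M i)"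
  have U: "mopen TM U" "\<xi> \<in> U" "U \<subseteq> bundle_over M (cdom M i)" "U \<subseteq> U'"
    using F.TB.mopen_Int[OF U' W_open[OF i]] \<xi> p v by (auto simp: U_def pv)
  have Ui: "U \<subseteq> cdom TM i" "i \<in> idx TM" using U i by simp_all
  have X: "vector_field TM U X" and Y: "vector_field TM U Y"
    using X' Y' F.TB.vector_field_subset[OF _ U(4)] by blast+
  have H: "vector_field TM U (H k)" if "k < DIM('e \<times> 'e)" for k
    using H' F.TB.vector_field_subset[OF _ U(4)] that by (auto simp: orthonormal_frame_def)
  let ?F = "{..<DIM('e)} \<times> (UNIV :: bool set)" and ?f = "\<lambda>f. lifted_frame E f"
  have fr: "vector_field TM U (?f f)" if "f \<in> ?F" for f
    using F.TB.vector_field_subset[OF lifted_frame_field[OF i p v E that] U(3)] .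
  note t = F.TB.vector_field_tangent[OF _ U(2)]
  have F_card: "finite ?F" "card ?F = DIM('e \<times> 'e)"
    by (simp_all add: card_cartesian_product)
  define c where "c k f = g\<^sub>1 \<xi> (H k \<xi>) (?f f \<xi>)" for k f
  define R where "R f = curvature TM C X Y (?f f) \<xi>" for f
  define Jf where "Jf f = J\<^sub>1 \<xi> (?f f \<xi>)" for f
  have H_eq: "H k \<xi> = (\<Sum>f\<in>?F. c k f \<cdot> ?f f \<xi>)" if "k < DIM('e \<times> 'e)" for k
    unfolding c_def
    by (rule G.orthonormal_expand[OF \<xi>c F_card t[OF fr] _ t[OF H[OF that]]])
      (use lifted_frame_orthonormal[OF i p v E] pv in simp_all)
  \<comment> \<open>The expansion of \<open>H k\<close> has constant coefficients and holds at
    \<open>\<xi>\<close> only; tensoriality in the third argument makes that enough.\<close>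
  have curv: "curvature TM C X Y (H k) \<xi> = (\<Sum>f\<in>?F. c k f \<cdot> R f)" if "k < DIM('e \<times> 'e)" for k
  proof
    fix j show "curvature TM C X Y (H k) \<xi> j = (\<Sum>f\<in>?F. c k f \<cdot> R f) j"
      unfolding R_def
      using F.TB.tensorial_lincomb[OF K.curvature_tensorial_3[OF U(1,2) X Y] U(1) Ui H[OF that] fr
          H_eq[OF that]] by simp
  qed
  have JH: "J\<^sub>1 \<xi> (H k \<xi>) = (\<Sum>f\<in>?F. c k f \<cdot> Jf f)" if "k < DIM('e \<times> 'e)" for k
    unfolding Jf_def by (subst H_eq[OF that], rule J_sum[OF \<xi>c t[OF fr]])
  have tR: "R f \<in> tangent_space TM \<xi>" if "f \<in> ?F" for f
    unfolding R_def using t[OF K.vector_field_curvature[OF U(1) X Y fr[OF that]]] .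
  have tJ: "Jf f \<in> tangent_space TM \<xi>" if f: "f \<in> ?F" for f
  proof -
    obtain k b where kb: "f = (k, b)" "k < DIM('e)" using f by (cases f) auto
    have e: "E k p \<in> tangent_space M p"
      using E kb(2) vector_field_tangent[OF _ p] by (auto simp: orthonormal_frame_def)
    show ?thesis
      unfolding Jf_def pv kb(1) using lift_structure(1,2)[OF pc v e e]
      by (cases b) (simp_all add: lifted_frame_at[OF i p v E] F.hor_tangent F.ver_tangent e v)
  qed
  have B: "g\<^sub>1 \<xi> (curvature TM C X Y (H k) \<xi>) (J\<^sub>1 \<xi> (H k \<xi>))
      = (\<Sum>f\<in>?F. \<Sum>f'\<in>?F. c k f * c k f' * g\<^sub>1 \<xi> (R f) (Jf f'))"
    if k: "k < DIM('e \<times> 'e)" for k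
  proof -
    have tJs: "(\<Sum>f\<in>?F. c k f \<cdot> Jf f) \<in> tangent_space TM \<xi>"
      by (intro F.TB.tangent_sum F.TB.tangent_scale tJ)
    have "g\<^sub>1 \<xi> (\<Sum>f\<in>?F. c k f \<cdot> R f) (\<Sum>f\<in>?F. c k f \<cdot> Jf f)
        = (\<Sum>f\<in>?F. g\<^sub>1 \<xi> (c k f \<cdot> R f) (\<Sum>f\<in>?F. c k f \<cdot> Jf f))"
      by (intro G.metric_sum_left[OF \<xi>c tJs] F.TB.tangent_scale tR)
    also have "\<dots> = (\<Sum>f\<in>?F. c k f * (\<Sum>f'\<in>?F. c k f' * g\<^sub>1 \<xi> (R f) (Jf f')))"
    proof (rule sum.cong[OF refl])
      fix f assume f: "f \<in> ?F"
      have "g\<^sub>1 \<xi> (c k f \<cdot> R f) (\<Sum>f\<in>?F. c k f \<cdot> Jf f) = c k f * g\<^sub>1 \<xi> (R f) (\<Sum>f\<in>?F. c k f \<cdot> Jf f)"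
        by (rule G.metric_scale_left[OF \<xi>c tR[OF f] tJs])
      also have "g\<^sub>1 \<xi> (R f) (\<Sum>f\<in>?F. c k f \<cdot> Jf f) = (\<Sum>f'\<in>?F. g\<^sub>1 \<xi> (R f) (c k f' \<cdot> Jf f'))"
        by (intro G.metric_sum_right[OF \<xi>c tR[OF f]] F.TB.tangent_scale tJ)
      also have "\<dots> = (\<Sum>f'\<in>?F. c k f' * g\<^sub>1 \<xi> (R f) (Jf f'))"
        by (intro sum.cong[OF refl] G.metric_scale_right[OF \<xi>c] tJ tR f)
      finally show "g\<^sub>1 \<xi> (c k f \<cdot> R f) (\<Sum>f\<in>?F. c k f \<cdot> Jf f)
          = c k f * (\<Sum>f'\<in>?F. c k f' * g\<^sub>1 \<xi> (R f) (Jf f'))" .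
    qed
    finally show ?thesis
      by (simp only: curv[OF k] JH[OF k] sum_distrib_left mult.assoc)
  qed
  \<comment> \<open>Parseval for the frame \<open>H\<close>, applied to the vectors of the lifted
    frame: the columns of the matrix \<open>c\<close> are orthonormal.\<close>
  have pars: "(\<Sum>k<DIM('e \<times> 'e). c k f * c k f') = (if f = f' then 1 else 0)"
      if f: "f \<in> ?F" "f' \<in> ?F" for f f'
  proof -
    have tH: "H k \<xi> \<in> tangent_space TM \<xi>" if "k \<in> {..<DIM('e \<times> 'e)}" for k
      using t[OF H] that by simp
    have "g\<^sub>1 \<xi> (?f f \<xi>) (?f f' \<xi>) = (\<Sum>k<DIM('e \<times> 'e). g\<^sub>1 \<xi> (?f f \<xi>) (H k \<xi>) * g\<^sub>1 \<xi> (?f f' \<xi>)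
        (H k \<xi>))"
      by (rule G.parseval[OF \<xi>c _ _ tH _ t[OF fr] t[OF fr]])
        (use H' \<xi> f in \<open>auto simp: orthonormal_frame_def\<close>)
    also have "\<dots> = (\<Sum>k<DIM('e \<times> 'e). c k f * c k f')"
      unfolding c_def using f by (intro sum.cong[OF refl] arg_cong2[where f
          = "(*)"] G.metric_sym[OF \<xi>c] t fr tH)
    finally show ?thesis
      using lifted_frame_orthonormal[OF i p v E f] pv by simp
  qed
  have "(\<Sum>k<DIM('e \<times> 'e). g\<^sub>1 \<xi> (curvature TM C X Y (H k) \<xi>) (J\<^sub>1 \<xi> (H k \<xi>)))
      = (\<Sum>k<DIM('e \<times> 'e). \<Sum>f\<in>?F. \<Sum>f'\<in>?F. c k f * c k f' * g\<^sub>1 \<xi> (R f) (Jf f'))"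
    by (intro sum.cong[OF refl] B) simp
  also have "\<dots> = (\<Sum>f\<in>?F. \<Sum>k<DIM('e \<times> 'e). \<Sum>f'\<in>?F. c k f * c k f' * g\<^sub>1 \<xi> (R f) (Jf f'))"
    by (rule sum.swap)
  also have "\<dots> = (\<Sum>f\<in>?F. \<Sum>f'\<in>?F. \<Sum>k<DIM('e \<times> 'e). c k f * c k f' * g\<^sub>1 \<xi> (R f) (Jf f'))"
    by (intro sum.cong[OF refl] sum.swap)
  also have "\<dots> = (\<Sum>f\<in>?F. \<Sum>f'\<in>?F. if f = f' then g\<^sub>1 \<xi> (R f) (Jf f') else 0)"
    by (intro sum.cong[OF refl]) (simp only: sum_distrib_right[symmetric] pars, simp)
  also have "\<dots> = (\<Sum>f\<in>?F. g\<^sub>1 \<xi> (R f) (Jf f))"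
    by (intro sum.cong[OF refl]) (simp add: F_card(1))
  also have "\<dots> = 0"
    unfolding R_def Jf_def pv
    by (rule frame_trace_curvature[OF i p v E trace U(1) U(2)[unfolded pv] U(3) X Y])
  finally show "ricci_form TM J\<^sub>1 g\<^sub>1 C H X Y \<xi> = 0"
    by (simp add: ricci_form_def)
qed

end

theorem proposition5p5:
  fixes M :: "('i, 'm, 'e::euclidean_space) atlas"
    and nab D \<gamma>\<^sub>s :: "('m \<Rightarrow> 'i \<Rightarrow> 'e) \<Rightarrow> ('m \<Rightarrow> 'i \<Rightarrow> 'e) \<Rightarrow> 'm \<Rightarrow> 'i \<Rightarrow> 'e"
    and g :: "'m \<Rightarrow> ('i \<Rightarrow> 'e) \<Rightarrow> ('i \<Rightarrow> 'e) \<Rightarrow> real"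
  assumes "affine_riemann M nab g"
    and "levi_civita M g D"
    and "adjoint_tensor M g (difference_tensor D nab) \<gamma>\<^sub>s"
    and "trace_vanishes M g \<gamma>\<^sub>s"
  shows "(\<forall>X. vector_field M (carrier_of M) X \<longrightarrow> trace_vanishes M g (cov_deriv D X \<gamma>\<^sub>s)) \<and>
    (\<forall>J\<^sub>1 g\<^sub>1 C. canonical_hermitian M nab g J\<^sub>1 g\<^sub>1 \<longrightarrow>
       chern_connection (tangent_bundle M) J\<^sub>1 g\<^sub>1 C \<longrightarrow>
       ricci_form_vanishes (tangent_bundle M) J\<^sub>1 g\<^sub>1 C)"
proof (intro conjI allI impI)
  interpret affine_riemann_adjoint M nab D \<gamma>\<^sub>s g
    using assms by unfold_locales
  show "trace_vanishes M g (cov_deriv D X \<gamma>\<^sub>s)" if "vector_field M (carrier_of M) X" for X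
    by (rule trace_cov_deriv_vanishes[OF assms(4) that])
  fix J\<^sub>1 g\<^sub>1 C
  assume her: "canonical_hermitian M nab g J\<^sub>1 g\<^sub>1"
      and chern: "chern_connection (tangent_bundle M) J\<^sub>1 g\<^sub>1 C"
  from chern obtain LC where LC: "connection (tangent_bundle M) C" "levi_civita
      (tangent_bundle M) g\<^sub>1 LC"
    "\<forall>U X Y Z. mopen (tangent_bundle M) U \<and> vector_field (tangent_bundle M) U X \<and>
       vector_field (tangent_bundle M) U Y \<and> vector_field (tangent_bundle M) U Z \<longrightarrow>
       (\<forall>p\<in>U. g\<^sub>1 p (C X Y p) (Z p) = g\<^sub>1 p (LC X Y p) (Z p)
          - 1 / 2 * ext_deriv (tangent_bundle M) (fundamental_form J\<^sub>1 g\<^sub>1) (\<lambda>q. J\<^sub>1 q (X q)) Y Z p)"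
    unfolding chern_connection_def by blast
  interpret chern_bundle M nab D \<gamma>\<^sub>s g J\<^sub>1 g\<^sub>1 C LC
    by unfold_locales (use her LC in blast)+
  show "ricci_form_vanishes (tangent_bundle M) J\<^sub>1 g\<^sub>1 C"
    by (rule ricci_vanishes[OF assms(4)])
qed

end
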